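(* Let $f:\Sigma\to M^3$ be a mixed type surface in a Lorentzian $3$-manifold $M^3$ and let $p\in\Sigma$ be a lightlike point of the admissible second kind. Then: (i) the lightlike singular curvature $\kappa_L$ tends to $-\infty$ at $p$; (ii) the lightlike normal curvature $\kappa_N$ converges to $0$ or diverges to $\pm\infty$ at $p$. In particular, if $p$ is not an $L_3$-point, then $\kappa_N$ tends to $-\infty$ at $p$.
   Context: All objects are smooth. $(M^3,\bar g)$, $\bar g=\langle\ ,\ \rangle$, is a Lorentzian $3$-manifold (signature $(+,+,-)$) with Levi-Civita connection $\nabla$. A surface is an immersion $f:\Sigma\to M^3$ of a connected $2$-manifold; its first fundamental form is $ds^2=f^*\bar g$. A point $p\in\Sigma$ is spacelike, timelike or lightlike if $(ds^2)_p$ is positive definite, (non-degenerate) indefinite, or degenerate, respectively. $LD$ is the set of lightlike points. The surface is of mixed type if both the spacelike and the timelike point sets are non-empty. In local coordinates $(u,v)$ write $ds^2=E\,du^2+2F\,du\,dv+G\,dv^2$ and $\lambda=EG-F^2$. A lightlike point $p$ is non-degenerate if $d\lambda(p)\ne0$; then near $p$ the set $LD$ is the image of a regular curve $\gamma(t)$, $\gamma(0)=p$, called a characteristic curve. At a lightlike point $p$ the null space $\{\boldsymbol v\in T_p\Sigma: ds^2(\boldsymbol v,\cdot)=0\}$ is one-dimensional and its nonzero elements are null vectors. A null vector field is a smooth vector field $\eta$ on an open set $U\subset\Sigma$ with $\eta_q$ a null vector for each $q\in LD\cap U$; write $\eta(t)=\eta_{\gamma(t)}$. A non-degenerate lightlike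 point $p=\gamma(0)$ is of the first kind (resp. second kind) if $\gamma'(0),\eta(0)$ are linearly independent (resp. dependent). A lightlike point $p$ of the second kind is admissible (i.e. $p$ is of the admissible second kind) if every neighborhood of $p$ contains a lightlike point of the first kind. With $\delta(t)=\det(\gamma'(t),\eta(t))$ (in local coordinates), $p=\gamma(0)$ of the second kind is an $L_k$-point ($k\ge3$) if $\delta(0)=\dots=\delta^{(k-3)}(0)=0$ and $\delta^{(k-2)}(0)\ne0$; in particular it is an $L_3$-point if $\delta(0)=0$, $\delta'(0)\neq0$. Invariants at a lightlike point $q$ of the first kind: put $\hat\gamma=f\circ\gamma$, where $\gamma$ is a characteristic curve with $\gamma(0)=q$ parametrized so that $|\hat\gamma'(t)|=1$ (the curve $\hat\gamma$ is spacelike), and $\boldsymbol e(t)=\hat\gamma'(t)$. Let $\eta$ be a normalized null vector field near $q$, i.e. a null vector field with $\eta\langle df(\eta),df(\eta)\rangle=1$ along $LD$ (it exists and its restriction to $LD$ is unique). Put $L(t)=df(\eta(t))$ and let $N(t)$ be the unique vector field along $\hat\gamma$ with $\langle N,\boldsymbol e\rangle=\langle N,N\rangle=0$, $\langle N,L\rangle=1$. Then $\kappa_L(q)=\langle\nabla_t\boldsymbol e,L\rangle|_{t=0}$ (lightlike singular curvature) and $\kappa_N(q)=\langle\nabla_t\boldsymbol e,N\rangle|_{t=0}$ (lightlike normal curvature). Limits "at $p$" of $\kappa_L,\kappa_N$ are limits along lightlike points of the first kind converging to $p$. "Diverges to $\pm\infty$" means that the absolute value tends to $\infty$ (the sign may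 differ on the two sides of $p$ on the characteristic curve). *)

theory Defs
  imports "HOL-Analysis.Analysis"
begin

section \<open>Smooth maps and smooth manifolds\<close>

text \<open>All notions of smoothness below are used on open sets only.\<close>

fun C_k_on :: "nat \<Rightarrow> ('a::real_normed_vector \<Rightarrow> 'b::real_normed_vector) \<Rightarrow> 'a set \<Rightarrow> bool" where
  "C_k_on 0 h X \<longleftrightarrow> continuous_on X h"
| "C_k_on (Suc k) h X \<longleftrightarrow>
     (\<forall>x\<in>X. h differentiable (at x)) \<and> (\<forall>v. C_k_on k (\<lambda>x. frechet_derivative h (at x) v) X)"

definition smooth_on :: "('a::real_normed_vector \<Rightarrow> 'b::real_normed_vector) \<Rightarrow> 'a set \<Rightarrow> bool" where
  "smooth_on h X \<longleftrightarrow> (\<forall>k. C_k_on k h X)"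

text \<open>A chart is a pair (domain, coordinate map). A manifold is a whole type, carrying its
  topology, together with an atlas.\<close>

type_synonym ('m, 'e) chart = "'m set \<times> ('m \<Rightarrow> 'e)"

abbreviation dom_of :: "('m, 'e) chart \<Rightarrow> 'm set" where "dom_of c \<equiv> fst c"
abbreviation map_of_chart :: "('m, 'e) chart \<Rightarrow> 'm \<Rightarrow> 'e" where "map_of_chart c \<equiv> snd c"

definition inv_chart :: "('m, 'e) chart \<Rightarrow> 'e \<Rightarrow> 'm" where
  "inv_chart c = inv_into (dom_of c) (map_of_chart c)"

definition smooth_atlas :: "('m::topological_space, 'e::euclidean_space) chart set \<Rightarrow> bool" where
  "smooth_atlas A \<longleftrightarrow>
     (\<Union>c\<in>A. dom_of c) = UNIV \<and>
     (\<forall>c\<in>A. open (dom_of c) \<and> open (map_of_chart c ` dom_of c) \<and>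
        homeomorphism (dom_of c) (map_of_chart c ` dom_of c) (map_of_chart c) (inv_chart c)) \<and>
     (\<forall>c\<in>A. \<forall>c'\<in>A.
        smooth_on (map_of_chart c' \<circ> inv_chart c) (map_of_chart c ` (dom_of c \<inter> dom_of c')))"


section \<open>Lorentzian metrics and the Levi-Civita connection\<close>

definition form_of :: "real^3^3 \<Rightarrow> real^3 \<Rightarrow> real^3 \<Rightarrow> real" where
  "form_of G v w = v \<bullet> (G *v w)"

text \<open>A metric is given by its component matrices: \<open>g d\<close> maps the coordinates, with respect to the
  chart \<open>d\<close>, of a point to the matrix of the metric in the coordinate basis; the last clause is the
  transformation law of covariant 2-tensors. The third clause says that there is a basis of the
  tangent space (the columns of \<open>P\<close>) in which the form is \<open>diag (1, 1, -1)\<close>.\<close>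

definition lorentzian_metric ::
  "('m::topological_space, real^3) chart set \<Rightarrow> (('m, real^3) chart \<Rightarrow> real^3 \<Rightarrow> real^3^3) \<Rightarrow> bool" where
  "lorentzian_metric B g \<longleftrightarrow>
     (\<forall>d\<in>B.
        smooth_on (g d) (map_of_chart d ` dom_of d) \<and>
        (\<forall>y \<in> map_of_chart d ` dom_of d. transpose (g d y) = g d y) \<and>
        (\<forall>y \<in> map_of_chart d ` dom_of d. \<exists>P::real^3^3. invertible P \<and>
           transpose P ** g d y ** P =
             (\<chi> i j. if i = j then (if i = 3 then -1 else 1) else 0))) \<and>
     (\<forall>d\<in>B. \<forall>d'\<in>B. \<forall>q \<in> dom_of d \<inter> dom_of d'.
        let J = matrix (frechet_derivative (map_of_chart d' \<circ> inv_chart d) (at (map_of_chart d q)))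
        in g d (map_of_chart d q) = transpose J ** g d' (map_of_chart d' q) ** J)"

definition partial_deriv :: "3 \<Rightarrow> (real^3 \<Rightarrow> real) \<Rightarrow> real^3 \<Rightarrow> real" where
  "partial_deriv i h y = frechet_derivative h (at y) (axis i 1)"

definition christoffel :: "(real^3 \<Rightarrow> real^3^3) \<Rightarrow> real^3 \<Rightarrow> 3 \<Rightarrow> 3 \<Rightarrow> 3 \<Rightarrow> real" where
  "christoffel G y k i j =
     (1/2) * (\<Sum>l\<in>UNIV. matrix_inv (G y) $ k $ l *
        (partial_deriv i (\<lambda>z. G z $ j $ l) y + partial_deriv j (\<lambda>z. G z $ i $ l) y
         - partial_deriv l (\<lambda>z. G z $ i $ j) y))"

text \<open>Covariant derivative at \<open>t\<close> of the vector field \<open>W\<close> along the curve \<open>\<sigma>\<close>, in coordinates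
  in which the metric is \<open>G\<close>.\<close>

definition cov_deriv ::
  "(real^3 \<Rightarrow> real^3^3) \<Rightarrow> (real \<Rightarrow> real^3) \<Rightarrow> (real \<Rightarrow> real^3) \<Rightarrow> real \<Rightarrow> real^3" where
  "cov_deriv G \<sigma> W t = (\<chi> k. vector_derivative W (at t) $ k +
     (\<Sum>i\<in>UNIV. \<Sum>j\<in>UNIV.
        christoffel G (\<sigma> t) k i j * vector_derivative \<sigma> (at t) $ i * W t $ j))"


section \<open>Surfaces in Lorentzian 3-manifolds\<close>

record ('s, 'm) surface =
  surf_atlas :: "('s, real^2) chart set"
  amb_atlas :: "('m, real^3) chart set"
  amb_metric :: "('m, real^3) chart \<Rightarrow> real^3 \<Rightarrow> real^3^3"
  surf_map :: "'s \<Rightarrow> 'm"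

definition coords_at ::
  "('s, 'm) surface \<Rightarrow> 's \<Rightarrow> ('s, real^2) chart \<Rightarrow> ('m, real^3) chart \<Rightarrow> bool" where
  "coords_at S q c d \<longleftrightarrow>
     c \<in> surf_atlas S \<and> q \<in> dom_of c \<and> d \<in> amb_atlas S \<and> surf_map S q \<in> dom_of d"

text \<open>Expression of the map in the charts \<open>c\<close> and \<open>d\<close>, and the coordinate domain on which it is
  meaningful.\<close>

definition loc_dom :: "('s, 'm) surface \<Rightarrow> ('s, real^2) chart \<Rightarrow> ('m, real^3) chart \<Rightarrow> (real^2) set" where
  "loc_dom S c d = map_of_chart c ` (dom_of c \<inter> surf_map S -` dom_of d)"

definition loc_map ::
  "('s, 'm) surface \<Rightarrow> ('s, real^2) chart \<Rightarrow> ('m, real^3) chart \<Rightarrow> real^2 \<Rightarrow> real^3" where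
  "loc_map S c d = map_of_chart d \<circ> surf_map S \<circ> inv_chart c"

definition loc_diff ::
  "('s, 'm) surface \<Rightarrow> ('s, real^2) chart \<Rightarrow> ('m, real^3) chart \<Rightarrow> real^2 \<Rightarrow> real^2 \<Rightarrow> real^3" where
  "loc_diff S c d x = frechet_derivative (loc_map S c d) (at x)"

definition immersed_surface ::
  "('s::topological_space, 'm::topological_space) surface \<Rightarrow> bool" where
  "immersed_surface S \<longleftrightarrow>
     connected (UNIV :: 's set) \<and> smooth_atlas (surf_atlas S) \<and>
     smooth_atlas (amb_atlas S) \<and> lorentzian_metric (amb_atlas S) (amb_metric S) \<and>
     continuous_on UNIV (surf_map S) \<and>
     (\<forall>c \<in> surf_atlas S. \<forall>d \<in> amb_atlas S.
        smooth_on (loc_map S c d) (loc_dom S c d) \<and>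
        (\<forall>x \<in> loc_dom S c d. inj (loc_diff S c d x)))"

text \<open>First fundamental form at the point with coordinates \<open>x\<close>; vectors are given by their
  components with respect to \<open>c\<close>.\<close>

definition first_form ::
  "('s, 'm) surface \<Rightarrow> ('s, real^2) chart \<Rightarrow> ('m, real^3) chart \<Rightarrow> real^2 \<Rightarrow> real^2 \<Rightarrow> real^2 \<Rightarrow> real" where
  "first_form S c d x v w =
     form_of (amb_metric S d (loc_map S c d x)) (loc_diff S c d x v) (loc_diff S c d x w)"

text \<open>The notions below do not depend on the coordinates; they are defined by means of some charts
  around the point in question (equivalently, arbitrary ones).\<close>

definition spacelike_point :: "('s, 'm) surface \<Rightarrow> 's \<Rightarrow> bool" where
  "spacelike_point S q \<longleftrightarrow> (\<exists>c d. coords_at S q c d \<and>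
     (\<forall>v. v \<noteq> 0 \<longrightarrow> first_form S c d (map_of_chart c q) v v > 0))"

definition timelike_point :: "('s, 'm) surface \<Rightarrow> 's \<Rightarrow> bool" where
  "timelike_point S q \<longleftrightarrow> (\<exists>c d. coords_at S q c d \<and>
     (\<forall>v. v \<noteq> 0 \<longrightarrow> (\<exists>w. first_form S c d (map_of_chart c q) v w \<noteq> 0)) \<and>
     (\<exists>v. first_form S c d (map_of_chart c q) v v > 0) \<and>
     (\<exists>v. first_form S c d (map_of_chart c q) v v < 0))"

definition lightlike_point :: "('s, 'm) surface \<Rightarrow> 's \<Rightarrow> bool" where
  "lightlike_point S q \<longleftrightarrow> (\<exists>c d. coords_at S q c d \<and>
     (\<exists>v. v \<noteq> 0 \<and> (\<forall>w. first_form S c d (map_of_chart c q) v w = 0)))"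

definition LD :: "('s, 'm) surface \<Rightarrow> 's set" where
  "LD S = {q. lightlike_point S q}"

definition mixed_type_surface ::
  "('s::topological_space, 'm::topological_space) surface \<Rightarrow> bool" where
  "mixed_type_surface S \<longleftrightarrow>
     immersed_surface S \<and> (\<exists>q. spacelike_point S q) \<and> (\<exists>q. timelike_point S q)"


section \<open>Non-degenerate lightlike points\<close>

definition lam :: "('s, 'm) surface \<Rightarrow> ('s, real^2) chart \<Rightarrow> ('m, real^3) chart \<Rightarrow> real^2 \<Rightarrow> real" where
  "lam S c d x =
     (let E = first_form S c d x (axis 1 1) (axis 1 1);
          F = first_form S c d x (axis 1 1) (axis 2 1);
          G = first_form S c d x (axis 2 1) (axis 2 1)
      in E * G - F\<^sup>2)"

definition nondegenerate_point :: "('s, 'm) surface \<Rightarrow> 's \<Rightarrow> bool" where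
  "nondegenerate_point S q \<longleftrightarrow> lightlike_point S q \<and>
     (\<exists>c d. coords_at S q c d \<and> frechet_derivative (lam S c d) (at (map_of_chart c q)) \<noteq> (\<lambda>v. 0))"

definition char_curve ::
  "('s::topological_space, 'm) surface \<Rightarrow> 's \<Rightarrow> (real \<Rightarrow> 's) \<Rightarrow> real \<Rightarrow> bool" where
  "char_curve S q \<gamma> \<epsilon> \<longleftrightarrow>
     \<epsilon> > 0 \<and> \<gamma> 0 = q \<and> continuous_on {-\<epsilon><..<\<epsilon>} \<gamma> \<and>
     (\<forall>c \<in> surf_atlas S.
        smooth_on (map_of_chart c \<circ> \<gamma>) ({-\<epsilon><..<\<epsilon>} \<inter> \<gamma> -` dom_of c) \<and>
        (\<forall>t \<in> {-\<epsilon><..<\<epsilon>} \<inter> \<gamma> -` dom_of c. vector_derivative (map_of_chart c \<circ> \<gamma>) (at t) \<noteq> 0)) \<and>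
     (\<exists>W. open W \<and> q \<in> W \<and> LD S \<inter> W = \<gamma> ` {-\<epsilon><..<\<epsilon>})"

text \<open>\<open>\<eta>\<close> is the coordinate expression of a null vector field on the open set with coordinate
  image \<open>U\<close>.\<close>

definition null_field ::
  "('s, 'm) surface \<Rightarrow> ('s, real^2) chart \<Rightarrow> ('m, real^3) chart \<Rightarrow> (real^2) set \<Rightarrow>
   (real^2 \<Rightarrow> real^2) \<Rightarrow> bool" where
  "null_field S c d U \<eta> \<longleftrightarrow>
     open U \<and> U \<subseteq> loc_dom S c d \<and> smooth_on \<eta> U \<and>
     (\<forall>x\<in>U. inv_chart c x \<in> LD S \<longrightarrow>
        \<eta> x \<noteq> 0 \<and> (\<forall>w. first_form S c d x (\<eta> x) w = 0))"

text \<open>Charts \<open>c\<close>, \<open>d\<close> around \<open>q\<close> and its image, a characteristic curve \<open>\<gamma>\<close> through \<open>q\<close> (on the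
  interval of radius \<open>\<epsilon>\<close>), and a null vector field \<open>\<eta>\<close> defined along it.\<close>

definition adapted ::
  "('s::topological_space, 'm) surface \<Rightarrow> 's \<Rightarrow> ('s, real^2) chart \<Rightarrow> ('m, real^3) chart \<Rightarrow>
   (real \<Rightarrow> 's) \<Rightarrow> real \<Rightarrow> (real^2) set \<Rightarrow> (real^2 \<Rightarrow> real^2) \<Rightarrow> bool" where
  "adapted S q c d \<gamma> \<epsilon> U \<eta> \<longleftrightarrow>
     coords_at S q c d \<and> char_curve S q \<gamma> \<epsilon> \<and> null_field S c d U \<eta> \<and>
     (\<forall>t \<in> {-\<epsilon><..<\<epsilon>}. \<gamma> t \<in> dom_of c \<and> map_of_chart c (\<gamma> t) \<in> U)"

definition velocity :: "('s, real^2) chart \<Rightarrow> (real \<Rightarrow> 's) \<Rightarrow> real \<Rightarrow> real^2" where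
  "velocity c \<gamma> t = vector_derivative (map_of_chart c \<circ> \<gamma>) (at t)"

definition field_along :: "('s, real^2) chart \<Rightarrow> (real \<Rightarrow> 's) \<Rightarrow> (real^2 \<Rightarrow> real^2) \<Rightarrow> real \<Rightarrow> real^2" where
  "field_along c \<gamma> \<eta> t = \<eta> (map_of_chart c (\<gamma> t))"

definition lin_indep_pair :: "real^2 \<Rightarrow> real^2 \<Rightarrow> bool" where
  "lin_indep_pair v w \<longleftrightarrow> (\<forall>a b. a *\<^sub>R v + b *\<^sub>R w = 0 \<longrightarrow> a = 0 \<and> b = 0)"

definition first_kind :: "('s::topological_space, 'm) surface \<Rightarrow> 's \<Rightarrow> bool" where
  "first_kind S q \<longleftrightarrow> nondegenerate_point S q \<and>
     (\<exists>c d \<gamma> \<epsilon> U \<eta>. adapted S q c d \<gamma> \<epsilon> U \<eta> \<and>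
        lin_indep_pair (velocity c \<gamma> 0) (field_along c \<gamma> \<eta> 0))"

definition second_kind :: "('s::topological_space, 'm) surface \<Rightarrow> 's \<Rightarrow> bool" where
  "second_kind S q \<longleftrightarrow> nondegenerate_point S q \<and>
     (\<exists>c d \<gamma> \<epsilon> U \<eta>. adapted S q c d \<gamma> \<epsilon> U \<eta> \<and>
        \<not> lin_indep_pair (velocity c \<gamma> 0) (field_along c \<gamma> \<eta> 0))"

definition admissible_second_kind :: "('s::topological_space, 'm) surface \<Rightarrow> 's \<Rightarrow> bool" where
  "admissible_second_kind S p \<longleftrightarrow> second_kind S p \<and>
     (\<forall>W. open W \<and> p \<in> W \<longrightarrow> (\<exists>q\<in>W. first_kind S q))"

definition delta :: "('s, real^2) chart \<Rightarrow> (real \<Rightarrow> 's) \<Rightarrow> (real^2 \<Rightarrow> real^2) \<Rightarrow> real \<Rightarrow> real" where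
  "delta c \<gamma> \<eta> t =
     velocity c \<gamma> t $ 1 * field_along c \<gamma> \<eta> t $ 2 - velocity c \<gamma> t $ 2 * field_along c \<gamma> \<eta> t $ 1"

definition L_point :: "('s::topological_space, 'm) surface \<Rightarrow> nat \<Rightarrow> 's \<Rightarrow> bool" where
  "L_point S k p \<longleftrightarrow> k \<ge> 3 \<and> second_kind S p \<and>
     (\<exists>c d \<gamma> \<epsilon> U \<eta>. adapted S p c d \<gamma> \<epsilon> U \<eta> \<and>
        (\<forall>j \<le> k - 3. (deriv ^^ j) (delta c \<gamma> \<eta>) 0 = 0) \<and>
        (deriv ^^ (k - 2)) (delta c \<gamma> \<eta>) 0 \<noteq> 0)"


section \<open>Lightlike singular curvature and lightlike normal curvature\<close>

text \<open>The curve \<open>f \<circ> \<gamma>\<close> in the chart \<open>d\<close>, its velocity \<open>e\<close>, and the field \<open>L = df(\<eta>)\<close> along it.\<close>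

definition space_curve :: "('s, 'm) surface \<Rightarrow> ('m, real^3) chart \<Rightarrow> (real \<Rightarrow> 's) \<Rightarrow> real \<Rightarrow> real^3" where
  "space_curve S d \<gamma> t = map_of_chart d (surf_map S (\<gamma> t))"

definition e_field :: "('s, 'm) surface \<Rightarrow> ('m, real^3) chart \<Rightarrow> (real \<Rightarrow> 's) \<Rightarrow> real \<Rightarrow> real^3" where
  "e_field S d \<gamma> t = vector_derivative (space_curve S d \<gamma>) (at t)"

definition L_field ::
  "('s, 'm) surface \<Rightarrow> ('s, real^2) chart \<Rightarrow> ('m, real^3) chart \<Rightarrow> (real \<Rightarrow> 's) \<Rightarrow>
   (real^2 \<Rightarrow> real^2) \<Rightarrow> real \<Rightarrow> real^3" where
  "L_field S c d \<gamma> \<eta> t = loc_diff S c d (map_of_chart c (\<gamma> t)) (field_along c \<gamma> \<eta> t)"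

definition metric_along ::
  "('s, 'm) surface \<Rightarrow> ('m, real^3) chart \<Rightarrow> (real \<Rightarrow> 's) \<Rightarrow> real \<Rightarrow> real^3 \<Rightarrow> real^3 \<Rightarrow> real" where
  "metric_along S d \<gamma> t = form_of (amb_metric S d (space_curve S d \<gamma> t))"

definition normalized_null_field ::
  "('s, 'm) surface \<Rightarrow> ('s, real^2) chart \<Rightarrow> ('m, real^3) chart \<Rightarrow> (real^2) set \<Rightarrow>
   (real^2 \<Rightarrow> real^2) \<Rightarrow> bool" where
  "normalized_null_field S c d U \<eta> \<longleftrightarrow> null_field S c d U \<eta> \<and>
     (\<forall>x\<in>U. inv_chart c x \<in> LD S \<longrightarrow>
        frechet_derivative (\<lambda>z. first_form S c d z (\<eta> z) (\<eta> z)) (at x) (\<eta> x) = 1)"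

definition curvature_frame ::
  "('s::topological_space, 'm) surface \<Rightarrow> 's \<Rightarrow> ('s, real^2) chart \<Rightarrow> ('m, real^3) chart \<Rightarrow>
   (real \<Rightarrow> 's) \<Rightarrow> real \<Rightarrow> (real^2) set \<Rightarrow> (real^2 \<Rightarrow> real^2) \<Rightarrow> bool" where
  "curvature_frame S q c d \<gamma> \<epsilon> U \<eta> \<longleftrightarrow>
     adapted S q c d \<gamma> \<epsilon> U \<eta> \<and> normalized_null_field S c d U \<eta> \<and>
     (\<forall>t \<in> {-\<epsilon><..<\<epsilon>}. metric_along S d \<gamma> t (e_field S d \<gamma> t) (e_field S d \<gamma> t) = 1)"

definition N_field ::
  "('s, 'm) surface \<Rightarrow> ('s, real^2) chart \<Rightarrow> ('m, real^3) chart \<Rightarrow> (real \<Rightarrow> 's) \<Rightarrow> real \<Rightarrow>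
   (real^2 \<Rightarrow> real^2) \<Rightarrow> (real \<Rightarrow> real^3) \<Rightarrow> bool" where
  "N_field S c d \<gamma> \<epsilon> \<eta> N \<longleftrightarrow>
     (\<forall>t \<in> {-\<epsilon><..<\<epsilon>}.
        metric_along S d \<gamma> t (N t) (e_field S d \<gamma> t) = 0 \<and>
        metric_along S d \<gamma> t (N t) (N t) = 0 \<and>
        metric_along S d \<gamma> t (N t) (L_field S c d \<gamma> \<eta> t) = 1)"

text \<open>The values are independent of all the choices made; they are meaningful at lightlike points of
  the first kind.\<close>

definition kappa_L :: "('s::topological_space, 'm) surface \<Rightarrow> 's \<Rightarrow> real" where
  "kappa_L S q = (THE k. \<exists>c d \<gamma> \<epsilon> U \<eta>. curvature_frame S q c d \<gamma> \<epsilon> U \<eta> \<and>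
     k = metric_along S d \<gamma> 0
           (cov_deriv (amb_metric S d) (space_curve S d \<gamma>) (e_field S d \<gamma>) 0)
           (L_field S c d \<gamma> \<eta> 0))"

definition kappa_N :: "('s::topological_space, 'm) surface \<Rightarrow> 's \<Rightarrow> real" where
  "kappa_N S q = (THE k. \<exists>c d \<gamma> \<epsilon> U \<eta> N. curvature_frame S q c d \<gamma> \<epsilon> U \<eta> \<and>
     N_field S c d \<gamma> \<epsilon> \<eta> N \<and>
     k = metric_along S d \<gamma> 0
           (cov_deriv (amb_metric S d) (space_curve S d \<gamma>) (e_field S d \<gamma>) 0)
           (N 0))"

text \<open>Limits at \<open>p\<close> are taken along lightlike points of the first kind.\<close>

definition first_kind_near :: "('s::topological_space, 'm) surface \<Rightarrow> 's \<Rightarrow> 's filter" where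
  "first_kind_near S p = at p within {q. first_kind S q}"

end

theory Submission
  imports Defs
begin

text \<open>
  Let \<open>x(t)\<close> be the characteristic curve through \<open>p\<close> in a chart, with first fundamental form \<open>g\<close>. Fix a
  constant vector \<open>\<xi>\<close> that is not null at \<open>p\<close> and write \<open>x' = E + b \<xi>\<close> with \<open>E\<close> null. Then \<open>b\<close> is a
  nonvanishing multiple of \<open>\<delta>\<close>, so \<open>b = 0\<close> at \<open>p\<close> and \<open>b \<noteq> 0\<close> at points of the first kind. Put
  \<open>w = g(\<xi>, \<xi>) > 0\<close> and \<open>\<nu> = (\<partial>\<^sub>\<xi> g)(E, E)\<close>; non-degeneracy gives \<open>\<nu> \<noteq> 0\<close> at \<open>p\<close>. Differentiating
  \<open>g(E, E) = 0\<close> along the curve yields \<open>(\<partial>\<^sub>E g)(E, E) = - b \<nu>\<close>, so the normalized null vector is \<open>E\<close>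
  divided by the cube root of \<open>- b \<nu>\<close>. Computing both curvatures in terms of the smooth functions of
  \<open>t\<close> involved gives
  \<open>\<kappa>\<^sub>L^3 = - (\<nu>/2 + O(b))^3 / (b^4 w^3 \<nu>)\<close> and \<open>\<kappa>\<^sub>N^3 = - \<nu> M^3 / (8 b^8 w^6)\<close>, where
  \<open>M = \<nu>/2 - 2 b' w + O(b)\<close> is smooth. At an \<open>L\<^sub>3\<close>-point \<open>b\<close> vanishes to first order, and the order of
  vanishing of \<open>M\<close> (at most 2, or at least 3) decides between divergence and convergence to \<open>0\<close>; otherwise
  \<open>b' = 0\<close> and \<open>M = \<nu>/2\<close> at \<open>p\<close>.
\<close>

section \<open>Smooth functions\<close>

text \<open>The curvatures are definite descriptions over all charts, unit-speed characteristic
  curves and normalized null fields at a point, while the limits need one formula that stays smooth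
  up to \<open>p\<close>. Neither normalization survives at \<open>p\<close>: the velocity is null
  there, so arc length breaks down, and the factor normalizing the null vector blows up. Hence the
  curve through \<open>p\<close> keeps an arbitrary regular parameter, and each frame at a nearby
  point is translated into it. The translation compares 2-jets only: two curves in the zero set of
  \<open>lam\<close> through a common point agree to second order up to reparametrization, because
  the differential of \<open>lam\<close> does not vanish there. Both curvatures pair the
  acceleration with a vector orthogonal to the velocity, so the tangential discrepancy disappears
  and only a division by the squared speed remains. The first curvature is intrinsic and is computed
  on the surface with lowered Christoffel symbols. The second needs a transversal null vector; the
  one belonging to a frame degenerates at \<open>p\<close>, so it is expressed through a smooth null
  vector \<open>n\<close> adapted to \<open>E\<close> and \<open>\<xi>\<close>.\<close>

abbreviation FD :: "('a::real_normed_vector \<Rightarrow> 'b::real_normed_vector) \<Rightarrow> 'a \<Rightarrow> 'a \<Rightarrow> 'b" where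
  "FD h x \<equiv> frechet_derivative h (at x)"

lemma FD_eqI: "(h has_derivative h') (at x) \<Longrightarrow> FD h x = h'"
  using frechet_derivative_at by metis

section \<open>Calculus of C^k maps on open sets\<close>

lemma C_k_on_Suc_D: "C_k_on (Suc k) h X \<Longrightarrow> C_k_on k h X"
proof (induction k arbitrary: h)
  case 0
  then show ?case
    by (auto intro!: continuous_at_imp_continuous_on differentiable_imp_continuous_within)
next
  case (Suc k)
  then show ?case by simp
qed

lemma C_k_on_cong:
  assumes "open X" "\<And>x. x \<in> X \<Longrightarrow> h x = h' x" "C_k_on k h X"
  shows "C_k_on k h' X"
  using assms(2,3)
proof (induction k arbitrary: h h')
  case 0
  then show ?case by (auto intro: continuous_on_eq)
next
  case (Suc k)
  have *: "(h' has_derivative FD h x) (at x)" if "x \<in> X" for x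
  proof (rule has_derivative_transform_within_open[OF _ assms(1) that])
    show "(h has_derivative FD h x) (at x)"
      using Suc.prems(2) that frechet_derivative_works by fastforce
  qed (use Suc.prems in auto)
  have "C_k_on k (\<lambda>x. FD h' x v) X" for v
    by (rule Suc.IH[of "\<lambda>x. FD h x v"]) (use Suc.prems(2) FD_eqI[OF *] in auto)
  then show ?case using * by (auto simp: differentiable_def)
qed

text \<open>\<open>C_k_on\<close> is phrased with the total function
  \<open>frechet_derivative\<close>. On an open set any explicit candidate \<open>h'\<close> may
  take its place, so the inductions below can work with computed product, chain and quotient
  rules.\<close>

lemma C_k_on_SucI:
  assumes "open X" "\<And>x. x \<in> X \<Longrightarrow> (h has_derivative h' x) (at x)"
    and "\<And>v. C_k_on k (\<lambda>x. h' x v) X"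
  shows "C_k_on (Suc k) h X"
proof -
  have "C_k_on k (\<lambda>x. FD h x v) X" for v
    by (rule C_k_on_cong[OF assms(1) _ assms(3)[of v]]) (simp add: FD_eqI[OF assms(2)])
  then show ?thesis using assms(2) by (auto simp: differentiable_def)
qed

lemma C_k_on_Suc_has_derivative:
  "C_k_on (Suc k) h X \<Longrightarrow> x \<in> X \<Longrightarrow> (h has_derivative FD h x) (at x)"
  using frechet_derivative_works by fastforce

lemma C_k_on_const: "open X \<Longrightarrow> C_k_on k (\<lambda>x. c) X"
proof (induction k arbitrary: c)
  case (Suc k)
  then show ?case by (intro C_k_on_SucI[where h' = "\<lambda>x v. 0"]) auto
qed auto

lemma C_k_on_bounded_linear:
  assumes "open X" "bounded_linear f"
  shows "C_k_on k f X"
proof (cases k)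
  case 0
  then show ?thesis using assms(2) linear_continuous_on by auto
next
  case (Suc k)
  have "C_k_on (Suc k) f X"
  proof (rule C_k_on_SucI[where h' = "\<lambda>x. f"])
    show "C_k_on k (\<lambda>x. f v) X" for v using C_k_on_const assms by blast
  qed (use assms bounded_linear_imp_has_derivative in auto)
  then show ?thesis using Suc by simp
qed

lemma C_k_on_add:
  assumes "open X" "C_k_on k f X" "C_k_on k g X"
  shows "C_k_on k (\<lambda>x. f x + g x) X"
  using assms(2,3)
proof (induction k arbitrary: f g)
  case (Suc k)
  show ?case
  proof (rule C_k_on_SucI[OF assms(1), where h' = "\<lambda>x v. FD f x v + FD g x v"])
    show "C_k_on k (\<lambda>x. FD f x v + FD g x v) X" for v
      using Suc by auto
  qed (use Suc.prems[THEN C_k_on_Suc_has_derivative] in \<open>auto intro!: derivative_eq_intros\<close>)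
qed (auto intro: continuous_intros)

lemma C_k_on_sum:
  assumes "open X" "\<And>i. i \<in> I \<Longrightarrow> C_k_on k (f i) X"
  shows "C_k_on k (\<lambda>x. \<Sum>i\<in>I. f i x) X"
  using assms(2)
  by (induction I rule: infinite_finite_induct) (simp_all add: C_k_on_const C_k_on_add assms(1))

lemma C_k_on_bilinear:
  assumes "bounded_bilinear pr" "open X" "C_k_on k f X" "C_k_on k g X"
  shows "C_k_on k (\<lambda>x. pr (f x) (g x)) X"
  using assms(3,4)
proof (induction k arbitrary: f g)
  case 0
  then show ?case using bounded_bilinear.continuous_on[OF assms(1)] by auto
next
  case (Suc k)
  show ?case
  proof (rule C_k_on_SucI[OF assms(2), where h' = "\<lambda>x v. pr (f x) (FD g x v) + pr (FD f x v) (g x)"])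
    show "C_k_on k (\<lambda>x. pr (f x) (FD g x v) + pr (FD f x v) (g x)) X" for v
      using Suc Suc.prems[THEN C_k_on_Suc_D] by (intro C_k_on_add assms(2)) auto
  qed (use Suc.prems[THEN C_k_on_Suc_has_derivative] bounded_bilinear.FDERIV[OF assms(1)] in blast)
qed

text \<open>\<open>C_k_on\<close> differentiates in constant directions, but the chain rule
  evaluates the derivative of \<open>g\<close> in the direction \<open>FD f x v\<close>, which moves
  with \<open>x\<close>. Expanding that direction in the basis leaves constant directions with C^k
  coefficients, to which the induction applies.\<close>

lemma C_k_on_compose:
  fixes f :: "'a::real_normed_vector \<Rightarrow> 'b::euclidean_space"
  assumes "open X" "open Y" "f ` X \<subseteq> Y" "C_k_on k g Y" "C_k_on k f X"
  shows "C_k_on k (\<lambda>x. g (f x)) X"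
  using assms(4,5)
proof (induction k arbitrary: g)
  case 0
  then show ?case using continuous_on_compose2 assms(3) by auto
next
  case (Suc k)
  let ?D = "\<lambda>x v. \<Sum>i\<in>Basis. (FD f x v \<bullet> i) *\<^sub>R FD g (f x) i"
  show ?case
  proof (rule C_k_on_SucI[OF assms(1), where h' = ?D])
    fix x assume x: "x \<in> X"
    have f: "(f has_derivative FD f x) (at x)" and g: "(g has_derivative FD g (f x)) (at (f x))"
      using Suc.prems C_k_on_Suc_has_derivative x assms(3) by blast+
    have "((\<lambda>x. g (f x)) has_derivative (\<lambda>v. FD g (f x) (FD f x v))) (at x)"
      using has_derivative_compose[OF f g] by simp
    moreover have "FD g (f x) (FD f x v) = ?D x v" for v
    proof -
      have lin: "linear (FD g (f x))" using g has_derivative_linear by blast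
      have "FD g (f x) (\<Sum>i\<in>Basis. (FD f x v \<bullet> i) *\<^sub>R i) = ?D x v"
        by (simp add: linear_sum[OF lin] linear_scale[OF lin])
      then show ?thesis by (simp add: euclidean_representation)
    qed
    ultimately show "((\<lambda>x. g (f x)) has_derivative ?D x) (at x)" by simp
  next
    fix v
    have "C_k_on k (\<lambda>x. FD g (f x) i) X" for i
      using Suc C_k_on_Suc_D[OF Suc.prems(2)] by (intro Suc.IH[of "\<lambda>y. FD g y i"]) auto
    moreover have "C_k_on k (\<lambda>x. FD f x v \<bullet> i) X" for i
      using Suc.prems(2)
      by (intro C_k_on_bilinear[OF bounded_bilinear_inner assms(1)] C_k_on_const assms(1)) auto
    ultimately show "C_k_on k (\<lambda>x. ?D x v) X"
      by (intro C_k_on_sum C_k_on_bilinear[OF bounded_bilinear_scaleR] assms(1)) auto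
  qed
qed

text \<open>Bootstrapping: as soon as \<open>\<phi>\<close> is C^k, so is its derivative
  \<open>g \<circ> \<phi>\<close>, and \<open>\<phi>\<close> gains one order.\<close>

lemma C_k_on_autonomous:
  fixes \<phi> g :: "real \<Rightarrow> real"
  assumes "open X" "\<And>x. x \<in> X \<Longrightarrow> (\<phi> has_real_derivative g (\<phi> x)) (at x)"
    and "open Y" "\<phi> ` X \<subseteq> Y" "C_k_on k g Y"
  shows "C_k_on k \<phi> X"
  using assms(5)
proof (induction k)
  case 0
  show ?case using assms(2)
    by (auto intro!: continuous_at_imp_continuous_on DERIV_isCont)
next
  case (Suc k)
  show ?case
  proof (rule C_k_on_SucI[OF assms(1), where h' = "\<lambda>x v. g (\<phi> x) * v"])
    show "(\<phi> has_derivative (\<lambda>v. g (\<phi> x) * v)) (at x)" if "x \<in> X" for x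
      using assms(2)[OF that] by (simp add: has_field_derivative_def)
    show "C_k_on k (\<lambda>x. g (\<phi> x) * v) X" for v
    proof -
      have "C_k_on k (\<lambda>x. g (\<phi> x)) X"
        by (rule C_k_on_compose[OF assms(1,3,4) C_k_on_Suc_D[OF Suc.prems] Suc.IH[OF C_k_on_Suc_D[OF Suc.prems]]])
      then show ?thesis
        by (intro C_k_on_bilinear[OF bounded_bilinear_mult assms(1)] C_k_on_const assms(1))
    qed
  qed
qed

lemma C_k_on_inverse: "C_k_on k (inverse :: real \<Rightarrow> real) {x. x \<noteq> 0}"
proof (induction k)
  case 0
  show ?case by (auto intro!: continuous_intros)
next
  case (Suc k)
  have op: "open {x::real. x \<noteq> 0}" by (simp add: open_Collect_neq)
  show ?case
  proof (rule C_k_on_SucI[OF op, where h' = "\<lambda>x v. - (inverse x * v * inverse x)"])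
    show "C_k_on k (\<lambda>x. - (inverse x * v * inverse x)) {x. x \<noteq> 0}" for v :: real
    proof -
      have "C_k_on k (\<lambda>x. (-1) * (inverse x * v * inverse x)) {x. x \<noteq> 0}"
        using Suc by (intro C_k_on_bilinear[OF bounded_bilinear_mult op] C_k_on_const[OF op])
      then show ?thesis by simp
    qed
  qed (auto intro!: has_derivative_inverse')
qed

section \<open>Closure properties of smooth maps\<close>

lemma smooth_on_has_derivative:
  "smooth_on h X \<Longrightarrow> x \<in> X \<Longrightarrow> (h has_derivative FD h x) (at x)"
  using C_k_on_Suc_has_derivative smooth_on_def by blast

lemma smooth_on_FD: "smooth_on h X \<Longrightarrow> smooth_on (\<lambda>x. FD h x v) X"
  unfolding smooth_on_def by (metis C_k_on.simps(2))

lemma smooth_on_subset: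
  assumes "smooth_on h X" "Y \<subseteq> X"
  shows "smooth_on h Y"
proof -
  have "C_k_on k h X \<Longrightarrow> C_k_on k h Y" for k and h :: "'a \<Rightarrow> 'b"
    using assms(2) by (induction k arbitrary: h) (auto intro: continuous_on_subset)
  then show ?thesis using assms(1) smooth_on_def by blast
qed

lemma smooth_on_cong:
  assumes "smooth_on h X" "open X" "\<And>x. x \<in> X \<Longrightarrow> h x = h' x"
  shows "smooth_on h' X"
  using assms C_k_on_cong unfolding smooth_on_def by blast

lemma smooth_on_imp_continuous_on: "smooth_on h X \<Longrightarrow> continuous_on X h"
  by (metis C_k_on.simps(1) smooth_on_def)

lemma smooth_on_imp_continuous_at:
  "smooth_on h X \<Longrightarrow> x \<in> X \<Longrightarrow> isCont h x"
  using smooth_on_has_derivative has_derivative_continuous by blast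

named_theorems smooth_intros

lemma smooth_on_const [smooth_intros]: "open X \<Longrightarrow> smooth_on (\<lambda>x. c) X"
  by (simp add: smooth_on_def C_k_on_const)

lemma smooth_on_id [smooth_intros]: "open X \<Longrightarrow> smooth_on (\<lambda>x. x) X"
  by (simp add: smooth_on_def C_k_on_bounded_linear bounded_linear_ident)

lemma smooth_on_add [smooth_intros]:
  "open X \<Longrightarrow> smooth_on f X \<Longrightarrow> smooth_on g X \<Longrightarrow> smooth_on (\<lambda>x. f x + g x) X"
  by (simp add: smooth_on_def C_k_on_add)

lemma smooth_on_sum [smooth_intros]:
  "open X \<Longrightarrow> (\<And>i. i \<in> I \<Longrightarrow> smooth_on (f i) X) \<Longrightarrow> smooth_on (\<lambda>x. \<Sum>i\<in>I. f i x) X"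
  by (simp add: smooth_on_def C_k_on_sum)

lemma smooth_on_scaleR [smooth_intros]:
  "open X \<Longrightarrow> smooth_on f X \<Longrightarrow> smooth_on g X \<Longrightarrow> smooth_on (\<lambda>x. f x *\<^sub>R g x) X"
  by (simp add: smooth_on_def C_k_on_bilinear[OF bounded_bilinear_scaleR])

lemma smooth_on_mult [smooth_intros]:
  fixes f g :: "'a::real_normed_vector \<Rightarrow> real"
  shows "open X \<Longrightarrow> smooth_on f X \<Longrightarrow> smooth_on g X \<Longrightarrow> smooth_on (\<lambda>x. f x * g x) X"
  by (simp add: smooth_on_def C_k_on_bilinear[OF bounded_bilinear_mult])

lemma smooth_on_inner [smooth_intros]:
  "open X \<Longrightarrow> smooth_on f X \<Longrightarrow> smooth_on g X \<Longrightarrow> smooth_on (\<lambda>x. f x \<bullet> g x) X"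
  by (simp add: smooth_on_def C_k_on_bilinear[OF bounded_bilinear_inner])

lemma smooth_on_minus [smooth_intros]:
  assumes "open X" "smooth_on f X"
  shows "smooth_on (\<lambda>x. - f x) X"
  using smooth_on_scaleR[OF assms(1) smooth_on_const[OF assms(1), of "-1"] assms(2)] by simp

lemma smooth_on_diff [smooth_intros]:
  assumes "open X" "smooth_on f X" "smooth_on g X"
  shows "smooth_on (\<lambda>x. f x - g x) X"
  using smooth_on_add[OF assms(1,2) smooth_on_minus[OF assms(1,3)]] by simp

lemma smooth_on_power [smooth_intros]:
  fixes f :: "'a::real_normed_vector \<Rightarrow> real"
  assumes "open X" "smooth_on f X"
  shows "smooth_on (\<lambda>x. f x ^ n) X"
  by (induction n) (auto intro!: smooth_intros assms)

lemma smooth_on_compose: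
  fixes f :: "'a::real_normed_vector \<Rightarrow> 'b::euclidean_space"
  shows "smooth_on g Y \<Longrightarrow> smooth_on f X \<Longrightarrow> open X \<Longrightarrow> open Y \<Longrightarrow> (\<And>x. x \<in> X \<Longrightarrow> f x \<in> Y)
    \<Longrightarrow> smooth_on (\<lambda>x. g (f x)) X"
  unfolding smooth_on_def using C_k_on_compose[of X Y f] by blast

lemma smooth_on_bounded_linear:
  fixes f :: "'a::real_normed_vector \<Rightarrow> 'b::euclidean_space"
  shows "bounded_linear L \<Longrightarrow> open X \<Longrightarrow> smooth_on f X \<Longrightarrow> smooth_on (\<lambda>x. L (f x)) X"
  by (rule smooth_on_compose[of L UNIV]) (auto simp: smooth_on_def C_k_on_bounded_linear)

lemma smooth_on_nth [smooth_intros]: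
  fixes f :: "'a::real_normed_vector \<Rightarrow> 'b::euclidean_space ^ 'n"
  shows "open X \<Longrightarrow> smooth_on f X \<Longrightarrow> smooth_on (\<lambda>x. f x $ i) X"
  by (rule smooth_on_bounded_linear[OF bounded_linear_vec_nth])

lemma smooth_on_inverse [smooth_intros]:
  fixes f :: "'a::real_normed_vector \<Rightarrow> real"
  assumes "open X" "smooth_on f X" "\<And>x. x \<in> X \<Longrightarrow> f x \<noteq> 0"
  shows "smooth_on (\<lambda>x. inverse (f x)) X"
proof (rule smooth_on_compose[OF _ assms(2,1)])
  show "smooth_on inverse {x::real. x \<noteq> 0}" by (simp add: smooth_on_def C_k_on_inverse)
  show "open {x::real. x \<noteq> 0}" by (simp add: open_Collect_neq)
qed (use assms in auto)

lemma smooth_on_divide [smooth_intros]: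
  fixes f g :: "'a::real_normed_vector \<Rightarrow> real"
  assumes "open X" "smooth_on f X" "smooth_on g X" "\<And>x. x \<in> X \<Longrightarrow> g x \<noteq> 0"
  shows "smooth_on (\<lambda>x. f x / g x) X"
  unfolding divide_inverse by (intro smooth_intros assms)

text \<open>A solution of the autonomous equation \<open>\<phi>' = g \<circ> \<phi>\<close> is as smooth as \<open>g\<close>; roots and inverse
  functions are instances.\<close>

lemma smooth_on_autonomous:
  fixes \<phi> g :: "real \<Rightarrow> real"
  assumes "open X" "open Y" "smooth_on g Y" "\<And>x. x \<in> X \<Longrightarrow> \<phi> x \<in> Y"
    and "\<And>x. x \<in> X \<Longrightarrow> (\<phi> has_real_derivative g (\<phi> x)) (at x)"
  shows "smooth_on \<phi> X"
  using assms C_k_on_autonomous[of X \<phi> g Y] unfolding smooth_on_def by blast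

lemma smooth_on_cbrt:
  fixes f :: "'a::real_normed_vector \<Rightarrow> real"
  assumes "open X" "smooth_on f X" "\<And>x. x \<in> X \<Longrightarrow> f x \<noteq> 0"
  shows "smooth_on (\<lambda>x. root 3 (f x)) X"
proof -
  have op: "open {x::real. x \<noteq> 0}" by (simp add: open_Collect_neq)
  have "smooth_on (\<lambda>x. root 3 x) {x::real. x \<noteq> 0}"
  proof (rule smooth_on_autonomous[OF op op, where g = "\<lambda>y. inverse (3 * y ^ 2)"])
    show "smooth_on (\<lambda>y. inverse (3 * y ^ 2)) {x::real. x \<noteq> 0}"
      by (intro smooth_intros op) auto
    show "(root 3 has_real_derivative inverse (3 * root 3 x ^ 2)) (at x)" if "x \<in> {x. x \<noteq> 0}" for x
      using DERIV_odd_real_root[of 3 x] that by simp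
  qed auto
  then show ?thesis by (rule smooth_on_compose) (use assms op in auto)
qed

lemma smooth_on_sqrt:
  fixes f :: "'a::real_normed_vector \<Rightarrow> real"
  assumes "open X" "smooth_on f X" "\<And>x. x \<in> X \<Longrightarrow> f x > 0"
  shows "smooth_on (\<lambda>x. sqrt (f x)) X"
proof -
  have "smooth_on sqrt {0<..}"
  proof (rule smooth_on_autonomous[of _ "{0<..}" "\<lambda>y. inverse y / 2"])
    show "smooth_on (\<lambda>y. inverse y / 2) {0::real<..}"
      by (intro smooth_intros) auto
    show "(sqrt has_real_derivative inverse (sqrt x) / 2) (at x)" if "x \<in> {0<..}" for x
      using DERIV_real_sqrt that by auto
  qed auto
  then show ?thesis by (rule smooth_on_compose) (use assms in auto)
qed

section \<open>Smooth curves\<close>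

lemma smooth_curve_has_vector_derivative:
  fixes x :: "real \<Rightarrow> 'a::real_normed_vector"
  shows "smooth_on x I \<Longrightarrow> t \<in> I \<Longrightarrow> (x has_vector_derivative vector_derivative x (at t)) (at t)"
  using smooth_on_has_derivative differentiableI vector_derivative_works by blast

lemma FD_curve:
  fixes x :: "real \<Rightarrow> 'a::real_normed_vector"
  shows "smooth_on x I \<Longrightarrow> t \<in> I \<Longrightarrow> FD x t 1 = vector_derivative x (at t)"
  using frechet_derivative_eq_vector_derivative[of x t] smooth_on_has_derivative
  by (metis differentiable_def scaleR_one)

lemma smooth_on_vector_derivative [smooth_intros]:
  fixes x :: "real \<Rightarrow> 'a::real_normed_vector"
  assumes "open I" "smooth_on x I"
  shows "smooth_on (\<lambda>t. vector_derivative x (at t)) I"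
  by (rule smooth_on_cong[OF smooth_on_FD[OF assms(2), of 1] assms(1)]) (simp add: FD_curve[OF assms(2)])

lemma vector_derivative_cong_open:
  assumes "open I" "t \<in> I" "\<And>s. s \<in> I \<Longrightarrow> x s = y s"
  shows "vector_derivative x (at t) = vector_derivative y (at t)"
proof -
  have "eventually (\<lambda>s. x s = y s) (nhds t)"
    using assms eventually_nhds by blast
  then show ?thesis by (intro vector_derivative_cong_eq refl) auto
qed

lemma has_vector_derivative_compose_smooth:
  fixes h :: "'a::euclidean_space \<Rightarrow> 'b::real_normed_vector"
  assumes "(x has_vector_derivative v) (at t)" "smooth_on h V" "x t \<in> V"
  shows "((\<lambda>s. h (x s)) has_vector_derivative FD h (x t) v) (at t)"
proof -
  have h: "(h has_derivative FD h (x t)) (at (x t))" using assms smooth_on_has_derivative by blast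
  have "((\<lambda>s. h (x s)) has_derivative (\<lambda>r. FD h (x t) (r *\<^sub>R v))) (at t)"
    using has_derivative_compose[of x _ t UNIV h, OF _ h] assms(1)
    unfolding has_vector_derivative_def by blast
  then show ?thesis
    using linear_scale[OF has_derivative_linear[OF h]] by (simp add: has_vector_derivative_def)
qed

section \<open>Derivatives in a moving direction\<close>

lemma FD_linear: "smooth_on h V \<Longrightarrow> z \<in> V \<Longrightarrow> linear (FD h z)"
  using smooth_on_has_derivative has_derivative_linear by blast

lemma FD_expand:
  fixes h :: "'a::euclidean_space \<Rightarrow> 'b::real_normed_vector"
  assumes "smooth_on h V" "z \<in> V"
  shows "FD h z v = (\<Sum>i\<in>Basis. (v \<bullet> i) *\<^sub>R FD h z i)"
proof -
  note lin = FD_linear[OF assms]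
  have "FD h z v = FD h z (\<Sum>i\<in>Basis. (v \<bullet> i) *\<^sub>R i)" by (simp add: euclidean_representation)
  also have "\<dots> = (\<Sum>i\<in>Basis. (v \<bullet> i) *\<^sub>R FD h z i)"
    by (simp add: linear_sum[OF lin] linear_scale[OF lin])
  finally show ?thesis .
qed

lemma smooth_on_FD_along [smooth_intros]:
  fixes h :: "'a::euclidean_space \<Rightarrow> 'b::real_normed_vector" and x v :: "'c::real_normed_vector \<Rightarrow> 'a"
  assumes "smooth_on h V" "open V" "open I" "smooth_on x I" "smooth_on v I" "\<And>t. t \<in> I \<Longrightarrow> x t \<in> V"
  shows "smooth_on (\<lambda>t. FD h (x t) (v t)) I"
proof (rule smooth_on_cong[OF _ assms(3)])
  show "smooth_on (\<lambda>t. \<Sum>i\<in>Basis. (v t \<bullet> i) *\<^sub>R FD h (x t) i) I"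
    by (intro smooth_intros assms smooth_on_compose[OF smooth_on_FD[OF assms(1)] assms(4,3,2,6)])
qed (use FD_expand[OF assms(1) assms(6)] in simp)

text \<open>Point and direction move together. Expansion of the direction in the basis reduces this
  to the product rule; the terms in which the point moves reassemble to a second derivative with the
  direction frozen at \<open>v t\<close>.\<close>

lemma has_derivative_FD_along:
  fixes h :: "'a::euclidean_space \<Rightarrow> 'b::real_normed_vector" and x v :: "'c::real_normed_vector \<Rightarrow> 'a"
  assumes h: "smooth_on h V" and V: "open V" "x t \<in> V"
    and x: "(x has_derivative x') (at t)" and v: "(v has_derivative v') (at t)"
  shows "((\<lambda>s. FD h (x s) (v s)) has_derivative
    (\<lambda>r. FD h (x t) (v' r) + FD (\<lambda>z. FD h z (v t)) (x t) (x' r))) (at t)"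
proof -
  have D: "((\<lambda>s. FD h (x s) i) has_derivative (\<lambda>r. FD (\<lambda>z. FD h z i) (x t) (x' r))) (at t)" for i
    using has_derivative_compose[OF x smooth_on_has_derivative[OF smooth_on_FD[OF h] V(2)]] by simp
  have *: "((\<lambda>s. \<Sum>i\<in>Basis. (v s \<bullet> i) *\<^sub>R FD h (x s) i) has_derivative
      (\<lambda>r. \<Sum>i\<in>Basis. (v t \<bullet> i) *\<^sub>R FD (\<lambda>z. FD h z i) (x t) (x' r) + (v' r \<bullet> i) *\<^sub>R FD h (x t) i)) (at t)"
    using v by (intro has_derivative_sum has_derivative_scaleR D) (auto intro!: derivative_eq_intros)
  have "FD (\<lambda>z. FD h z (v t)) (x t) w = (\<Sum>i\<in>Basis. (v t \<bullet> i) *\<^sub>R FD (\<lambda>z. FD h z i) (x t) w)" for w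
  proof -
    have "((\<lambda>z. \<Sum>i\<in>Basis. (v t \<bullet> i) *\<^sub>R FD h z i) has_derivative
        (\<lambda>w. \<Sum>i\<in>Basis. (v t \<bullet> i) *\<^sub>R FD (\<lambda>z. FD h z i) (x t) w)) (at (x t))"
      using smooth_on_has_derivative[OF smooth_on_FD[OF h] V(2)]
      by (intro has_derivative_sum has_derivative_scaleR_right)
    then have "((\<lambda>z. FD h z (v t)) has_derivative
        (\<lambda>w. \<Sum>i\<in>Basis. (v t \<bullet> i) *\<^sub>R FD (\<lambda>z. FD h z i) (x t) w)) (at (x t))"
      by (rule has_derivative_transform_within_open[OF _ V]) (use FD_expand[OF h] in simp)
    then show ?thesis by (simp add: FD_eqI)
  qed
  then have **: "(\<lambda>r. \<Sum>i\<in>Basis. (v t \<bullet> i) *\<^sub>R FD (\<lambda>z. FD h z i) (x t) (x' r) + (v' r \<bullet> i) *\<^sub>R FD h (x t) i)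
    = (\<lambda>r. FD h (x t) (v' r) + FD (\<lambda>z. FD h z (v t)) (x t) (x' r))"
    by (simp add: sum.distrib FD_expand[OF h V(2), symmetric] add.commute)
  have "eventually (\<lambda>s. x s \<in> V) (at t)"
    using x V has_derivative_continuous[OF x] topological_tendstoD unfolding continuous_at by blast
  then have "eventually (\<lambda>s. (\<Sum>i\<in>Basis. (v s \<bullet> i) *\<^sub>R FD h (x s) i) = FD h (x s) (v s)) (at t)"
    by eventually_elim (simp add: FD_expand[OF h, symmetric])
  then show ?thesis
    using has_derivative_transform_eventually[OF *[unfolded **]] FD_expand[OF h V(2), of "v t"]
    by simp
qed

text \<open>Both second derivatives are limits of the second difference quotient over a parallelogram.\<close>

lemma second_difference_mean_value:
  fixes h :: "'a::real_normed_vector \<Rightarrow> real"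
  assumes h: "smooth_on h X" and "s > 0" "t > 0"
    and X: "\<And>a b. 0 \<le> a \<Longrightarrow> a \<le> s \<Longrightarrow> 0 \<le> b \<Longrightarrow> b \<le> t \<Longrightarrow> x + a *\<^sub>R u + b *\<^sub>R v \<in> X"
  obtains a b where "0 < a" "a < s" "0 < b" "b < t"
    "h (x + s *\<^sub>R u + t *\<^sub>R v) - h (x + s *\<^sub>R u) - h (x + t *\<^sub>R v) + h x =
      s * t * FD (\<lambda>z. FD h z u) (x + a *\<^sub>R u + b *\<^sub>R v) v"
proof -
  have D: "((\<lambda>r. k (z + r *\<^sub>R w)) has_real_derivative FD k (z + r *\<^sub>R w) w) (at r)"
    if "smooth_on k X" "z + r *\<^sub>R w \<in> X" for k :: "'a \<Rightarrow> real" and z w r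
  proof -
    have "((\<lambda>r. z + r *\<^sub>R w) has_derivative (\<lambda>r. r *\<^sub>R w)) (at r)"
      by (auto intro!: derivative_eq_intros)
    from has_derivative_compose[OF this smooth_on_has_derivative[OF that]]
    show ?thesis
      by (simp add: has_field_derivative_def linear_scale[OF FD_linear[OF that]] mult_commute_abs)
  qed
  define k where "k = (\<lambda>r. h (x + t *\<^sub>R v + r *\<^sub>R u) - h (x + r *\<^sub>R u))"
  have X1: "x + t *\<^sub>R v + r *\<^sub>R u \<in> X" "x + r *\<^sub>R u \<in> X" if "0 \<le> r" "r \<le> s" for r
    using X[OF that, of t] X[OF that, of 0] assms(3) by (simp_all add: algebra_simps)
  have "\<exists>a. 0 < a \<and> a < s \<and> k s - k 0 = (s - 0) * (FD h (x + t *\<^sub>R v + a *\<^sub>R u) u - FD h (x + a *\<^sub>R u) u)"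
    unfolding k_def by (rule MVT2[OF assms(2)]) (intro DERIV_diff D h X1, auto)
  then obtain a where a: "0 < a" "a < s"
    and ka: "k s - k 0 = s * (FD h (x + t *\<^sub>R v + a *\<^sub>R u) u - FD h (x + a *\<^sub>R u) u)"
    by auto
  define l where "l = (\<lambda>r. FD h (x + a *\<^sub>R u + r *\<^sub>R v) u)"
  have "\<exists>b. 0 < b \<and> b < t \<and> l t - l 0 = (t - 0) * FD (\<lambda>z. FD h z u) (x + a *\<^sub>R u + b *\<^sub>R v) v"
    unfolding l_def
    by (rule MVT2[OF assms(3)], rule D[OF smooth_on_FD[OF h]]) (use X a in auto)
  then obtain b where "0 < b" "b < t" "l t - l 0 = t * FD (\<lambda>z. FD h z u) (x + a *\<^sub>R u + b *\<^sub>R v) v"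
    by auto
  moreover have "k s - k 0 = s * (l t - l 0)" using ka by (simp add: l_def algebra_simps)
  ultimately show ?thesis using that a unfolding k_def by (simp add: algebra_simps)
qed

lemma FD_FD_commute_real:
  fixes h :: "'a::real_normed_vector \<Rightarrow> real"
  assumes h: "smooth_on h X" and X: "open X" "x \<in> X"
  shows "FD (\<lambda>z. FD h z u) x v = FD (\<lambda>z. FD h z v) x u"
proof -
  let ?H = "\<lambda>u v z. FD (\<lambda>z. FD h z u) z v"
  have "\<bar>?H u v x - ?H v u x\<bar> \<le> 0 + e" if "e > 0" for e
  proof -
    have "isCont (?H u v) x" "isCont (?H v u) x"
      using smooth_on_imp_continuous_at[OF smooth_on_FD[OF smooth_on_FD[OF h]] X(2)] by blast+
    moreover have "0 < e / 2" using that by simp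
    ultimately obtain d1 d2 where d12: "d1 > 0" "\<And>z. dist z x < d1 \<Longrightarrow> dist (?H u v z) (?H u v x) < e/2"
      "d2 > 0" "\<And>z. dist z x < d2 \<Longrightarrow> dist (?H v u z) (?H v u x) < e/2"
      unfolding continuous_at_eps_delta by blast
    obtain d3 where d3: "d3 > 0" "ball x d3 \<subseteq> X" using X open_contains_ball by blast
    define d where "d = min (min d1 d2) d3"
    \<comment> \<open>With this side length the whole parallelogram stays within
      \<open>d / 2\<close> of \<open>x\<close>; the summand 1 keeps the denominator positive when
      \<open>u\<close> and \<open>v\<close> vanish.\<close>
    define s where "s = d / (2 * (norm u + norm v + 1))"
    have d: "d > 0" using d12 d3 d_def by auto
    have n: "norm u + norm v + 1 > 0" by (simp add: add_nonneg_pos)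
    then have s: "s > 0" using d by (simp add: s_def)
    have near: "dist (x + a *\<^sub>R u + b *\<^sub>R v) x < d" if "0 \<le> a" "a \<le> s" "0 \<le> b" "b \<le> s" for a b
    proof -
      have "dist (x + a *\<^sub>R u + b *\<^sub>R v) x = norm (a *\<^sub>R u + b *\<^sub>R v)"
        by (simp add: dist_norm algebra_simps)
      also have "\<dots> \<le> a * norm u + b * norm v"
        using norm_triangle_ineq[of "a *\<^sub>R u" "b *\<^sub>R v"] that by simp
      also have "\<dots> \<le> s * norm u + s * norm v"
        using that by (intro add_mono mult_right_mono) auto
      also have "\<dots> \<le> s * (norm u + norm v + 1)" using s by (simp add: algebra_simps)
      also have "\<dots> = d / 2"
        unfolding s_def using n by (metis mult.commute less_numeral_extra(3) divide_divide_eq_left nonzero_eq_divide_eq)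
      finally show ?thesis using d by simp
    qed
    have inX: "x + a *\<^sub>R u + b *\<^sub>R v \<in> X" if "0 \<le> a" "a \<le> s" "0 \<le> b" "b \<le> s" for a b
      using near[OF that] d3 by (auto simp: d_def dist_commute)
    have inX': "x + a *\<^sub>R v + b *\<^sub>R u \<in> X" if "0 \<le> a" "a \<le> s" "0 \<le> b" "b \<le> s" for a b
      using inX[of b a] that by (simp add: algebra_simps)
    obtain a b where ab: "0 < a" "a < s" "0 < b" "b < s"
      "h (x + s *\<^sub>R u + s *\<^sub>R v) - h (x + s *\<^sub>R u) - h (x + s *\<^sub>R v) + h x =
        s * s * ?H u v (x + a *\<^sub>R u + b *\<^sub>R v)"
      using second_difference_mean_value[OF h s s inX] by blast
    obtain a' b' where ab': "0 < a'" "a' < s" "0 < b'" "b' < s"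
      "h (x + s *\<^sub>R v + s *\<^sub>R u) - h (x + s *\<^sub>R v) - h (x + s *\<^sub>R u) + h x =
        s * s * ?H v u (x + a' *\<^sub>R v + b' *\<^sub>R u)"
      using second_difference_mean_value[OF h s s inX'] by blast
    have "s * s * ?H u v (x + a *\<^sub>R u + b *\<^sub>R v) = s * s * ?H v u (x + a' *\<^sub>R v + b' *\<^sub>R u)"
      using ab(5) ab'(5) by (simp add: algebra_simps)
    then have "?H u v (x + a *\<^sub>R u + b *\<^sub>R v) = ?H v u (x + a' *\<^sub>R v + b' *\<^sub>R u)"
      using s by simp
    moreover have "dist (?H u v (x + a *\<^sub>R u + b *\<^sub>R v)) (?H u v x) < e/2"
      using near[of a b] ab by (intro d12) (auto simp: d_def)
    moreover have "dist (?H v u (x + a' *\<^sub>R v + b' *\<^sub>R u)) (?H v u x) < e/2"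
    proof (rule d12)
      show "dist (x + a' *\<^sub>R v + b' *\<^sub>R u) x < d2"
        using near[of b' a'] ab' by (simp add: d_def algebra_simps)
    qed
    ultimately show ?thesis unfolding dist_real_def by linarith
  qed
  then have "\<bar>?H u v x - ?H v u x\<bar> \<le> 0" using field_le_epsilon by blast
  then show ?thesis by simp
qed

lemma FD_inner:
  fixes h :: "'a::real_normed_vector \<Rightarrow> 'b::euclidean_space"
  assumes "smooth_on h X" "x \<in> X"
  shows "FD (\<lambda>z. h z \<bullet> i) x v = FD h x v \<bullet> i"
proof -
  have "((\<lambda>z. h z \<bullet> i) has_derivative (\<lambda>v. FD h x v \<bullet> i)) (at x)"
    using smooth_on_has_derivative[OF assms] by (rule has_derivative_inner_left)
  then show ?thesis by (simp add: FD_eqI)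
qed

lemma FD_FD_commute:
  fixes h :: "'a::real_normed_vector \<Rightarrow> 'b::euclidean_space"
  assumes h: "smooth_on h X" and X: "open X" "x \<in> X"
  shows "FD (\<lambda>z. FD h z u) x v = FD (\<lambda>z. FD h z v) x u"
proof (rule euclidean_eqI)
  fix i :: 'b assume "i \<in> Basis"
  have hi: "smooth_on (\<lambda>z. h z \<bullet> i) X" by (intro smooth_intros h X)
  have *: "FD (\<lambda>z. FD h z u) x v \<bullet> i = FD (\<lambda>z. FD (\<lambda>z. h z \<bullet> i) z u) x v" for u v
  proof -
    have "FD (\<lambda>z. FD h z u \<bullet> i) x v = FD (\<lambda>z. FD (\<lambda>z. h z \<bullet> i) z u) x v"
    proof (rule fun_cong[OF frechet_derivative_transform_within_open[OF _ X]])
      show "(\<lambda>z. FD h z u \<bullet> i) differentiable at x"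
        using smooth_on_has_derivative[OF smooth_on_inner[OF X(1) smooth_on_FD[OF h] smooth_on_const[OF X(1)]] X(2)]
        unfolding differentiable_def by blast
    qed (simp add: FD_inner[OF h])
    then show ?thesis by (simp add: FD_inner[OF smooth_on_FD[OF h] X(2)])
  qed
  show "FD (\<lambda>z. FD h z u) x v \<bullet> i = FD (\<lambda>z. FD h z v) x u \<bullet> i"
    using * FD_FD_commute_real[OF hi X] by simp
qed

section \<open>Fields of symmetric bilinear forms\<close>

text \<open>No nondegeneracy is assumed, so the locale serves the ambient metric and also the first
  fundamental form, which degenerates exactly on the lightlike set.\<close>

locale form_field =
  fixes B :: "'a::euclidean_space \<Rightarrow> 'a \<Rightarrow> 'a \<Rightarrow> real" and V :: "'a set"
  assumes open_V: "open V"
    and bilin: "z \<in> V \<Longrightarrow> bilinear (B z)"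
    and sym: "z \<in> V \<Longrightarrow> B z X Y = B z Y X"
    and smooth: "smooth_on (\<lambda>z. B z X Y) V"

text \<open>\<open>X\<close> and \<open>Y\<close> are frozen coordinate vectors, so this is not a
  tensor: a change of coordinates adds second derivatives, see
  \<open>dform_pullback\<close>.\<close>

definition dform :: "('a::real_normed_vector \<Rightarrow> 'a \<Rightarrow> 'a \<Rightarrow> real) \<Rightarrow> 'a \<Rightarrow> 'a \<Rightarrow> 'a \<Rightarrow> 'a \<Rightarrow> real" where
  "dform B z v X Y = FD (\<lambda>z. B z X Y) z v"

abbreviation vel :: "(real \<Rightarrow> 'a::real_normed_vector) \<Rightarrow> real \<Rightarrow> 'a" where
  "vel x t \<equiv> vector_derivative x (at t)"

text \<open>In the notation of Riemannian geometry, \<open>acc B x W t\<close> is \<open>\<langle>\<nabla>\<^sub>t x', W\<rangle>\<close>: the lowered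
  Christoffel symbols, unlike the usual ones, make sense for a degenerate form.\<close>

definition acc :: "('a::real_normed_vector \<Rightarrow> 'a \<Rightarrow> 'a \<Rightarrow> real) \<Rightarrow> (real \<Rightarrow> 'a) \<Rightarrow> 'a \<Rightarrow> real \<Rightarrow> real" where
  "acc B x W t = B (x t) (vel (vel x) t) W + dform B (x t) (vel x t) (vel x t) W
     - dform B (x t) W (vel x t) (vel x t) / 2"

lemma bilinear_expand:
  fixes f :: "'a::euclidean_space \<Rightarrow> 'a \<Rightarrow> real"
  assumes "bilinear f"
  shows "f X Y = (\<Sum>i\<in>Basis. \<Sum>j\<in>Basis. (X \<bullet> i) * (Y \<bullet> j) * f i j)"
proof -
  have "f X Y = f (\<Sum>i\<in>Basis. (X \<bullet> i) *\<^sub>R i) (\<Sum>j\<in>Basis. (Y \<bullet> j) *\<^sub>R j)"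
    by (simp add: euclidean_representation)
  also have "\<dots> = (\<Sum>(i,j)\<in>Basis \<times> Basis. (X \<bullet> i) * (Y \<bullet> j) * f i j)"
    by (simp add: bilinear_sum[OF assms] bilinear_lmul[OF assms] bilinear_rmul[OF assms] mult_ac)
  finally show ?thesis by (simp add: sum.cartesian_product)
qed

context form_field
begin

lemmas expand = bilinear_expand[OF bilin]

lemma B_simps:
  assumes "z \<in> V"
  shows "B z (X + X') Y = B z X Y + B z X' Y" "B z X (Y + Y') = B z X Y + B z X Y'"
    "B z (X - X') Y = B z X Y - B z X' Y" "B z X (Y - Y') = B z X Y - B z X Y'"
    "B z (r *\<^sub>R X) Y = r * B z X Y" "B z X (r *\<^sub>R Y) = r * B z X Y"
    "B z 0 Y = 0" "B z X 0 = 0" "B z (- X) Y = - B z X Y" "B z X (- Y) = - B z X Y"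
  using bilin[OF assms]
  by (simp_all add: bilinear_ladd bilinear_radd bilinear_lsub bilinear_rsub bilinear_lmul bilinear_rmul
      bilinear_lzero bilinear_rzero bilinear_lneg bilinear_rneg)

lemma has_derivative_B: "z \<in> V \<Longrightarrow> ((\<lambda>z. B z X Y) has_derivative (\<lambda>v. dform B z v X Y)) (at z)"
  unfolding dform_def by (rule smooth_on_has_derivative[OF smooth])

text \<open>The coefficients in a basis depend on the point alone, so expansion turns the motion of
  all three arguments into a finite sum of ordinary products.\<close>

lemma has_derivative_along:
  fixes x X Y :: "'c::real_normed_vector \<Rightarrow> 'a"
  assumes V: "x t \<in> V" and x: "(x has_derivative x') (at t)"
    and X: "(X has_derivative X') (at t)" and Y: "(Y has_derivative Y') (at t)"
  shows "((\<lambda>s. B (x s) (X s) (Y s)) has_derivative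
    (\<lambda>r. dform B (x t) (x' r) (X t) (Y t) + B (x t) (X' r) (Y t) + B (x t) (X t) (Y' r))) (at t)"
proof -
  let ?S = "\<lambda>s. \<Sum>i\<in>Basis. \<Sum>j\<in>Basis. (X s \<bullet> i) * (Y s \<bullet> j) * B (x s) i j"
  let ?S' = "\<lambda>r. \<Sum>i\<in>Basis. \<Sum>j\<in>Basis. (X t \<bullet> i) * (Y t \<bullet> j) * dform B (x t) (x' r) i j
    + ((X t \<bullet> i) * (Y' r \<bullet> j) + (X' r \<bullet> i) * (Y t \<bullet> j)) * B (x t) i j"
  have D: "((\<lambda>s. B (x s) i j) has_derivative (\<lambda>r. dform B (x t) (x' r) i j)) (at t)" for i j
    using has_derivative_compose[OF x has_derivative_B[OF V]] by simp
  have *: "(?S has_derivative ?S') (at t)"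
    using X Y by (intro has_derivative_sum has_derivative_mult D has_derivative_inner_left)
  have "eventually (\<lambda>s. x s \<in> V) (at t)"
    using V open_V has_derivative_continuous[OF x] topological_tendstoD unfolding continuous_at by blast
  then have ev: "eventually (\<lambda>s. ?S s = B (x s) (X s) (Y s)) (at t)"
    by eventually_elim (rule expand[symmetric])
  have dX: "dform B (x t) v P Q = (\<Sum>i\<in>Basis. \<Sum>j\<in>Basis. (P \<bullet> i) * (Q \<bullet> j) * dform B (x t) v i j)"
    for v P Q
  proof -
    have "((\<lambda>z. \<Sum>i\<in>Basis. \<Sum>j\<in>Basis. (P \<bullet> i) * (Q \<bullet> j) * B z i j) has_derivative
        (\<lambda>v. \<Sum>i\<in>Basis. \<Sum>j\<in>Basis. (P \<bullet> i) * (Q \<bullet> j) * dform B (x t) v i j)) (at (x t))"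
      by (intro has_derivative_sum has_derivative_mult_right has_derivative_B V)
    then have "((\<lambda>z. B z P Q) has_derivative
        (\<lambda>v. \<Sum>i\<in>Basis. \<Sum>j\<in>Basis. (P \<bullet> i) * (Q \<bullet> j) * dform B (x t) v i j)) (at (x t))"
      by (rule has_derivative_transform_within_open[OF _ open_V V]) (rule expand[symmetric])
    then show ?thesis unfolding dform_def by (simp add: FD_eqI)
  qed
  have "((\<lambda>s. B (x s) (X s) (Y s)) has_derivative ?S') (at t)"
    using has_derivative_transform_eventually[OF * ev] expand[OF V, of "X t" "Y t"] by simp
  moreover have "?S' = (\<lambda>r. dform B (x t) (x' r) (X t) (Y t) + B (x t) (X' r) (Y t) + B (x t) (X t) (Y' r))"
  proof
    fix r
    show "?S' r = dform B (x t) (x' r) (X t) (Y t) + B (x t) (X' r) (Y t) + B (x t) (X t) (Y' r)"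
      unfolding dX[of "x' r" "X t" "Y t"] expand[OF V, of "X' r" "Y t"] expand[OF V, of "X t" "Y' r"]
        sum.distrib[symmetric]
      by (rule sum.cong[OF refl], rule sum.cong[OF refl]) (simp only: ring_distribs)
  qed
  ultimately show ?thesis by (simp only:)
qed

lemma dform_sym: "z \<in> V \<Longrightarrow> dform B z v X Y = dform B z v Y X"
proof -
  assume z: "z \<in> V"
  have "((\<lambda>z. B z X Y) has_derivative (\<lambda>v. dform B z v Y X)) (at z)"
    by (rule has_derivative_transform_within_open[OF has_derivative_B[OF z] open_V z]) (rule sym)
  then show ?thesis using FD_eqI unfolding dform_def by metis
qed

lemma dform_bilinear: "z \<in> V \<Longrightarrow> bilinear (dform B z v)"
proof -
  assume z: "z \<in> V"
  have *: "((\<lambda>z. B z (X + r *\<^sub>R X') Y) has_derivative (\<lambda>v. dform B z v X Y + r * dform B z v X' Y)) (at z)" for r X X' Y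
  proof (rule has_derivative_transform_within_open[OF _ open_V z])
    show "((\<lambda>z. B z X Y + r * B z X' Y) has_derivative (\<lambda>v. dform B z v X Y + r * dform B z v X' Y)) (at z)"
      by (intro has_derivative_add has_derivative_mult_right has_derivative_B z)
  qed (simp add: B_simps)
  have l: "dform B z v (X + r *\<^sub>R X') Y = dform B z v X Y + r * dform B z v X' Y" for r X X' Y
    using fun_cong[OF FD_eqI[OF *]] by (simp add: dform_def)
  have l0: "linear (\<lambda>X. dform B z v X Y)" for Y
  proof (rule linearI)
    show "dform B z v (X + X') Y = dform B z v X Y + dform B z v X' Y" for X X' using l[of X 1 X'] by simp
    then have "dform B z v 0 Y = 0" by (metis add_cancel_right_right)
    then show "dform B z v (r *\<^sub>R X) Y = r *\<^sub>R dform B z v X Y" for r X using l[of 0 r X] by simp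
  qed
  then show ?thesis unfolding bilinear_def using dform_sym[OF z] by (metis (no_types, lifting) ext)
qed

lemma dform_linear: "z \<in> V \<Longrightarrow> linear (\<lambda>v. dform B z v X Y)"
  using has_derivative_B has_derivative_linear by blast

lemma dform_simps:
  assumes "z \<in> V"
  shows "dform B z v (X + X') Y = dform B z v X Y + dform B z v X' Y"
    "dform B z v X (Y + Y') = dform B z v X Y + dform B z v X Y'"
    "dform B z v (r *\<^sub>R X) Y = r * dform B z v X Y" "dform B z v X (r *\<^sub>R Y) = r * dform B z v X Y"
    "dform B z (v + v') X Y = dform B z v X Y + dform B z v' X Y"
    "dform B z (r *\<^sub>R v) X Y = r * dform B z v X Y"
  using dform_bilinear[OF assms] linear_add[OF dform_linear[OF assms]] linear_scale[OF dform_linear[OF assms]]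
  by (simp_all add: bilinear_ladd bilinear_radd bilinear_lmul bilinear_rmul)

lemma smooth_along [smooth_intros]:
  fixes x X Y :: "'c::real_normed_vector \<Rightarrow> 'a"
  assumes "open I" "smooth_on x I" "smooth_on X I" "smooth_on Y I" "\<And>t. t \<in> I \<Longrightarrow> x t \<in> V"
  shows "smooth_on (\<lambda>t. B (x t) (X t) (Y t)) I"
proof (rule smooth_on_cong[OF _ assms(1)])
  show "smooth_on (\<lambda>t. \<Sum>i\<in>Basis. \<Sum>j\<in>Basis. (X t \<bullet> i) * (Y t \<bullet> j) * B (x t) i j) I"
    by (intro smooth_intros assms smooth_on_compose[OF smooth assms(2,1) open_V assms(5)])
qed (rule expand[OF assms(5), symmetric])

lemma smooth_dform_along [smooth_intros]:
  fixes x v X Y :: "'c::real_normed_vector \<Rightarrow> 'a"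
  assumes "open I" "smooth_on x I" "smooth_on v I" "smooth_on X I" "smooth_on Y I"
    and "\<And>t. t \<in> I \<Longrightarrow> x t \<in> V"
  shows "smooth_on (\<lambda>t. dform B (x t) (v t) (X t) (Y t)) I"
proof (rule smooth_on_cong[OF _ assms(1)])
  have "smooth_on (\<lambda>t. dform B (x t) (v t) i j) I" for i j
    unfolding dform_def by (rule smooth_on_FD_along[OF smooth open_V assms(1,2,3,6)])
  then show "smooth_on (\<lambda>t. \<Sum>i\<in>Basis. \<Sum>j\<in>Basis. (X t \<bullet> i) * (Y t \<bullet> j) * dform B (x t) (v t) i j) I"
    by (intro smooth_intros assms)
qed (rule bilinear_expand[OF dform_bilinear[OF assms(6)], symmetric])

lemma smooth_acc [smooth_intros]:
  assumes "open I" "smooth_on x I" "smooth_on W I" "\<And>t. t \<in> I \<Longrightarrow> x t \<in> V"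
  shows "smooth_on (\<lambda>t. acc B x (W t) t) I"
  unfolding acc_def by (intro smooth_intros assms) auto

lemma acc_simps:
  assumes "x t \<in> V"
  shows "acc B x (X + Y) t = acc B x X t + acc B x Y t" "acc B x (r *\<^sub>R X) t = r * acc B x X t"
    "acc B x (X - Y) t = acc B x X t - acc B x Y t"
proof -
  show *: "acc B x (X + Y) t = acc B x X t + acc B x Y t" "acc B x (r *\<^sub>R X) t = r * acc B x X t" for X Y r
    unfolding acc_def by (simp_all add: B_simps[OF assms] dform_simps[OF assms] algebra_simps)
  show "acc B x (X - Y) t = acc B x X t - acc B x Y t"
    using *(1)[of X "-1 *\<^sub>R Y"] *(2)[of "-1" Y] by simp
qed

end

section \<open>Curves and forms under a smooth map\<close>

lemma vel_compose:
  fixes \<phi> :: "'a::euclidean_space \<Rightarrow> 'b::real_normed_vector"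
  assumes smooth_\<phi>: "smooth_on \<phi> V" and V: "open V" and I: "open I" "t \<in> I" and x: "smooth_on x I" "\<And>s. s \<in> I \<Longrightarrow> x s \<in> V"
    and y: "\<And>s. s \<in> I \<Longrightarrow> y s = \<phi> (x s)"
  shows "vel y t = FD \<phi> (x t) (vel x t)"
    and "vel (vel y) t = FD \<phi> (x t) (vel (vel x) t) + FD (\<lambda>z. FD \<phi> z (vel x t)) (x t) (vel x t)"
proof -
  have *: "vel y s = FD \<phi> (x s) (vel x s)" if s: "s \<in> I" for s
  proof -
    have "((\<lambda>s. \<phi> (x s)) has_vector_derivative FD \<phi> (x s) (vel x s)) (at s)"
      by (rule has_vector_derivative_compose_smooth[OF
          smooth_curve_has_vector_derivative[OF x(1) s] smooth_\<phi> x(2)[OF s]])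
    from vector_derivative_at[OF this] show ?thesis
      using vector_derivative_cong_open[OF I(1) s y] by simp
  qed
  then show "vel y t = FD \<phi> (x t) (vel x t)" using I by blast
  have x': "smooth_on (vel x) I" by (intro smooth_intros I x)
  have "((\<lambda>s. FD \<phi> (x s) (vel x s)) has_derivative
      (\<lambda>r. FD \<phi> (x t) (FD (vel x) t r) + FD (\<lambda>z. FD \<phi> z (vel x t)) (x t) (FD x t r))) (at t)"
    by (rule has_derivative_FD_along[OF smooth_\<phi> V x(2)[OF I(2)]
        smooth_on_has_derivative[OF x(1) I(2)] smooth_on_has_derivative[OF x' I(2)]])
  then have "FD (\<lambda>s. FD \<phi> (x s) (vel x s)) t 1 =
      FD \<phi> (x t) (vel (vel x) t) + FD (\<lambda>z. FD \<phi> z (vel x t)) (x t) (vel x t)"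
    by (simp add: FD_eqI FD_curve[OF x(1) I(2)] FD_curve[OF x' I(2)])
  moreover have "smooth_on (\<lambda>s. FD \<phi> (x s) (vel x s)) I"
    by (intro smooth_on_FD_along[OF smooth_\<phi> V I(1)] x x')
  ultimately show "vel (vel y) t = FD \<phi> (x t) (vel (vel x) t) + FD (\<lambda>z. FD \<phi> z (vel x t)) (x t) (vel x t)"
    using vector_derivative_cong_open[OF I *] FD_curve[OF _ I(2)] by fastforce
qed

text \<open>One locale for three situations: the immersion in charts, the coordinate changes of the
  surface and those of the ambient manifold. Domain and codomain may therefore have different
  dimensions.\<close>

locale pullback_form = B1: form_field B1 V1 + B2: form_field B2 V2
  for B1 :: "'a::euclidean_space \<Rightarrow> 'a \<Rightarrow> 'a \<Rightarrow> real" and V1 and B2 :: "'b::euclidean_space \<Rightarrow> 'b \<Rightarrow> 'b \<Rightarrow> real" and V2 +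
  fixes \<phi> :: "'a \<Rightarrow> 'b"
  assumes smooth_\<phi>: "smooth_on \<phi> V1" and maps: "z \<in> V1 \<Longrightarrow> \<phi> z \<in> V2"
    and pull: "z \<in> V1 \<Longrightarrow> B1 z X Y = B2 (\<phi> z) (FD \<phi> z X) (FD \<phi> z Y)"
begin

lemma dform_pullback:
  assumes z: "z \<in> V1"
  shows "dform B1 z v X Y = dform B2 (\<phi> z) (FD \<phi> z v) (FD \<phi> z X) (FD \<phi> z Y)
    + B2 (\<phi> z) (FD (\<lambda>z. FD \<phi> z X) z v) (FD \<phi> z Y) + B2 (\<phi> z) (FD \<phi> z X) (FD (\<lambda>z. FD \<phi> z Y) z v)"
proof -
  have "((\<lambda>z. B2 (\<phi> z) (FD \<phi> z X) (FD \<phi> z Y)) has_derivative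
    (\<lambda>v. dform B2 (\<phi> z) (FD \<phi> z v) (FD \<phi> z X) (FD \<phi> z Y)
    + B2 (\<phi> z) (FD (\<lambda>z. FD \<phi> z X) z v) (FD \<phi> z Y) + B2 (\<phi> z) (FD \<phi> z X) (FD (\<lambda>z. FD \<phi> z Y) z v))) (at z)"
    by (rule B2.has_derivative_along[OF maps[OF z]
        smooth_on_has_derivative[OF smooth_\<phi> z]
        smooth_on_has_derivative[OF smooth_on_FD[OF smooth_\<phi>] z]
        smooth_on_has_derivative[OF smooth_on_FD[OF smooth_\<phi>] z]])
  then have "((\<lambda>z. B1 z X Y) has_derivative
    (\<lambda>v. dform B2 (\<phi> z) (FD \<phi> z v) (FD \<phi> z X) (FD \<phi> z Y)
    + B2 (\<phi> z) (FD (\<lambda>z. FD \<phi> z X) z v) (FD \<phi> z Y) + B2 (\<phi> z) (FD \<phi> z X) (FD (\<lambda>z. FD \<phi> z Y) z v))) (at z)"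
    by (rule has_derivative_transform_within_open[OF _ B1.open_V z]) (simp add: pull)
  then show ?thesis unfolding dform_def by (simp add: FD_eqI)
qed

lemmas curve_image = vel_compose[OF smooth_\<phi> B1.open_V]

text \<open>The second derivatives of \<open>\<phi>\<close> cancel. The term differentiated along
  the velocity produces the second derivative of \<open>\<phi>\<close> in (velocity, velocity) and
  in (velocity, \<open>W\<close>); the halved term removes the latter by symmetry of mixed
  derivatives, and the former is the extra term in the acceleration of the image curve. For
  coordinate changes this is invariance; for the immersion it says that the tangential part of the
  ambient acceleration is intrinsic.\<close>

lemma acc_pullback:
  assumes I: "open I" "t \<in> I" and x: "smooth_on x I" "\<And>s. s \<in> I \<Longrightarrow> x s \<in> V1"
    and y: "\<And>s. s \<in> I \<Longrightarrow> y s = \<phi> (x s)"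
  shows "acc B2 y (FD \<phi> (x t) W) t = acc B1 x W t"
proof -
  have xt: "x t \<in> V1" and yt: "\<phi> (x t) \<in> V2" using I x maps by auto
  have c: "FD (\<lambda>z. FD \<phi> z W) (x t) (vel x t) = FD (\<lambda>z. FD \<phi> z (vel x t)) (x t) W"
    by (rule FD_FD_commute[OF smooth_\<phi> B1.open_V xt])
  have v: "vel y t = FD \<phi> (x t) (vel x t)"
    and a: "vel (vel y) t = FD \<phi> (x t) (vel (vel x) t) + FD (\<lambda>z. FD \<phi> z (vel x t)) (x t) (vel x t)"
    using curve_image[OF I x y] by auto
  have s: "B2 (\<phi> (x t)) (FD (\<lambda>z. FD \<phi> z (vel x t)) (x t) W) (FD \<phi> (x t) (vel x t))
    = B2 (\<phi> (x t)) (FD \<phi> (x t) (vel x t)) (FD (\<lambda>z. FD \<phi> z (vel x t)) (x t) W)"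
    by (rule B2.sym[OF yt])
  show ?thesis
    unfolding acc_def pull[OF xt] dform_pullback[OF xt] y[OF I(2)]
      a B2.B_simps[OF yt] c v s
    by (simp add: field_simps)
qed

end

section \<open>Lorentzian linear algebra\<close>

definition lorentz_form :: "real^3^3 \<Rightarrow> bool" where
  "lorentz_form G \<longleftrightarrow> transpose G = G \<and> (\<exists>P::real^3^3. invertible P \<and>
     transpose P ** G ** P = (\<chi> i j. if i = j then (if i = 3 then -1 else 1) else 0))"

lemma bilinear_form_of: "bilinear (form_of G)"
  unfolding bilinear_def form_of_def
  by (auto intro!: linearI simp: matrix_vector_right_distrib inner_add_left inner_add_right
      matrix_vector_mult_scaleR)

lemma form_of_sym: "transpose G = G \<Longrightarrow> form_of G v w = form_of G w v"
  unfolding form_of_def by (metis dot_lmul_matrix inner_commute transpose_matrix_vector)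

lemma form_of_matrix_congruence:
  "form_of (transpose J ** G ** J) v w = form_of G (J *v v) (J *v w)"
proof -
  have "v \<bullet> (transpose J *v u) = (J *v v) \<bullet> u" for u
    by (metis dot_lmul_matrix inner_commute transpose_matrix_vector transpose_transpose)
  then show ?thesis unfolding form_of_def by (simp add: matrix_vector_mul_assoc[symmetric])
qed

context
  fixes G :: "real^3^3"
  assumes G: "lorentz_form G"
begin

lemma lorentz_coordinates:
  obtains P :: "real^3^3" where "\<And>v. \<exists>a. v = P *v a" "\<And>a. P *v a = 0 \<longleftrightarrow> a = 0"
    "\<And>a b. form_of G (P *v a) (P *v b) = a$1 * b$1 + a$2 * b$2 - a$3 * b$3"
proof -
  obtain P :: "real^3^3" where P: "invertible P"
    "transpose P ** G ** P = (\<chi> i j. if i = j then (if i = 3 then -1 else 1) else 0)"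
    using G lorentz_form_def by blast
  obtain Q where Q: "P ** Q = mat 1" "Q ** P = mat 1" using P(1) invertible_def by blast
  show ?thesis
  proof (rule that[of P])
    show "\<exists>a. v = P *v a" for v
      by (rule exI[of _ "Q *v v"]) (simp add: matrix_vector_mul_assoc Q)
    show "P *v a = 0 \<longleftrightarrow> a = 0" for a
      by (metis Q(2) matrix_vector_mul_assoc matrix_vector_mul_lid matrix_vector_mult_0_right)
    show "form_of G (P *v a) (P *v b) = a$1 * b$1 + a$2 * b$2 - a$3 * b$3" for a b
      unfolding form_of_matrix_congruence[symmetric] P(2)
      by (simp add: form_of_def inner_vec_def matrix_vector_mult_def sum_3)
  qed
qed

lemma lorentz_nondegenerate:
  assumes "l \<noteq> 0"
  obtains z where "form_of G z l \<noteq> 0"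
proof -
  obtain P :: "real^3^3" where P: "\<And>v. \<exists>a. v = P *v a" "\<And>a. P *v a = 0 \<longleftrightarrow> a = 0"
    "\<And>a b. form_of G (P *v a) (P *v b) = a$1 * b$1 + a$2 * b$2 - a$3 * b$3"
    using lorentz_coordinates by blast
  obtain a where a: "l = P *v a" using P(1) by blast
  have "a \<bullet> a \<noteq> 0" using assms a P(2) by auto
  then have "a$1 * a$1 + a$2 * a$2 + a$3 * a$3 \<noteq> 0" by (simp add: inner_vec_def sum_3)
  \<comment> \<open>Reversing the timelike coordinate of \<open>l\<close> turns the Lorentzian
    pairing with \<open>l\<close> into the Euclidean square of its coordinate vector.\<close>
  then have "form_of G (P *v (\<chi> i. if i = 3 then - (a$3) else a$i)) l \<noteq> 0"
    unfolding a P(3) by simp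
  then show ?thesis using that by blast
qed

lemma lorentz_invertible: "invertible G"
proof -
  have "G *v l \<noteq> 0" if "l \<noteq> 0" for l
    using lorentz_nondegenerate[OF that] by (metis form_of_def inner_zero_right)
  then have "inj ((*v) G)"
    by (simp add: linear_injective_0) blast
  then show ?thesis
    by (simp add: invertible_left_inverse matrix_left_invertible_injective)
qed

text \<open>In Lorentz coordinates the third entry of the null vector \<open>l\<close> is nonzero,
  so orthogonality to \<open>l\<close> determines the third entry of a vector. After this
  substitution the form on the orthogonal complement is, up to the positive factor
  \<open>a$3 * a$3\<close>, the product \<open>r b * r c\<close> of a linear functional with itself,
  and on that complement \<open>r\<close> vanishes only along \<open>l\<close>.\<close>

lemma null_orthogonal_complement:
  assumes l: "l \<noteq> 0" "form_of G l l = 0" and x: "form_of G l x = 0" "\<And>k. x \<noteq> k *\<^sub>R l"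
  shows "form_of G x x > 0"
    and "form_of G l y = 0 \<Longrightarrow> form_of G x y = 0 \<Longrightarrow> \<exists>k. y = k *\<^sub>R l"
proof -
  obtain P :: "real^3^3" where P: "\<And>v. \<exists>a. v = P *v a" "\<And>a. P *v a = 0 \<longleftrightarrow> a = 0"
    "\<And>a b. form_of G (P *v a) (P *v b) = a$1 * b$1 + a$2 * b$2 - a$3 * b$3"
    using lorentz_coordinates by blast
  obtain a where a: "l = P *v a" using P(1) by blast
  have a0: "a$1 * a$1 + a$2 * a$2 = a$3 * a$3" using l(2) unfolding a P(3) by simp
  have a3: "a$3 \<noteq> 0"
  proof
    assume "a$3 = 0"
    then have "a$1 = 0" "a$2 = 0" using a0 by (simp_all add: add_nonneg_eq_0_iff)
    then have "a = 0" using \<open>a$3 = 0\<close> by (simp add: vec_eq_iff forall_3)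
    then show False using l(1) a P(2) by simp
  qed
  define r where "r b = a$1 * b$2 - a$2 * b$1" for b :: "real^3"
  have key: "a$3 * a$3 * form_of G (P *v b) (P *v c) = r b * r c"
    if "form_of G l (P *v b) = 0" "form_of G l (P *v c) = 0" for b c
  proof -
    have b: "a$3 * b$3 = a$1 * b$1 + a$2 * b$2" and c: "a$3 * c$3 = a$1 * c$1 + a$2 * c$2"
      using that unfolding a P(3) by auto
    have "a$3 * a$3 * form_of G (P *v b) (P *v c)
      = (a$1 * a$1 + a$2 * a$2) * (b$1 * c$1 + b$2 * c$2) - (a$3 * b$3) * (a$3 * c$3)"
      unfolding P(3) a0 by (simp add: algebra_simps)
    then show ?thesis unfolding b c r_def by (simp add: algebra_simps)
  qed
  have multiple: "\<exists>k. P *v b = k *\<^sub>R l" if "form_of G l (P *v b) = 0" "r b = 0" for b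
  proof -
    have b: "a$3 * b$3 = a$1 * b$1 + a$2 * b$2" using that(1) unfolding a P(3) by auto
    have r: "a$1 * b$2 = a$2 * b$1" using that(2) by (simp add: r_def)
    have "a$3 * (a$3 * b$1) = a$3 * (b$3 * a$1)" "a$3 * (a$3 * b$2) = a$3 * (b$3 * a$2)"
      using a0 b r by algebra+
    then have "b = (b$3 / a$3) *\<^sub>R a" using a3
      by (auto simp: vec_eq_iff forall_3 field_simps)
    then show ?thesis unfolding a by (metis matrix_vector_mult_scaleR)
  qed
  obtain b where b: "x = P *v b" using P(1) by blast
  have rb: "r b \<noteq> 0" using multiple[of b] x b by blast
  have "a$3 * a$3 * form_of G x x = r b * r b" using key x(1) b by blast
  moreover have "r b * r b > 0" "a$3 * a$3 > 0" using rb a3 by (auto simp: zero_less_mult_iff linorder_neq_iff)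
  ultimately show "form_of G x x > 0" by (metis zero_less_mult_pos)
  assume y: "form_of G l y = 0" "form_of G x y = 0"
  obtain c where c: "y = P *v c" using P(1) by blast
  have "r b * r c = 0" using key[of b c] x(1) y b c by simp
  then show "\<exists>k. y = k *\<^sub>R l" using multiple[of c] rb y c by simp
qed

end

text \<open>A Gram-Schmidt step followed by a correction along \<open>l\<close>, which changes the
  square but, for \<open>l\<close> null and orthogonal to \<open>x\<close>, not the pairings with
  \<open>l\<close> and \<open>x\<close>. The formula is rational: with a constant seed
  \<open>z\<close> and smoothly moving \<open>l\<close> and \<open>x\<close> the result moves
  smoothly.\<close>

definition null_completion :: "('a::real_vector \<Rightarrow> 'a \<Rightarrow> real) \<Rightarrow> 'a \<Rightarrow> 'a \<Rightarrow> 'a \<Rightarrow> 'a" where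
  "null_completion b l x z =
     (let u = (1 / b z l) *\<^sub>R (z - (b z x / b x x) *\<^sub>R x) in u - (b u u / 2) *\<^sub>R l)"

lemma null_completion:
  assumes "bilinear b" "\<And>v w. b v w = b w v" "b l l = 0" "b l x = 0" "b x x \<noteq> 0" "b z l \<noteq> 0"
  shows "b (null_completion b l x z) l = 1"
    "b (null_completion b l x z) x = 0"
    "b (null_completion b l x z) (null_completion b l x z) = 0"
proof -
  note bs = bilinear_ladd[OF assms(1)] bilinear_radd[OF assms(1)] bilinear_lsub[OF assms(1)]
    bilinear_rsub[OF assms(1)] bilinear_lmul[OF assms(1)] bilinear_rmul[OF assms(1)]
  define u where "u = (1 / b z l) *\<^sub>R (z - (b z x / b x x) *\<^sub>R x)"
  have n: "null_completion b l x z = u - (b u u / 2) *\<^sub>R l"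
    by (simp add: null_completion_def u_def Let_def)
  have xl: "b x l = 0" using assms by metis
  have ul: "b u l = 1" "b u x = 0" unfolding u_def using assms xl by (simp_all add: bs)
  then have lu: "b l u = 1" using assms(2) by metis
  show "b (null_completion b l x z) l = 1" "b (null_completion b l x z) x = 0"
    "b (null_completion b l x z) (null_completion b l x z) = 0"
    unfolding n by (simp_all add: bs ul lu assms(3,4))
qed

text \<open>In the application \<open>l + b *\<^sub>R x\<close> is the direction of the velocity and
  \<open>h *\<^sub>R l\<close> the normalized null vector, so \<open>N\<close> is the null normal of
  a curvature frame expressed in \<open>(l, x, n)\<close>. Its pairings with \<open>l\<close> and
  \<open>x\<close> are forced; the difference of two candidates is then a multiple of
  \<open>l\<close> by \<open>null_orthogonal_complement\<close>, and nullity makes the multiple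
  zero. The poles in \<open>b\<close> show how \<open>N\<close> degenerates as the velocity becomes
  null.\<close>

lemma null_vector_unique:
  assumes G: "lorentz_form G"
    and l: "l \<noteq> 0" "form_of G l l = 0"
    and x: "form_of G l x = 0" "form_of G x x = w" "\<And>k. x \<noteq> k *\<^sub>R l"
    and n: "form_of G n l = 1" "form_of G n n = 0" "form_of G n x = 0"
    and h: "b \<noteq> 0" "h \<noteq> 0"
    and N: "form_of G N (l + b *\<^sub>R x) = 0" "form_of G N N = 0" "form_of G N (h *\<^sub>R l) = 1"
  shows "N = (1/h) *\<^sub>R (n - (1 / (b * w)) *\<^sub>R x - (1 / (2 * b\<^sup>2 * w)) *\<^sub>R l)"
proof -
  let ?f = "form_of G"
  note bs = bilinear_ladd[OF bilinear_form_of] bilinear_radd[OF bilinear_form_of]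
    bilinear_lsub[OF bilinear_form_of] bilinear_rsub[OF bilinear_form_of]
    bilinear_lmul[OF bilinear_form_of] bilinear_rmul[OF bilinear_form_of]
  have sym: "?f v u = ?f u v" for u v using G form_of_sym lorentz_form_def by metis
  have w: "w > 0" using null_orthogonal_complement(1)[OF G l x(1,3)] x(2) by simp
  define M where "M = (1/h) *\<^sub>R (n - (1 / (b * w)) *\<^sub>R x - (1 / (2 * b\<^sup>2 * w)) *\<^sub>R l)"
  have t: "?f l n = 1" "?f x n = 0" "?f x l = 0" using n x sym by metis+
  have Nl: "?f N l = 1 / h" using N(3) h by (simp add: bs field_simps)
  have Nx: "?f N x = - 1 / (h * b)" using N(1) h Nl by (simp add: bs field_simps)
  have Ml: "?f M l = 1 / h" unfolding M_def by (simp add: bs n t l)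
  have Mx: "?f M x = - 1 / (h * b)" unfolding M_def using w h by (simp add: bs n t l x)
  have MM: "?f M M = 0" unfolding M_def using w h
    by (simp add: bs n t l x) (simp add: field_simps power2_eq_square)
  have "?f l (N - M) = 0" "?f x (N - M) = 0"
    using Nl Ml Nx Mx sym[of N l] sym[of M l] sym[of N x] sym[of M x] by (simp_all add: bs)
  then obtain k where k: "N - M = k *\<^sub>R l"
    using null_orthogonal_complement(2)[OF G l x(1,3)] by blast
  then have "N = M + k *\<^sub>R l" by (simp add: algebra_simps)
  then have "?f N N = 2 * k * (1 / h)"
    using Ml sym[of M l] l MM by (simp add: bs)
  then have "k = 0" using N(2) h by simp
  then show ?thesis using k unfolding M_def by simp
qed

text \<open>Pairing with \<open>W\<close> cancels the inverse matrix in the Christoffel symbols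
  (\<open>inv\<close>). Both lower indices are contracted with the velocity, so two of the three
  derivative terms coincide (\<open>sum_c\<close>); this explains the coefficients 1 and 1/2 in
  \<open>acc\<close>.\<close>

lemma form_of_cov_deriv:
  assumes ff: "form_field (\<lambda>z. form_of (G z)) V" and V: "\<sigma> t \<in> V" and G: "lorentz_form (G (\<sigma> t))"
  shows "form_of (G (\<sigma> t)) (cov_deriv G \<sigma> (vel \<sigma>) t) W = acc (\<lambda>z. form_of (G z)) \<sigma> W t"
proof -
  interpret form_field "\<lambda>z. form_of (G z)" V by (rule ff)
  let ?G = "G (\<sigma> t)" and ?X = "vel \<sigma> t" and ?d = "dform (\<lambda>z. form_of (G z)) (\<sigma> t)"
  let ?e = "\<lambda>i. axis i (1::real) :: real^3"
  have entry: "A $ i $ j = form_of A (?e i) (?e j)" for A :: "real^3^3" and i j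
    by (simp add: form_of_def inner_axis' matrix_vector_mult_basis column_def)
  define c where "c i j l = ?d (?e i) (?e j) (?e l) + ?d (?e j) (?e i) (?e l) - ?d (?e l) (?e i) (?e j)" for i j l
  have chr: "christoffel G (\<sigma> t) k i j = (1/2) * (\<Sum>l\<in>UNIV. matrix_inv ?G $ k $ l * c i j l)" for k i j
    unfolding christoffel_def partial_deriv_def c_def dform_def entry[symmetric] by simp
  have symG: "transpose ?G = ?G" using G lorentz_form_def by blast
  have GI: "matrix_inv ?G ** ?G = mat 1" "?G ** matrix_inv ?G = mat 1"
    using someI_ex[OF lorentz_invertible[OF G, unfolded invertible_def]] unfolding matrix_inv_def by auto
  have inv: "(\<Sum>k\<in>UNIV. matrix_inv ?G $ k $ l * (?G *v W) $ k) = W $ l" for l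
  proof -
    have "transpose (matrix_inv ?G) ** ?G = transpose (?G ** matrix_inv ?G)"
      by (simp add: matrix_transpose_mul symG)
    also have "\<dots> = mat 1" by (simp add: GI transpose_mat)
    finally have "transpose (matrix_inv ?G) *v (?G *v W) = W" by (simp add: matrix_vector_mul_assoc)
    then have "(transpose (matrix_inv ?G) *v (?G *v W)) $ l = W $ l" by simp
    then show ?thesis by (simp add: matrix_vector_mult_def transpose_def)
  qed
  have rep: "v = (\<Sum>i\<in>UNIV. (v $ i) *\<^sub>R ?e i)" for v :: "real^3"
    by (simp add: vec_eq_iff axis_def sum_3 forall_3)
  have tri: "?d X Y Z = (\<Sum>i\<in>UNIV. \<Sum>j\<in>UNIV. \<Sum>l\<in>UNIV. X $ i * Y $ j * Z $ l * ?d (?e i) (?e j) (?e l))" for X Y Z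
    by (subst rep[of X], subst rep[of Y], subst rep[of Z])
       (simp add: sum_3 dform_simps[OF V] algebra_simps)

  have sum_c: "(\<Sum>i\<in>UNIV. \<Sum>j\<in>UNIV. \<Sum>l\<in>UNIV. ?X $ i * ?X $ j * W $ l * c i j l) =
      2 * ?d ?X ?X W - ?d W ?X ?X"
    unfolding tri[of ?X ?X W] tri[of W ?X ?X] c_def by (simp add: sum_3 algebra_simps)
  have "form_of ?G (cov_deriv G \<sigma> (vel \<sigma>) t) W =
      (\<Sum>k\<in>UNIV. (vel (vel \<sigma>) t $ k + (\<Sum>i\<in>UNIV. \<Sum>j\<in>UNIV. christoffel G (\<sigma> t) k i j * ?X $ i * ?X $ j)) * (?G *v W) $ k)"
    unfolding form_of_def cov_deriv_def inner_vec_def by simp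
  also have "\<dots> = form_of ?G (vel (vel \<sigma>) t) W +
      (1/2) * (\<Sum>i\<in>UNIV. \<Sum>j\<in>UNIV. \<Sum>l\<in>UNIV. ?X $ i * ?X $ j * (\<Sum>k\<in>UNIV. matrix_inv ?G $ k $ l * (?G *v W) $ k) * c i j l)"
    unfolding chr form_of_def inner_vec_def by (simp add: sum_3 algebra_simps)
  also have "\<dots> = form_of ?G (vel (vel \<sigma>) t) W + (1/2) * (2 * ?d ?X ?X W - ?d W ?X ?X)"
    unfolding inv sum_c ..
  finally show ?thesis unfolding acc_def by simp
qed

section \<open>Degenerate forms in two variables\<close>

definition det2 :: "real^2 \<Rightarrow> real^2 \<Rightarrow> real" where
  "det2 v w = v $ 1 * w $ 2 - v $ 2 * w $ 1"

definition gram :: "(real^2 \<Rightarrow> real^2 \<Rightarrow> real) \<Rightarrow> real" where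
  "gram g = g (axis 1 1) (axis 1 1) * g (axis 2 1) (axis 2 1) - (g (axis 1 1) (axis 2 1))\<^sup>2"

lemma det2_simps:
  "det2 (u + v) w = det2 u w + det2 v w" "det2 w (u + v) = det2 w u + det2 w v"
  "det2 (r *\<^sub>R v) w = r * det2 v w" "det2 v (r *\<^sub>R w) = r * det2 v w" "det2 v v = 0"
  "det2 0 v = 0" "det2 v 0 = 0"
  by (simp_all add: det2_def algebra_simps)

lemma det2_swap: "det2 v w = - det2 w v"
  by (simp add: det2_def)

lemma vec2_cramer:
  assumes "det2 v w \<noteq> 0"
  shows "x = (det2 x w / det2 v w) *\<^sub>R v + (det2 v x / det2 v w) *\<^sub>R w"
proof -
  have "det2 v w *\<^sub>R x = det2 x w *\<^sub>R v + det2 v x *\<^sub>R w"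
    by (simp add: vec_eq_iff forall_2 det2_def algebra_simps)
  then have "(1 / det2 v w) *\<^sub>R (det2 v w *\<^sub>R x) = (1 / det2 v w) *\<^sub>R (det2 x w *\<^sub>R v + det2 v x *\<^sub>R w)"
    by simp
  then show ?thesis using assms by (simp add: scaleR_add_right)
qed

lemma det2_eq_0_iff:
  assumes "v \<noteq> 0"
  shows "det2 v w = 0 \<longleftrightarrow> (\<exists>k. w = k *\<^sub>R v)"
proof
  assume d: "det2 v w = 0"
  have "v $ 1 \<noteq> 0 \<or> v $ 2 \<noteq> 0" using assms by (auto simp: vec_eq_iff forall_2)
  then show "\<exists>k. w = k *\<^sub>R v"
  proof
    assume "v $ 1 \<noteq> 0"
    then have "w = (w $ 1 / v $ 1) *\<^sub>R v"
      using d by (auto simp: vec_eq_iff forall_2 det2_def field_simps)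
    then show ?thesis by blast
  next
    assume "v $ 2 \<noteq> 0"
    then have "w = (w $ 2 / v $ 2) *\<^sub>R v"
      using d by (auto simp: vec_eq_iff forall_2 det2_def field_simps)
    then show ?thesis by blast
  qed
qed (auto simp: det2_simps)

lemma lin_indep_pair_iff: "lin_indep_pair v w \<longleftrightarrow> det2 v w \<noteq> 0"
proof
  assume l: "lin_indep_pair v w"
  show "det2 v w \<noteq> 0"
  proof
    assume d: "det2 v w = 0"
    have "v \<noteq> 0" using l unfolding lin_indep_pair_def by (metis add.right_neutral scaleR_zero_left scaleR_zero_right zero_neq_one)
    then obtain k where "w = k *\<^sub>R v" using d det2_eq_0_iff by blast
    then have "k *\<^sub>R v + (-1) *\<^sub>R w = 0" by simp
    then show False using l unfolding lin_indep_pair_def by (metis zero_neq_neg_one)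
  qed
next
  assume d: "det2 v w \<noteq> 0"
  show "lin_indep_pair v w"
    unfolding lin_indep_pair_def
  proof (intro allI impI)
    fix a b assume ab: "a *\<^sub>R v + b *\<^sub>R w = 0"
    have "det2 (a *\<^sub>R v + b *\<^sub>R w) w = a * det2 v w" "det2 v (a *\<^sub>R v + b *\<^sub>R w) = b * det2 v w"
      by (simp_all add: det2_simps)
    then show "a = 0 \<and> b = 0" using d unfolding ab by (simp add: det2_simps)
  qed
qed

lemma exists_det2_nonzero:
  assumes "v \<noteq> 0"
  obtains w where "det2 w v \<noteq> 0"
proof -
  have "det2 (vector [- (v$2), v$1]) v = - (v$1 * v$1 + v$2 * v$2)"
    by (simp add: det2_def vector_2)
  moreover have "v$1 * v$1 + v$2 * v$2 \<noteq> 0" using assms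
    by (auto simp: vec_eq_iff forall_2 add_nonneg_eq_0_iff)
  ultimately show ?thesis using that by (metis neg_equal_0_iff_equal)
qed

lemma vec2_rep: "(v :: real^2) = v $ 1 *\<^sub>R axis 1 1 + v $ 2 *\<^sub>R axis 2 (1::real)"
  by (simp add: vec_eq_iff forall_2 axis_def)

context
  fixes g :: "real^2 \<Rightarrow> real^2 \<Rightarrow> real"
  assumes bil: "bilinear g" and sym: "\<And>v w. g v w = g w v"
begin

lemma gram_det2: "g v v * g w w - (g v w)\<^sup>2 = gram g * (det2 v w)\<^sup>2"
proof -
  let ?e = "axis 1 1 :: real^2" and ?f = "axis 2 1 :: real^2"
  have ex: "g a b = a$1 * b$1 * g ?e ?e + a$1 * b$2 * g ?e ?f + a$2 * b$1 * g ?e ?f + a$2 * b$2 * g ?f ?f" for a b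
    by (subst vec2_rep[of a], subst vec2_rep[of b])
       (simp add: bilinear_ladd[OF bil] bilinear_radd[OF bil] bilinear_lmul[OF bil] bilinear_rmul[OF bil]
         sym[of ?f ?e] algebra_simps)
  show ?thesis
    unfolding ex[of v v] ex[of w w] ex[of v w] gram_def det2_def by algebra
qed

lemma gram_eq_0_iff: "gram g = 0 \<longleftrightarrow> (\<exists>v. v \<noteq> 0 \<and> (\<forall>w. g v w = 0))"
proof
  assume "\<exists>v. v \<noteq> 0 \<and> (\<forall>w. g v w = 0)"
  then obtain v where v: "v \<noteq> 0" "\<And>w. g v w = 0" by blast
  obtain w where "det2 w v \<noteq> 0" using exists_det2_nonzero[OF v(1)] .
  then show "gram g = 0" using gram_det2[of v w] v det2_swap[of v w] by simp
next
  assume 0: "gram g = 0"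
  let ?e = "axis 1 1 :: real^2" and ?f = "axis 2 1 :: real^2"
  \<comment> \<open>The kernel vector (-F, E) of a degenerate matrix, except when E = F = 0: then it
    would be zero, and the first basis vector is itself in the kernel.\<close>
  define v where "v = (if g ?e ?e = 0 \<and> g ?e ?f = 0 then ?e else g ?e ?e *\<^sub>R ?f - g ?e ?f *\<^sub>R ?e)"
  have "v \<noteq> 0"
    unfolding v_def by (auto simp: vec_eq_iff axis_def forall_2)
  moreover have "g v ?e = 0" "g v ?f = 0"
    unfolding v_def using 0
    by (auto simp: bilinear_lsub[OF bil] bilinear_lmul[OF bil] sym[of ?f ?e] gram_def power2_eq_square)
  then have "g v w = 0" for w
    by (subst vec2_rep[of w]) (simp add: bilinear_radd[OF bil] bilinear_rmul[OF bil])
  ultimately show "\<exists>v. v \<noteq> 0 \<and> (\<forall>w. g v w = 0)" by blast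
qed

end

text \<open>In the product rule every term that keeps an undifferentiated factor pairing
  \<open>\<eta>\<close> with something vanishes; one term survives.\<close>

lemma (in form_field) dform_null_direction:
  fixes \<xi> \<eta> v :: "'a"
  assumes "z \<in> V" "\<And>w. B z \<eta> w = 0"
  shows "B z \<xi> \<xi> * dform B z v \<eta> \<eta> = FD (\<lambda>z. B z \<xi> \<xi> * B z \<eta> \<eta> - (B z \<xi> \<eta>)\<^sup>2) z v"
proof -
  have "((\<lambda>z. B z \<xi> \<xi> * B z \<eta> \<eta> - (B z \<xi> \<eta>)\<^sup>2) has_derivative
    (\<lambda>v. (B z \<xi> \<xi> * dform B z v \<eta> \<eta> + dform B z v \<xi> \<xi> * B z \<eta> \<eta>)
      - real 2 * dform B z v \<xi> \<eta> * B z \<xi> \<eta> ^ (2 - 1))) (at z)"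
    by (intro has_derivative_diff has_derivative_mult has_derivative_power has_derivative_B assms(1))
  moreover have "B z \<xi> \<eta> = 0" using assms sym by metis
  ultimately show ?thesis using assms(2) by (simp add: FD_eqI)
qed

text \<open>Differentiate the identity between the Gram determinants of \<open>(\<xi>, \<eta>)\<close> and of the standard basis.\<close>

lemma dform_gram:
  fixes \<xi> \<eta> v :: "real^2"
  assumes ff: "form_field B V" and z: "z \<in> V" and null: "\<And>w. B z \<eta> w = 0"
  shows "B z \<xi> \<xi> * dform B z v \<eta> \<eta> = FD (\<lambda>z. gram (B z)) z v * (det2 \<xi> \<eta>)\<^sup>2"
proof -
  interpret form_field B V by (rule ff)
  have sm: "smooth_on (\<lambda>z. gram (B z)) V"
    unfolding gram_def by (intro smooth_intros open_V smooth)
  have "((\<lambda>z. gram (B z) * (det2 \<xi> \<eta>)\<^sup>2) has_derivative (\<lambda>v. FD (\<lambda>z. gram (B z)) z v * (det2 \<xi> \<eta>)\<^sup>2)) (at z)"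
    using smooth_on_has_derivative[OF sm z] by (rule has_derivative_mult_left)
  then have "((\<lambda>z. B z \<xi> \<xi> * B z \<eta> \<eta> - (B z \<xi> \<eta>)\<^sup>2) has_derivative
      (\<lambda>v. FD (\<lambda>z. gram (B z)) z v * (det2 \<xi> \<eta>)\<^sup>2)) (at z)"
    by (rule has_derivative_transform_within_open[OF _ open_V z]) (simp add: gram_det2[OF bilin sym])
  then show ?thesis using dform_null_direction[OF z null] by (simp add: FD_eqI)
qed

section \<open>Charts\<close>

context
  fixes A :: "('p::topological_space, 'e::euclidean_space) chart set" and c
  assumes A: "smooth_atlas A" and c: "c \<in> A"
begin

lemma chart_homeomorphism:
  "homeomorphism (dom_of c) (map_of_chart c ` dom_of c) (map_of_chart c) (inv_chart c)"
  using A c unfolding smooth_atlas_def by blast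

lemma open_chart_dom: "open (dom_of c)"
  using A c unfolding smooth_atlas_def by blast

lemma inv_chart_map [simp]: "q \<in> dom_of c \<Longrightarrow> inv_chart c (map_of_chart c q) = q"
  using chart_homeomorphism unfolding homeomorphism_def by blast

lemma map_inv_chart [simp]: "z \<in> map_of_chart c ` dom_of c \<Longrightarrow> map_of_chart c (inv_chart c z) = z"
  and inv_chart_in_dom: "z \<in> map_of_chart c ` dom_of c \<Longrightarrow> inv_chart c z \<in> dom_of c"
  using inv_chart_map by auto

lemma open_chart_image:
  assumes "open W"
  shows "open (map_of_chart c ` (dom_of c \<inter> W))"
proof -
  have "continuous_on (map_of_chart c ` dom_of c) (inv_chart c)" "open (map_of_chart c ` dom_of c)"
    using chart_homeomorphism A c unfolding homeomorphism_def smooth_atlas_def by blast+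
  then have "open (map_of_chart c ` dom_of c \<inter> inv_chart c -` W)"
    using assms continuous_open_preimage by blast
  moreover have "map_of_chart c ` dom_of c \<inter> inv_chart c -` W = map_of_chart c ` (dom_of c \<inter> W)"
    by auto
  ultimately show ?thesis by simp
qed

lemma open_chart_preimage:
  assumes "open Z"
  shows "open (dom_of c \<inter> map_of_chart c -` Z)"
proof -
  have "continuous_on (dom_of c) (map_of_chart c)"
    using chart_homeomorphism unfolding homeomorphism_def by blast
  then show ?thesis using open_chart_dom assms continuous_open_preimage by blast
qed

lemma smooth_transition:
  assumes "c' \<in> A"
  shows "smooth_on (\<lambda>z. map_of_chart c' (inv_chart c z)) (map_of_chart c ` (dom_of c \<inter> dom_of c'))"
  using A c assms unfolding smooth_atlas_def comp_def by blast

end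

text \<open>Bilinearity, symmetry and smoothness all descend along a pullback, so only the target
  form has to be checked. This is how the first fundamental form becomes a
  \<open>form_field\<close>.\<close>

lemma pullback_formI:
  fixes \<phi> :: "'a::euclidean_space \<Rightarrow> 'b::euclidean_space"
  assumes B2: "form_field B2 V2" and V: "open V1" and \<phi>: "smooth_on \<phi> V1" "\<And>z. z \<in> V1 \<Longrightarrow> \<phi> z \<in> V2"
    and pull: "\<And>z X Y. z \<in> V1 \<Longrightarrow> B1 z X Y = B2 (\<phi> z) (FD \<phi> z X) (FD \<phi> z Y)"
  shows "pullback_form B1 V1 B2 V2 \<phi>"
proof -
  interpret form_field B2 V2 by (rule B2)
  have "form_field B1 V1"
  proof
    show "open V1" by (rule V)
    show "bilinear (B1 z)" if "z \<in> V1" for z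
      unfolding bilinear_def pull[OF that] using \<phi>(2)[OF that] FD_linear[OF \<phi>(1) that]
      by (auto intro!: linearI simp: B_simps linear_add linear_scale)
    show "B1 z X Y = B1 z Y X" if "z \<in> V1" for z X Y
      unfolding pull[OF that] using \<phi>(2)[OF that] by (rule sym)
    show "smooth_on (\<lambda>z. B1 z X Y) V1" for X Y
    proof (rule smooth_on_cong[OF _ V])
      show "smooth_on (\<lambda>z. B2 (\<phi> z) (FD \<phi> z X) (FD \<phi> z Y)) V1"
        by (intro smooth_intros V \<phi> smooth_on_FD)
    qed (simp add: pull)
  qed
  then show ?thesis
    using B2 \<phi> pull by (simp add: pullback_form_def pullback_form_axioms_def)
qed

section \<open>Immersed surfaces in charts\<close>

abbreviation amb_form :: "('s, 'm) surface \<Rightarrow> ('m, real^3) chart \<Rightarrow> real^3 \<Rightarrow> real^3 \<Rightarrow> real^3 \<Rightarrow> real" where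
  "amb_form S d \<equiv> \<lambda>y. form_of (amb_metric S d y)"

abbreviation surf_trans :: "('s, real^2) chart \<Rightarrow> ('s, real^2) chart \<Rightarrow> real^2 \<Rightarrow> real^2" where
  "surf_trans c c' \<equiv> \<lambda>z. map_of_chart c' (inv_chart c z)"

abbreviation amb_trans :: "('m, real^3) chart \<Rightarrow> ('m, real^3) chart \<Rightarrow> real^3 \<Rightarrow> real^3" where
  "amb_trans d d' \<equiv> \<lambda>y. map_of_chart d' (inv_chart d y)"

lemma lam_eq_gram: "lam S c d z = gram (first_form S c d z)"
  by (simp add: lam_def gram_def Let_def)

locale immersion =
  fixes S :: "('s::topological_space, 'm::topological_space) surface"
  assumes immersed: "immersed_surface S"
begin

lemma surf_atlas: "smooth_atlas (surf_atlas S)"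
  and amb_atlas: "smooth_atlas (amb_atlas S)"
  and continuous_surf_map: "continuous_on UNIV (surf_map S)"
  using immersed unfolding immersed_surface_def by blast+

lemma open_surf_preimage: "open W \<Longrightarrow> open (surf_map S -` W)"
  using continuous_surf_map by (metis continuous_on_open_vimage open_UNIV Int_UNIV_right inf_top.right_neutral)

lemma lorentz_amb:
  assumes "d \<in> amb_atlas S" "y \<in> map_of_chart d ` dom_of d"
  shows "lorentz_form (amb_metric S d y)"
  using immersed assms unfolding immersed_surface_def lorentzian_metric_def lorentz_form_def by blast

lemma amb_form_field:
  assumes d: "d \<in> amb_atlas S"
  shows "form_field (amb_form S d) (map_of_chart d ` dom_of d)"
proof
  show op: "open (map_of_chart d ` dom_of d)"
    using open_chart_image[OF amb_atlas d open_UNIV] by simp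
  show "form_of (amb_metric S d y) X Y = form_of (amb_metric S d y) Y X"
    if "y \<in> map_of_chart d ` dom_of d" for y X Y
    using lorentz_amb[OF d that] form_of_sym lorentz_form_def by blast
  have sm: "smooth_on (amb_metric S d) (map_of_chart d ` dom_of d)"
    using immersed d unfolding immersed_surface_def lorentzian_metric_def by blast
  show "smooth_on (\<lambda>y. form_of (amb_metric S d y) X Y) (map_of_chart d ` dom_of d)" for X Y
    unfolding form_of_def matrix_vector_mult_def inner_vec_def
    by (simp, intro smooth_intros op sm)
qed (rule bilinear_form_of)

lemma amb_trans_pullback:
  assumes d: "d \<in> amb_atlas S" "d' \<in> amb_atlas S"
  shows "pullback_form (amb_form S d) (map_of_chart d ` (dom_of d \<inter> dom_of d'))
    (amb_form S d') (map_of_chart d' ` dom_of d') (amb_trans d d')"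
proof (rule pullback_formI[OF amb_form_field[OF d(2)]])
  let ?D = "map_of_chart d ` (dom_of d \<inter> dom_of d')"
  show "open ?D" using open_chart_image[OF amb_atlas d(1) open_chart_dom[OF amb_atlas d(2)]] .
  show sm: "smooth_on (amb_trans d d') ?D" by (rule smooth_transition[OF amb_atlas d])
  show "amb_trans d d' z \<in> map_of_chart d' ` dom_of d'" if "z \<in> ?D" for z
    using that inv_chart_map[OF amb_atlas d(1)] by auto
  fix z X Y assume z: "z \<in> ?D"
  then obtain q where q: "q \<in> dom_of d \<inter> dom_of d'" "z = map_of_chart d q" by blast
  have iz: "inv_chart d z = q" using q inv_chart_map[OF amb_atlas d(1)] by auto
  let ?J = "matrix (FD (amb_trans d d') z)"
  have "amb_metric S d z = transpose ?J ** amb_metric S d' (map_of_chart d' q) ** ?J"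
    using immersed d q unfolding immersed_surface_def lorentzian_metric_def comp_def Let_def by blast
  moreover have "?J *v v = FD (amb_trans d d') z v" for v
    using FD_linear[OF sm z] by (simp add: matrix_works)
  ultimately show "form_of (amb_metric S d z) X Y =
      form_of (amb_metric S d' (amb_trans d d' z)) (FD (amb_trans d d') z X) (FD (amb_trans d d') z Y)"
    by (simp add: form_of_matrix_congruence iz)
qed

context
  fixes c d
  assumes c: "c \<in> surf_atlas S" and d: "d \<in> amb_atlas S"
begin

lemma loc_dom_iff: "z \<in> loc_dom S c d \<longleftrightarrow> z \<in> map_of_chart c ` dom_of c \<and> surf_map S (inv_chart c z) \<in> dom_of d"
  unfolding loc_dom_def using inv_chart_map[OF surf_atlas c] by auto

lemma open_loc_dom: "open (loc_dom S c d)"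
  unfolding loc_dom_def
  using open_chart_image[OF surf_atlas c open_surf_preimage[OF open_chart_dom[OF amb_atlas d]]] .

lemma smooth_loc_map: "smooth_on (loc_map S c d) (loc_dom S c d)"
  using immersed c d unfolding immersed_surface_def by blast

lemma loc_map_in: "z \<in> loc_dom S c d \<Longrightarrow> loc_map S c d z \<in> map_of_chart d ` dom_of d"
  unfolding loc_map_def using loc_dom_iff by auto

lemma FD_loc_map_eq_0:
  assumes "z \<in> loc_dom S c d"
  shows "FD (loc_map S c d) z v = 0 \<longleftrightarrow> v = 0"
  using immersed c d assms linear_injective_0[OF FD_linear[OF smooth_loc_map assms]] linear_0[OF FD_linear[OF smooth_loc_map assms]]
  unfolding immersed_surface_def loc_diff_def by blast

lemma first_form_pullback:
  "pullback_form (first_form S c d) (loc_dom S c d) (amb_form S d) (map_of_chart d ` dom_of d) (loc_map S c d)"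
  by (rule pullback_formI[OF amb_form_field[OF d] open_loc_dom smooth_loc_map loc_map_in])
     (simp_all add: first_form_def loc_diff_def)

lemma first_form_field: "form_field (first_form S c d) (loc_dom S c d)"
  using first_form_pullback pullback_form_def by blast

text \<open>The differential of an immersion is injective, so the images of \<open>\<xi>\<close> and
  \<open>\<eta>\<close> are independent; that of \<open>\<eta>\<close> is null and orthogonal to
  that of \<open>\<xi>\<close>, and \<open>null_orthogonal_complement\<close> applies. Every
  direction transverse to the null one is thus spacelike, which is the source of
  \<open>w > 0\<close>.\<close>

lemma first_form_positive:
  assumes z: "z \<in> loc_dom S c d" and \<eta>: "\<And>w. first_form S c d z \<eta> w = 0" and \<xi>: "det2 \<xi> \<eta> \<noteq> 0"
  shows "first_form S c d z \<xi> \<xi> > 0" "\<And>k. FD (loc_map S c d) z \<xi> \<noteq> k *\<^sub>R FD (loc_map S c d) z \<eta>"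
    "FD (loc_map S c d) z \<eta> \<noteq> 0"
proof -
  note lin = FD_linear[OF smooth_loc_map z]
  have "\<eta> \<noteq> 0" using \<xi> det2_simps by auto
  then show n: "FD (loc_map S c d) z \<eta> \<noteq> 0" using FD_loc_map_eq_0[OF z] by blast
  show k: "FD (loc_map S c d) z \<xi> \<noteq> k *\<^sub>R FD (loc_map S c d) z \<eta>" for k
  proof
    assume "FD (loc_map S c d) z \<xi> = k *\<^sub>R FD (loc_map S c d) z \<eta>"
    then have "FD (loc_map S c d) z (\<xi> - k *\<^sub>R \<eta>) = 0"
      by (simp add: linear_diff[OF lin] linear_scale[OF lin])
    then have "\<xi> = k *\<^sub>R \<eta>" using FD_loc_map_eq_0[OF z] by simp
    then show False using \<xi> by (simp add: det2_simps)
  qed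
  show "first_form S c d z \<xi> \<xi> > 0"
    using null_orthogonal_complement(1)[OF lorentz_amb[OF d loc_map_in[OF z]] n _ _ k] \<eta>
    unfolding first_form_def loc_diff_def by blast
qed

lemma null_directions_dependent:
  assumes "z \<in> loc_dom S c d" "\<And>w. first_form S c d z \<eta> w = 0" "\<And>w. first_form S c d z \<xi> w = 0"
  shows "det2 \<xi> \<eta> = 0"
  using first_form_positive(1)[OF assms(1,2)] assms(3) by force

lemma smooth_lam: "smooth_on (lam S c d) (loc_dom S c d)"
proof -
  interpret form_field "first_form S c d" "loc_dom S c d" by (rule first_form_field)
  have "smooth_on (\<lambda>z. gram (first_form S c d z)) (loc_dom S c d)"
    unfolding gram_def by (intro smooth_intros open_V smooth)
  then show ?thesis by (simp add: lam_eq_gram[abs_def])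
qed

lemma dform_lam:
  assumes z: "z \<in> loc_dom S c d" and null: "\<And>w. first_form S c d z \<eta> w = 0"
  shows "first_form S c d z \<xi> \<xi> * dform (first_form S c d) z v \<eta> \<eta> = FD (lam S c d) z v * (det2 \<xi> \<eta>)\<^sup>2"
  using dform_gram[OF first_form_field z null] by (simp add: lam_eq_gram[abs_def])

end

section \<open>Changes of charts\<close>

lemma coords_at_loc_dom:
  "coords_at S q c d \<Longrightarrow> map_of_chart c q \<in> loc_dom S c d"
  unfolding coords_at_def loc_dom_def by blast

text \<open>The condition is symmetric in the two pairs of charts, so the two coordinate changes map
  the two overlaps inversely onto each other, with all local expressions defined there.\<close>

definition overlap where
  "overlap c d c' d' = map_of_chart c ` (dom_of c \<inter> (dom_of c' \<inter> surf_map S -` (dom_of d \<inter> dom_of d')))"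

context
  fixes c d c' d'
  assumes c: "c \<in> surf_atlas S" "c' \<in> surf_atlas S" and d: "d \<in> amb_atlas S" "d' \<in> amb_atlas S"
begin

lemma open_overlap: "open (overlap c d c' d')"
  unfolding overlap_def
  by (intro open_chart_image[OF surf_atlas c(1)] open_Int open_surf_preimage
      open_chart_dom[OF surf_atlas] open_chart_dom[OF amb_atlas] c d)

lemma overlap_subset: "overlap c d c' d' \<subseteq> loc_dom S c d"
  unfolding overlap_def loc_dom_def by blast

lemma surf_trans_in: "z \<in> overlap c d c' d' \<Longrightarrow> surf_trans c c' z \<in> overlap c' d' c d"
  unfolding overlap_def using inv_chart_map[OF surf_atlas c(1)] by auto

lemma surf_trans_inverse: "z \<in> overlap c d c' d' \<Longrightarrow> surf_trans c' c (surf_trans c c' z) = z"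
  unfolding overlap_def
  using inv_chart_map[OF surf_atlas c(1)] inv_chart_map[OF surf_atlas c(2)] by auto

lemma smooth_surf_trans: "smooth_on (surf_trans c c') (overlap c d c' d')"
  by (rule smooth_on_subset[OF smooth_transition[OF surf_atlas c]]) (auto simp: overlap_def)

lemma loc_map_trans:
  assumes "z \<in> overlap c d c' d'"
  shows "loc_map S c' d' (surf_trans c c' z) = amb_trans d d' (loc_map S c d z)"
    "loc_map S c d z \<in> map_of_chart d ` (dom_of d \<inter> dom_of d')"
  using assms unfolding overlap_def loc_map_def
  by (auto simp: inv_chart_map[OF surf_atlas c(1)] inv_chart_map[OF surf_atlas c(2)]
      inv_chart_map[OF amb_atlas d(1)])

end

context
  fixes c d c' d'
  assumes c: "c \<in> surf_atlas S" "c' \<in> surf_atlas S" and d: "d \<in> amb_atlas S" "d' \<in> amb_atlas S"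
begin

lemma surf_trans_loc_dom: "z \<in> overlap c d c' d' \<Longrightarrow> surf_trans c c' z \<in> loc_dom S c' d'"
  using surf_trans_in[OF c d] overlap_subset[OF c(2,1) d(2,1)] by blast

lemma FD_loc_map_trans:
  assumes z: "z \<in> overlap c d c' d'"
  shows "FD (loc_map S c' d') (surf_trans c c' z) (FD (surf_trans c c') z v) =
    FD (amb_trans d d') (loc_map S c d z) (FD (loc_map S c d) z v)"
proof -
  have zl: "z \<in> loc_dom S c d" using z overlap_subset[OF c d] by blast
  have "((\<lambda>z. loc_map S c' d' (surf_trans c c' z)) has_derivative
      (\<lambda>v. FD (loc_map S c' d') (surf_trans c c' z) (FD (surf_trans c c') z v))) (at z)"
    using has_derivative_compose[OF smooth_on_has_derivative[OF smooth_surf_trans[OF c d] z]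
        smooth_on_has_derivative[OF smooth_loc_map[OF c(2) d(2)] surf_trans_loc_dom[OF z]]] .
  moreover have D: "((\<lambda>z. amb_trans d d' (loc_map S c d z)) has_derivative
      (\<lambda>v. FD (amb_trans d d') (loc_map S c d z) (FD (loc_map S c d) z v))) (at z)"
    using has_derivative_compose[OF smooth_on_has_derivative[OF smooth_loc_map[OF c(1) d(1)] zl]
        smooth_on_has_derivative[OF smooth_transition[OF amb_atlas d] loc_map_trans(2)[OF c d z]]] .
  then have "((\<lambda>z. loc_map S c' d' (surf_trans c c' z)) has_derivative
      (\<lambda>v. FD (amb_trans d d') (loc_map S c d z) (FD (loc_map S c d) z v))) (at z)"
    by (rule has_derivative_transform_within_open[OF _ open_overlap[OF c d] z])
       (simp add: loc_map_trans[OF c d])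
  ultimately show ?thesis using has_derivative_unique by metis
qed

lemma first_form_trans:
  "pullback_form (first_form S c d) (overlap c d c' d') (first_form S c' d') (loc_dom S c' d') (surf_trans c c')"
proof (rule pullback_formI[OF first_form_field[OF c(2) d(2)] open_overlap[OF c d] smooth_surf_trans[OF c d]
      surf_trans_loc_dom])
  fix z X Y assume z: "z \<in> overlap c d c' d'"
  interpret A: pullback_form "amb_form S d" "map_of_chart d ` (dom_of d \<inter> dom_of d')" "amb_form S d'"
    "map_of_chart d' ` dom_of d'" "amb_trans d d'" by (rule amb_trans_pullback[OF d])
  show "first_form S c d z X Y =
      first_form S c' d' (surf_trans c c' z) (FD (surf_trans c c') z X) (FD (surf_trans c c') z Y)"
    unfolding first_form_def loc_diff_def FD_loc_map_trans[OF z] loc_map_trans(1)[OF c d z]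
    by (rule A.pull[OF loc_map_trans(2)[OF c d z]])
qed

end

lemma FD_surf_trans_inverse:
  assumes c: "c \<in> surf_atlas S" "c' \<in> surf_atlas S" and d: "d \<in> amb_atlas S" "d' \<in> amb_atlas S"
    and z: "z \<in> overlap c d c' d'"
  shows "FD (surf_trans c' c) (surf_trans c c' z) (FD (surf_trans c c') z v) = v"
proof -
  have "((\<lambda>z. surf_trans c' c (surf_trans c c' z)) has_derivative
      (\<lambda>v. FD (surf_trans c' c) (surf_trans c c' z) (FD (surf_trans c c') z v))) (at z)"
    using has_derivative_compose[OF smooth_on_has_derivative[OF smooth_surf_trans[OF c d] z]
        smooth_on_has_derivative[OF smooth_surf_trans[OF c(2,1) d(2,1)] surf_trans_in[OF c d z]]] .
  then have "((\<lambda>z. z) has_derivative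
      (\<lambda>v. FD (surf_trans c' c) (surf_trans c c' z) (FD (surf_trans c c') z v))) (at z)"
    by (rule has_derivative_transform_within_open[OF _ open_overlap[OF c d] z])
       (rule surf_trans_inverse[OF c d])
  then show ?thesis using has_derivative_unique[OF has_derivative_ident] by metis
qed

lemma null_trans:
  assumes c: "c \<in> surf_atlas S" "c' \<in> surf_atlas S" and d: "d \<in> amb_atlas S" "d' \<in> amb_atlas S"
    and z: "z \<in> overlap c d c' d'" and null: "\<And>w. first_form S c d z v w = 0"
  shows "first_form S c' d' (surf_trans c c' z) (FD (surf_trans c c') z v) w = 0"
proof -
  interpret P: pullback_form "first_form S c d" "overlap c d c' d'" "first_form S c' d'" "loc_dom S c' d'" "surf_trans c c'"
    by (rule first_form_trans[OF c d])
  define u where "u = FD (surf_trans c' c) (surf_trans c c' z) w"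
  have "FD (surf_trans c c') z u = w"
    using FD_surf_trans_inverse[OF c(2,1) d(2,1) surf_trans_in[OF c d z], of w] surf_trans_inverse[OF c d z]
    by (simp add: u_def)
  then show ?thesis using null[of u] P.pull[OF z, of v u] by simp
qed

lemma FD_surf_trans_eq_0:
  assumes c: "c \<in> surf_atlas S" "c' \<in> surf_atlas S" and d: "d \<in> amb_atlas S" "d' \<in> amb_atlas S"
    and z: "z \<in> overlap c d c' d'"
  shows "FD (surf_trans c c') z v = 0 \<longleftrightarrow> v = 0"
  using FD_surf_trans_inverse[OF c d z, of v] linear_0[OF FD_linear[OF smooth_surf_trans[OF c d] z]]
    linear_0[OF FD_linear[OF smooth_surf_trans[OF c(2,1) d(2,1)] surf_trans_in[OF c d z]]] by force

section \<open>Chart independence of lightlike and non-degenerate points\<close>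

lemma coords_at_overlap:
  assumes "coords_at S q c d" "coords_at S q c' d'"
  shows "map_of_chart c q \<in> overlap c d c' d'" "surf_trans c c' (map_of_chart c q) = map_of_chart c' q"
  using assms inv_chart_map[OF surf_atlas] unfolding coords_at_def overlap_def by auto

text \<open>\<open>lightlike_point\<close> asks for some pair of charts. Transporting the null
  vector by the coordinate change shows that the test by \<open>lam\<close> may be made in any
  pair.\<close>

lemma lightlike_iff_lam:
  assumes q: "coords_at S q c d"
  shows "lightlike_point S q \<longleftrightarrow> lam S c d (map_of_chart c q) = 0"
proof -
  have *: "lam S c d (map_of_chart c q) = 0 \<longleftrightarrow>
      (\<exists>v. v \<noteq> 0 \<and> (\<forall>w. first_form S c d (map_of_chart c q) v w = 0))" if "coords_at S q c d" for c d
  proof -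
    interpret form_field "first_form S c d" "loc_dom S c d"
      using first_form_field that coords_at_def by metis
    show ?thesis unfolding lam_eq_gram
      by (rule gram_eq_0_iff) (use coords_at_loc_dom[OF that] bilin sym in auto)
  qed
  have "\<exists>v. v \<noteq> 0 \<and> (\<forall>w. first_form S c d (map_of_chart c q) v w = 0)"
    if q': "coords_at S q c' d'" and v: "v \<noteq> 0" "\<forall>w. first_form S c' d' (map_of_chart c' q) v w = 0" for c' d' v
  proof -
    have cd: "c' \<in> surf_atlas S" "c \<in> surf_atlas S" "d' \<in> amb_atlas S" "d \<in> amb_atlas S"
      using q q' coords_at_def by metis+
    have o: "map_of_chart c' q \<in> overlap c' d' c d" "surf_trans c' c (map_of_chart c' q) = map_of_chart c q"
      using coords_at_overlap[OF q' q] .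
    show ?thesis
      using null_trans[OF cd o(1)] v FD_surf_trans_eq_0[OF cd o(1), of v] unfolding o(2) by blast
  qed
  then show ?thesis unfolding lightlike_point_def using *[OF q] q by blast
qed

lemma LD_iff_lam:
  assumes "c \<in> surf_atlas S" "d \<in> amb_atlas S" "z \<in> loc_dom S c d"
  shows "inv_chart c z \<in> LD S \<longleftrightarrow> lam S c d z = 0"
proof -
  have z: "z \<in> map_of_chart c ` dom_of c" "surf_map S (inv_chart c z) \<in> dom_of d"
    using assms loc_dom_iff by auto
  then have "coords_at S (inv_chart c z) c d"
    using assms inv_chart_in_dom[OF surf_atlas assms(1)] unfolding coords_at_def by blast
  from lightlike_iff_lam[OF this] show ?thesis
    using map_inv_chart[OF surf_atlas assms(1) z(1)] by (simp add: LD_def)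
qed

lemma lam_trans:
  assumes c: "c \<in> surf_atlas S" "c' \<in> surf_atlas S" and d: "d \<in> amb_atlas S" "d' \<in> amb_atlas S"
    and z: "z \<in> overlap c d c' d'"
  shows "lam S c d z = lam S c' d' (surf_trans c c' z) *
    (det2 (FD (surf_trans c c') z (axis 1 1)) (FD (surf_trans c c') z (axis 2 1)))\<^sup>2"
proof -
  interpret P: pullback_form "first_form S c d" "overlap c d c' d'" "first_form S c' d'" "loc_dom S c' d'" "surf_trans c c'"
    by (rule first_form_trans[OF c d])
  have z': "surf_trans c c' z \<in> loc_dom S c' d'" using P.maps[OF z] .
  show ?thesis
    unfolding lam_eq_gram gram_det2[OF P.B2.bilin[OF z'] P.B2.sym[OF z'], symmetric]
    by (simp add: gram_def P.pull[OF z])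
qed

text \<open>\<open>lam\<close> changes by the square of a Jacobian determinant
  (\<open>lam_trans\<close>). At a zero of \<open>lam\<close> the product rule leaves no derivative
  of that factor, so a nonzero differential in some charts forces one in all.\<close>

lemma nondegenerate_FD_lam:
  assumes nd: "nondegenerate_point S q" and q: "coords_at S q c d"
  obtains v where "FD (lam S c d) (map_of_chart c q) v \<noteq> 0"
proof -
  obtain c' d' where q': "coords_at S q c' d'" and ne: "FD (lam S c' d') (map_of_chart c' q) \<noteq> (\<lambda>v. 0)"
    using nd nondegenerate_point_def by metis
  have cd: "c' \<in> surf_atlas S" "c \<in> surf_atlas S" "d' \<in> amb_atlas S" "d \<in> amb_atlas S"
    using q q' coords_at_def by metis+
  have o: "map_of_chart c' q \<in> overlap c' d' c d" "surf_trans c' c (map_of_chart c' q) = map_of_chart c q"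
    using coords_at_overlap[OF q' q] .
  let ?z = "map_of_chart c' q"
  let ?k = "\<lambda>z. (det2 (FD (surf_trans c' c) z (axis 1 1)) (FD (surf_trans c' c) z (axis 2 1)))\<^sup>2"
  have sk: "smooth_on ?k (overlap c' d' c d)"
    unfolding det2_def by (intro smooth_intros open_overlap[OF cd] smooth_on_FD smooth_surf_trans[OF cd])
  have l0: "lam S c d (map_of_chart c q) = 0"
    using nd lightlike_iff_lam[OF q] nondegenerate_point_def by metis
  have "((\<lambda>z. lam S c d (surf_trans c' c z) * ?k z) has_derivative
      (\<lambda>v. lam S c d (surf_trans c' c ?z) * FD ?k ?z v +
        FD (lam S c d) (surf_trans c' c ?z) (FD (surf_trans c' c) ?z v) * ?k ?z)) (at ?z)"
    by (intro has_derivative_mult smooth_on_has_derivative[OF sk o(1)]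
        has_derivative_compose[OF smooth_on_has_derivative[OF smooth_surf_trans[OF cd] o(1)]]
        smooth_on_has_derivative[OF smooth_lam[OF cd(2,4)]] surf_trans_loc_dom[OF cd o(1)])
  then have "(lam S c' d' has_derivative
      (\<lambda>v. lam S c d (surf_trans c' c ?z) * FD ?k ?z v +
        FD (lam S c d) (surf_trans c' c ?z) (FD (surf_trans c' c) ?z v) * ?k ?z)) (at ?z)"
    by (rule has_derivative_transform_within_open[OF _ open_overlap[OF cd] o(1)])
       (simp add: lam_trans[OF cd])
  then have "FD (lam S c' d') ?z = (\<lambda>v. FD (lam S c d) (map_of_chart c q) (FD (surf_trans c' c) ?z v) * ?k ?z)"
    using FD_eqI l0 o(2) by simp
  then have "\<exists>v. FD (lam S c d) (map_of_chart c q) v \<noteq> 0" using ne by fastforce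
  then show ?thesis using that by blast
qed

end

section \<open>Curves in the zero set of a function of two variables\<close>

lemma eventually_small_interval:
  assumes "isCont f (0::real)" "open W" "f 0 \<in> W"
  obtains \<delta> where "\<delta> > 0" "\<And>t. \<bar>t\<bar> < \<delta> \<Longrightarrow> f t \<in> W"
proof -
  have "eventually (\<lambda>t. f t \<in> W) (nhds 0)"
    using topological_tendstoD[of f "f 0" "nhds 0"] assms tendsto_at_iff_tendsto_nhds[of f 0]
    unfolding continuous_at by blast
  then show ?thesis using that unfolding eventually_nhds_metric dist_real_def by auto
qed

lemma kernel_1dim:
  assumes h: "linear (h :: real^2 \<Rightarrow> real)" "h v \<noteq> 0" and u: "h u = 0" "u \<noteq> 0" and w: "h w = 0"
  obtains k where "w = k *\<^sub>R u"
proof -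
  have "det2 u w = 0"
  proof (rule ccontr)
    assume d: "det2 u w \<noteq> 0"
    have "h v = 0"
      by (subst vec2_cramer[OF d, of v]) (simp add: linear_add[OF h(1)] linear_scale[OF h(1)] u w)
    then show False using h(2) by simp
  qed
  then show ?thesis using det2_eq_0_iff[OF u(2)] that by blast
qed

lemma zero_curve:
  fixes lam :: "real^2 \<Rightarrow> real"
  assumes lam: "smooth_on lam V" "open V" and I: "open I" "t \<in> I"
    and x: "smooth_on x I" "\<And>s. s \<in> I \<Longrightarrow> x s \<in> V" and z: "\<And>s. s \<in> I \<Longrightarrow> lam (x s) = 0"
  shows "FD lam (x t) (vel x t) = 0"
    "FD lam (x t) (vel (vel x) t) + FD (\<lambda>z. FD lam z (vel x t)) (x t) (vel x t) = 0"
proof -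
  have v: "vel (\<lambda>s. 0::real) s = 0" for s by simp
  have z': "\<And>s. s \<in> I \<Longrightarrow> (0::real) = lam (x s)" using z by simp
  show "FD lam (x t) (vel x t) = 0"
    using vel_compose(1)[OF lam I x z'] by simp
  have "vel (vel (\<lambda>s. 0::real)) t = 0" using v by simp
  then show "FD lam (x t) (vel (vel x) t) + FD (\<lambda>z. FD lam z (vel x t)) (x t) (vel x t) = 0"
    using vel_compose(2)[OF lam I x z'] by simp
qed

lemma FD_FD_scale:
  fixes h :: "'a::euclidean_space \<Rightarrow> 'b::real_normed_vector"
  assumes h: "smooth_on h V" and V: "open V" "z \<in> V"
  shows "FD (\<lambda>z. FD h z (k *\<^sub>R u)) z (k *\<^sub>R u) = k\<^sup>2 *\<^sub>R FD (\<lambda>z. FD h z u) z u"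
proof -
  have "((\<lambda>z. k *\<^sub>R FD h z u) has_derivative (\<lambda>w. k *\<^sub>R FD (\<lambda>z. FD h z u) z w)) (at z)"
    by (intro has_derivative_scaleR_right smooth_on_has_derivative[OF smooth_on_FD[OF h] V(2)])
  then have "((\<lambda>z. FD h z (k *\<^sub>R u)) has_derivative (\<lambda>w. k *\<^sub>R FD (\<lambda>z. FD h z u) z w)) (at z)"
    by (rule has_derivative_transform_within_open[OF _ V]) (simp add: linear_scale[OF FD_linear[OF h]])
  then have "FD (\<lambda>z. FD h z (k *\<^sub>R u)) z w = k *\<^sub>R FD (\<lambda>z. FD h z u) z w" for w
    by (simp add: FD_eqI)
  then show ?thesis
    using linear_scale[OF FD_linear[OF smooth_on_FD[OF h] V(2)]] by (simp add: power2_eq_square)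
qed

text \<open>The kernel of the differential of \<open>lam\<close> is a line, so the velocities are
  proportional. Differentiating \<open>lam = 0\<close> twice along both curves, the Hessian terms
  differ by the factor \<open>k\<^sup>2\<close>, so the corresponding difference of accelerations
  lies in the same line. Curves in the zero set thus share their 2-jet up to reparametrization,
  which is all that \<open>acc\<close> sees.\<close>

lemma zero_curves_second_order:
  fixes lam :: "real^2 \<Rightarrow> real"
  assumes lam: "smooth_on lam V" "open V" "FD lam (x t) v \<noteq> 0"
    and I: "open I" "t \<in> I" and x: "smooth_on x I" "\<And>s. s \<in> I \<Longrightarrow> x s \<in> V"
      "\<And>s. s \<in> I \<Longrightarrow> lam (x s) = 0" "vel x t \<noteq> 0"
    and J: "open J" "r \<in> J" and y: "smooth_on y J" "\<And>s. s \<in> J \<Longrightarrow> y s \<in> V"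
      "\<And>s. s \<in> J \<Longrightarrow> lam (y s) = 0" and xy: "y r = x t"
  obtains k l where "vel y r = k *\<^sub>R vel x t" "vel (vel y) r = k\<^sup>2 *\<^sub>R vel (vel x) t + l *\<^sub>R vel x t"
proof -
  have V: "x t \<in> V" using I x by blast
  note lin = FD_linear[OF lam(1) V]
  note zx = zero_curve[OF lam(1,2) I x(1-3)] and zy = zero_curve[OF lam(1,2) J y, unfolded xy]
  obtain k where k: "vel y r = k *\<^sub>R vel x t"
    using kernel_1dim[OF lin lam(3) zx(1) x(4) zy(1)] .
  have "FD (\<lambda>z. FD lam z (vel y r)) (x t) (vel y r) = k\<^sup>2 * FD (\<lambda>z. FD lam z (vel x t)) (x t) (vel x t)"
    unfolding k using FD_FD_scale[OF lam(1,2) V] by simp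
  then have "FD lam (x t) (vel (vel y) r - k\<^sup>2 *\<^sub>R vel (vel x) t) = 0"
    using zx(2) zy(2) by (simp add: linear_diff[OF lin] linear_scale[OF lin] add_eq_0_iff)
  then obtain l where "vel (vel y) r - k\<^sup>2 *\<^sub>R vel (vel x) t = l *\<^sub>R vel x t"
    using kernel_1dim[OF lin lam(3) zx(1) x(4)] by blast
  then have "vel (vel y) r = k\<^sup>2 *\<^sub>R vel (vel x) t + l *\<^sub>R vel x t" by (simp add: algebra_simps)
  then show ?thesis using that k by blast
qed

text \<open>The given curve may be self-overlapping far away from \<open>x 0\<close>; near \<open>x 0\<close> it is the graph
  of the implicit function.\<close>

lemma zero_set_local_graph:
  fixes lam :: "real^2 \<Rightarrow> real"
  assumes lam: "smooth_on lam V" "open V" "FD lam (x 0) v \<noteq> 0" and \<epsilon>: "\<epsilon> > 0"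
    and x: "smooth_on x {-\<epsilon><..<\<epsilon>}" "\<And>t. t \<in> {-\<epsilon><..<\<epsilon>} \<Longrightarrow> x t \<in> V"
      "\<And>t. t \<in> {-\<epsilon><..<\<epsilon>} \<Longrightarrow> lam (x t) = 0" "vel x 0 \<noteq> 0"
  obtains \<epsilon>0 where "0 < \<epsilon>0" "\<epsilon>0 \<le> \<epsilon>"
    "\<And>\<epsilon>'. 0 < \<epsilon>' \<Longrightarrow> \<epsilon>' \<le> \<epsilon>0 \<Longrightarrow>
      \<exists>W. open W \<and> x 0 \<in> W \<and> W \<subseteq> V \<and> {z\<in>W. lam z = 0} = x ` {-\<epsilon>'<..<\<epsilon>'}"
proof -
  have I: "open {-\<epsilon><..<\<epsilon>}" "0 \<in> {-\<epsilon><..<\<epsilon>}" using \<epsilon> by auto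
  define a where "a = vel x 0"
  obtain u where u: "det2 u a \<noteq> 0" using exists_det2_nonzero x(4) a_def by metis
  \<comment> \<open>\<open>a\<close> turned by a right angle. The differential of \<open>lam\<close>
    at \<open>x 0\<close> has kernel spanned by \<open>a\<close>, so it is nonzero on
    \<open>w\<close>, and it stays so on a small ball: there \<open>lam\<close> has at most one zero
    on each line parallel to \<open>w\<close>.\<close>
  define w :: "real^2" where "w = vector [- (a$2), a$1]"
  have aw: "a \<bullet> w = 0" "w \<bullet> a = 0" by (simp_all add: w_def inner_vec_def sum_2 vector_2)
  have da: "det2 a w = a \<bullet> a" by (simp add: w_def inner_vec_def sum_2 vector_2 det2_def)
  then have daw: "det2 a w \<noteq> 0" using x(4) a_def by simp
  have V0: "x 0 \<in> V" using x I by blast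
  have la: "FD lam (x 0) a = 0" "a \<noteq> 0"
    using zero_curve(1)[OF lam(1,2) I x(1-3)] x(4) by (auto simp: a_def)
  have w0: "FD lam (x 0) w \<noteq> 0"
  proof
    assume "FD lam (x 0) w = 0"
    then obtain k where "w = k *\<^sub>R a"
      using kernel_1dim[OF FD_linear[OF lam(1) V0] lam(3) la] by blast
    then show False using daw by (simp add: det2_simps)
  qed
  have "isCont (\<lambda>z. FD lam z w) (x 0)"
    using smooth_on_imp_continuous_at[OF smooth_on_FD[OF lam(1)] V0] .
  then obtain r0 where r0: "r0 > 0" "\<And>z. dist (x 0) z < r0 \<Longrightarrow> FD lam z w \<noteq> 0"
    using continuous_at_avoid[of "x 0" "\<lambda>z. FD lam z w" 0] w0 by blast
  obtain r1 where r1: "r1 > 0" "ball (x 0) r1 \<subseteq> V" using lam(2) V0 open_contains_ball by blast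
  define r where "r = min r0 r1"
  have r: "r > 0" "ball (x 0) r \<subseteq> V" "\<And>z. z \<in> ball (x 0) r \<Longrightarrow> FD lam z w \<noteq> 0"
    using r0 r1 by (auto simp: r_def)
  define m where "m z = z \<bullet> a" for z
  have mx: "((\<lambda>t. m (x t)) has_real_derivative vel x t \<bullet> a) (at t)" if "t \<in> {-\<epsilon><..<\<epsilon>}" for t
    using smooth_curve_has_vector_derivative[OF x(1) that] unfolding m_def has_field_derivative_def
    by (auto simp: has_vector_derivative_def mult.commute intro!: derivative_eq_intros)
  have c: "isCont (\<lambda>t. vel x t \<bullet> a) 0"
    by (intro continuous_intros smooth_on_imp_continuous_at[OF smooth_on_vector_derivative[OF I(1) x(1)] I(2)])
  have a0: "vel x 0 \<bullet> a > 0" using x(4) by (simp add: a_def)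
  obtain d1 where d1: "d1 > 0" "\<And>t. \<bar>t\<bar> < d1 \<Longrightarrow> vel x t \<bullet> a > 0"
    using eventually_small_interval[OF c, of "{0<..}"] a0 by auto
  obtain d2 where d2: "d2 > 0" "\<And>t. \<bar>t\<bar> < d2 \<Longrightarrow> x t \<in> ball (x 0) r"
    using eventually_small_interval[OF smooth_on_imp_continuous_at[OF x(1) I(2)], of "ball (x 0) r"] r by auto
  define \<epsilon>0 where "\<epsilon>0 = min (min d1 d2) \<epsilon> / 2"
  have e0: "0 < \<epsilon>0" "\<epsilon>0 < d1" "\<epsilon>0 < d2" "\<epsilon>0 < \<epsilon>" using d1 d2 \<epsilon> by (auto simp: \<epsilon>0_def min_def)
  have mono: "m (x s) < m (x t)" if "s < t" "- \<epsilon>0 \<le> s" "t \<le> \<epsilon>0" for s t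
  proof (rule DERIV_pos_imp_increasing[OF that(1)])
    fix y assume "s \<le> y" "y \<le> t"
    then have "\<bar>y\<bar> < d1" "y \<in> {-\<epsilon><..<\<epsilon>}" using that e0 by auto
    then show "\<exists>D. ((\<lambda>t. m (x t)) has_real_derivative D) (at y) \<and> D > 0" using mx d1 by blast
  qed
  show ?thesis
  proof (rule that[of \<epsilon>0])
    fix \<epsilon>' :: real assume e': "0 < \<epsilon>'" "\<epsilon>' \<le> \<epsilon>0"
    \<comment> \<open>The part of the ball between the level lines of \<open>m\<close> through the
      two end points. A zero in \<open>W\<close> has the same height \<open>m\<close> as some
      \<open>x t\<close>, so it differs from it by a multiple of \<open>w\<close>, and the mean
      value theorem makes this multiple zero. All radii up to \<open>\<epsilon>0\<close> are covered
      because the interval is shrunk further in the applications.\<close>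
    define W where "W = ball (x 0) r \<inter> {z. m (x (-\<epsilon>')) < m z} \<inter> {z. m z < m (x \<epsilon>')}"
    have "{z\<in>W. lam z = 0} = x ` {-\<epsilon>'<..<\<epsilon>'}"
    proof (intro subset_antisym subsetI)
      fix z assume "z \<in> x ` {-\<epsilon>'<..<\<epsilon>'}"
      then obtain t where t: "-\<epsilon>' < t" "t < \<epsilon>'" "z = x t" by auto
      then show "z \<in> {z\<in>W. lam z = 0}"
        using mono[of "-\<epsilon>'" t] mono[of t "\<epsilon>'"] d2(2)[of t] x(3)[of t] e' e0 by (auto simp: W_def)
    next
      fix z assume "z \<in> {z\<in>W. lam z = 0}"
      then have z: "z \<in> ball (x 0) r" "m (x (-\<epsilon>')) < m z" "m z < m (x \<epsilon>')" "lam z = 0"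
        by (auto simp: W_def)
      have "continuous_on {-\<epsilon>'..\<epsilon>'} (\<lambda>t. m (x t))"
        using e' e0 by (intro continuous_at_imp_continuous_on ballI DERIV_isCont[OF mx]) auto
      then obtain t where t: "-\<epsilon>' \<le> t" "t \<le> \<epsilon>'" "m (x t) = m z"
        using IVT'[of "\<lambda>t. m (x t)" "-\<epsilon>'" "m z" "\<epsilon>'"] z e' by auto
      have xt: "x t \<in> ball (x 0) r" "lam (x t) = 0" using d2(2)[of t] x(3)[of t] t e' e0 by auto
      have "det2 w (z - x t) = - ((z - x t) \<bullet> a)"
        by (simp add: w_def vector_2 det2_def inner_vec_def sum_2 algebra_simps)
      also have "\<dots> = 0" using t(3) by (simp add: m_def inner_diff_left)
      finally obtain k where k: "z - x t = k *\<^sub>R w"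
        using det2_eq_0_iff[of w] daw det2_simps(7) by (metis)
      have "k = 0"
      proof (rule ccontr)
        assume k0: "k \<noteq> 0"
        have seg: "x t + s *\<^sub>R (k *\<^sub>R w) \<in> ball (x 0) r" if "0 \<le> s" "s \<le> 1" for s
        proof -
          have "x t + s *\<^sub>R (k *\<^sub>R w) = (1 - s) *\<^sub>R x t + s *\<^sub>R z"
            using k by (simp add: algebra_simps)
          then show ?thesis using convexD_alt[OF convex_ball xt(1) z(1) that] by simp
        qed
        have D: "((\<lambda>s. lam (x t + s *\<^sub>R (k *\<^sub>R w))) has_real_derivative
            FD lam (x t + s *\<^sub>R (k *\<^sub>R w)) (k *\<^sub>R w)) (at s)" if "0 \<le> s" "s \<le> 1" for s
        proof -
          have "((\<lambda>s. x t + s *\<^sub>R (k *\<^sub>R w)) has_vector_derivative k *\<^sub>R w) (at s)"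
            by (auto intro!: derivative_eq_intros)
          from has_vector_derivative_compose_smooth[OF this lam(1)] show ?thesis
            using seg[OF that] r(2) by (auto simp: has_real_derivative_iff_has_vector_derivative)
        qed
        from MVT2[OF zero_less_one D] obtain s where s: "0 < s" "s < 1"
          "lam (x t + 1 *\<^sub>R (k *\<^sub>R w)) - lam (x t + 0 *\<^sub>R (k *\<^sub>R w)) = (1 - 0) * FD lam (x t + s *\<^sub>R (k *\<^sub>R w)) (k *\<^sub>R w)"
          by blast
        have "x t + k *\<^sub>R w = z" using k by (simp add: algebra_simps)
        then have "FD lam (x t + s *\<^sub>R (k *\<^sub>R w)) (k *\<^sub>R w) = 0" using s(3) z(4) xt(2) by simp
        moreover have "x t + s *\<^sub>R (k *\<^sub>R w) \<in> ball (x 0) r" using seg s by simp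
        ultimately show False
          using r k0 linear_scale[OF FD_linear[OF lam(1)], of _ k w]
          by (metis mult_eq_0_iff real_scaleR_def subsetD)
      qed
      then have "z = x t" using k by simp
      moreover have "t \<noteq> -\<epsilon>'" "t \<noteq> \<epsilon>'" using t(3) z by auto
      ultimately show "z \<in> x ` {-\<epsilon>'<..<\<epsilon>'}" using t by auto
    qed
    moreover have "open W" unfolding W_def m_def
      by (intro open_Int open_ball open_Collect_less continuous_intros)
    moreover have "x 0 \<in> W" using mono[of "-\<epsilon>'" 0] mono[of 0 "\<epsilon>'"] e' r(1) by (simp add: W_def)
    ultimately show "\<exists>W. open W \<and> x 0 \<in> W \<and> W \<subseteq> V \<and> {z\<in>W. lam z = 0} = x ` {-\<epsilon>'<..<\<epsilon>'}"
      using r(2) unfolding W_def by blast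
  qed (use e0 in auto)
qed

text \<open>\<open>\<theta>\<close> inverts the arc length \<open>L\<close>, an antiderivative of
  the speed \<open>s\<close>. The inverse function rule gives the equation
  \<open>\<theta>' = 1 / s(\<theta>)\<close>, and this autonomous equation yields smoothness by
  \<open>smooth_on_autonomous\<close>.\<close>

lemma arc_length_parameter:
  fixes s :: "real \<Rightarrow> real"
  assumes s: "smooth_on s {-\<epsilon><..<\<epsilon>}" and \<epsilon>: "\<epsilon> > 0" and pos: "\<And>t. t \<in> {-\<epsilon><..<\<epsilon>} \<Longrightarrow> s t > 0"
  obtains \<delta> \<theta> where "\<delta> > 0" "smooth_on \<theta> {-\<delta><..<\<delta>}" "\<theta> 0 = 0"
    "\<And>t. t \<in> {-\<delta><..<\<delta>} \<Longrightarrow> \<theta> t \<in> {-\<epsilon><..<\<epsilon>}"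
    "\<And>t. t \<in> {-\<delta><..<\<delta>} \<Longrightarrow> (\<theta> has_real_derivative 1 / s (\<theta> t)) (at t)"
proof -
  define e where "e = \<epsilon> / 2"
  have e: "0 < e" "e < \<epsilon>" using \<epsilon> by (auto simp: e_def)
  have "continuous_on {-e..e} s"
    by (rule continuous_on_subset[OF smooth_on_imp_continuous_on[OF s]]) (use e in auto)
  then obtain L0 where L0: "\<And>t. t \<in> {-e..e} \<Longrightarrow> (L0 has_vector_derivative s t) (at t within {-e..e})"
    using antiderivative_continuous by blast
  define L where "L t = L0 t - L0 0" for t
  have L: "(L has_real_derivative s t) (at t)" if "t \<in> {-e<..<e}" for t
  proof -
    have "(L0 has_vector_derivative s t) (at t)"
      using L0[of t] that by (metis at_within_Icc_at atLeastAtMost_iff greaterThanLessThan_iff less_eq_real_def)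
    then show ?thesis unfolding L_def
      by (auto simp: has_real_derivative_iff_has_vector_derivative[symmetric] intro!: derivative_eq_intros)
  qed
  \<comment> \<open>A second halving: the closed interval on which \<open>L\<close> is inverted must
    lie inside the open interval where \<open>L\<close> has a two-sided derivative.\<close>
  define e1 where "e1 = e / 2"
  have e1: "0 < e1" "e1 < e" using e by (auto simp: e1_def)
  have mono: "L a < L b" if "a < b" "-e1 \<le> a" "b \<le> e1" for a b
  proof (rule DERIV_pos_imp_increasing[OF that(1)])
    fix y assume "a \<le> y" "y \<le> b"
    then have "y \<in> {-e<..<e}" "y \<in> {-\<epsilon><..<\<epsilon>}" using that e e1 by auto
    then show "\<exists>D. (L has_real_derivative D) (at y) \<and> D > 0" using L pos by blast
  qed
  have L00: "L 0 = 0" by (simp add: L_def)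
  define \<theta> where "\<theta> = inv_into {-e1..e1} L"
  have inj: "inj_on L {-e1..e1}"
  proof (rule inj_onI)
    fix a b assume ab: "a \<in> {-e1..e1}" "b \<in> {-e1..e1}" "L a = L b"
    then show "a = b" using mono[of a b] mono[of b a] by (cases a b rule: linorder_cases) auto
  qed
  have \<theta>L: "\<theta> (L t) = t" if "t \<in> {-e1..e1}" for t
    using inv_into_f_f[OF inj that] by (simp add: \<theta>_def)
  define \<delta> where "\<delta> = min (L e1) (- L (- e1))"
  have \<delta>: "\<delta> > 0" using mono[of 0 e1] mono[of "-e1" 0] e1 L00 by (simp add: \<delta>_def)
  have L\<theta>: "L (\<theta> t) = t \<and> \<theta> t \<in> {-e1<..<e1}" if t: "t \<in> {-\<delta><..<\<delta>}" for t
  proof -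
    have "continuous_on {-e1..e1} L"
      using e1 by (intro continuous_at_imp_continuous_on ballI DERIV_isCont[OF L]) auto
    moreover have b: "L (-e1) < t" "t < L e1" using t by (auto simp: \<delta>_def)
    ultimately obtain r where r: "-e1 \<le> r" "r \<le> e1" "L r = t"
      using IVT'[of L "-e1" t e1] e1 by auto
    then have "\<theta> t = r" using \<theta>L by auto
    moreover have "r \<noteq> -e1" "r \<noteq> e1" using b r by auto
    ultimately show ?thesis using r by auto
  qed
  have D: "(\<theta> has_real_derivative 1 / s (\<theta> t)) (at t)" if t: "t \<in> {-\<delta><..<\<delta>}" for t
  proof -
    have \<theta>t: "\<theta> t \<in> {-e1<..<e1}" "L (\<theta> t) = t" using L\<theta>[OF t] by auto
    have "isCont \<theta> (L (\<theta> t))"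
    proof (rule isCont_inverse_function2[where f = L and a = "-e1" and b = e1])
      show "-e1 < \<theta> t" "\<theta> t < e1" using \<theta>t by auto
      show "\<theta> (L z) = z" "isCont L z" if "-e1 \<le> z" "z \<le> e1" for z
        using that \<theta>L e1 DERIV_isCont[OF L, of z] by auto
    qed
    then have c: "isCont \<theta> t" using \<theta>t by simp
    have in_e: "\<theta> t \<in> {-e<..<e}" "\<theta> t \<in> {-\<epsilon><..<\<epsilon>}" using \<theta>t e e1 by auto
    have "s (\<theta> t) \<noteq> 0" using pos[OF in_e(2)] by simp
    moreover have "L (\<theta> y) = y" if "-\<delta> < y" "y < \<delta>" for y using L\<theta>[of y] that by simp
    ultimately have "(\<theta> has_real_derivative inverse (s (\<theta> t))) (at t)"
      using t by (intro DERIV_inverse_function[OF L[OF in_e(1)] _ _ _ _ c, of "-\<delta>" \<delta>]) auto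
    then show ?thesis by (simp add: inverse_eq_divide)
  qed
  have in\<epsilon>: "\<theta> t \<in> {-\<epsilon><..<\<epsilon>}" if "t \<in> {-\<delta><..<\<delta>}" for t using L\<theta>[OF that] e e1 by auto
  show ?thesis
  proof (rule that[of \<delta> \<theta>])
    show "smooth_on \<theta> {-\<delta><..<\<delta>}"
    proof (rule smooth_on_autonomous[OF _ _ _ in\<epsilon> D])
      show "smooth_on (\<lambda>y. 1 / s y) {-\<epsilon><..<\<epsilon>}"
        by (intro smooth_intros s) (use pos in force)+
    qed auto
    show "\<theta> 0 = 0" using \<theta>L[of 0] e1 L00 by simp
  qed (use \<delta> in\<epsilon> D in auto)
qed

section \<open>Existence of curvature frames\<close>

text \<open>Neither unit speed of the curve nor normalization of the null field is imposed, since
  both are impossible at a point of the second kind. The point \<open>q\<close> may be of either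
  kind.\<close>

locale char_frame = immersion S
  for S :: "('s::topological_space, 'm::topological_space) surface" +
  fixes q c d \<gamma> \<epsilon> U \<eta>
  assumes adapted: "adapted S q c d \<gamma> \<epsilon> U \<eta>"
begin

abbreviation I where "I \<equiv> {-\<epsilon><..<\<epsilon>}"
abbreviation x where "x \<equiv> \<lambda>t. map_of_chart c (\<gamma> t)"
abbreviation g where "g \<equiv> first_form S c d"
abbreviation F where "F \<equiv> loc_map S c d"
abbreviation V where "V \<equiv> loc_dom S c d"

lemma coords: "coords_at S q c d" and char_curve: "char_curve S q \<gamma> \<epsilon>"
  and null_field: "null_field S c d U \<eta>"
  using adapted unfolding adapted_def by blast+

lemma c_atlas: "c \<in> surf_atlas S" and d_atlas: "d \<in> amb_atlas S"
  using coords unfolding coords_at_def by blast+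

lemma \<epsilon>_pos: "\<epsilon> > 0" and \<gamma>_0: "\<gamma> 0 = q" and continuous_\<gamma>: "continuous_on I \<gamma>"
  using char_curve unfolding char_curve_def by blast+

lemma open_I: "open I" and zero_I: "0 \<in> I"
  using \<epsilon>_pos by auto

lemma U: "open U" "U \<subseteq> V" "smooth_on \<eta> U"
  using null_field unfolding null_field_def by blast+

lemma \<gamma>_dom: "t \<in> I \<Longrightarrow> \<gamma> t \<in> dom_of c" and x_U: "t \<in> I \<Longrightarrow> x t \<in> U"
  using adapted unfolding adapted_def by blast+

lemma x_V: "t \<in> I \<Longrightarrow> x t \<in> V"
  using x_U U by blast

lemma inv_x: "t \<in> I \<Longrightarrow> inv_chart c (x t) = \<gamma> t"
  using inv_chart_map[OF surf_atlas c_atlas \<gamma>_dom] .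

lemma smooth_x: "smooth_on x I" and vel_x_nonzero: "t \<in> I \<Longrightarrow> vel x t \<noteq> 0"
proof -
  have e: "I \<inter> \<gamma> -` dom_of c = I" using \<gamma>_dom by auto
  have "smooth_on (map_of_chart c \<circ> \<gamma>) (I \<inter> \<gamma> -` dom_of c)"
    "\<forall>t \<in> I \<inter> \<gamma> -` dom_of c. vel (map_of_chart c \<circ> \<gamma>) t \<noteq> 0"
    using char_curve c_atlas unfolding char_curve_def by blast+
  then show "smooth_on x I" "t \<in> I \<Longrightarrow> vel x t \<noteq> 0" unfolding e by (simp_all add: comp_def)
qed

lemma \<gamma>_LD: "t \<in> I \<Longrightarrow> \<gamma> t \<in> LD S"
  using char_curve unfolding char_curve_def by blast

lemma coords_\<gamma>: "t \<in> I \<Longrightarrow> coords_at S (\<gamma> t) c d"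
  unfolding coords_at_def using c_atlas d_atlas \<gamma>_dom x_V loc_dom_iff[OF c_atlas d_atlas] inv_x by metis

lemma lam_x: "t \<in> I \<Longrightarrow> lam S c d (x t) = 0"
  using LD_iff_lam[OF c_atlas d_atlas x_V] inv_x \<gamma>_LD by simp

lemma \<eta>_nonzero: "t \<in> I \<Longrightarrow> \<eta> (x t) \<noteq> 0" and \<eta>_null: "t \<in> I \<Longrightarrow> g (x t) (\<eta> (x t)) w = 0"
  using null_field x_U inv_x \<gamma>_LD unfolding null_field_def by metis+

sublocale form_field g V
  by (rule first_form_field[OF c_atlas d_atlas])

sublocale sub: pullback_form g V "amb_form S d" "map_of_chart d ` dom_of d" F
  by (rule first_form_pullback[OF c_atlas d_atlas])

lemma FD_lam_vel: "t \<in> I \<Longrightarrow> FD (lam S c d) (x t) (vel x t) = 0"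
  by (rule zero_curve(1)[OF smooth_lam[OF c_atlas d_atlas] open_V open_I _ smooth_x x_V lam_x])

lemma space_curve_eq: "t \<in> I \<Longrightarrow> space_curve S d \<gamma> t = F (x t)"
  by (simp add: space_curve_def loc_map_def inv_x)

lemma e_field_eq: "t \<in> I \<Longrightarrow> e_field S d \<gamma> t = FD F (x t) (vel x t)"
  unfolding e_field_def
  by (rule sub.curve_image(1)[OF open_I _ smooth_x x_V space_curve_eq])

lemma metric_along_eq: "t \<in> I \<Longrightarrow> metric_along S d \<gamma> t = amb_form S d (F (x t))"
  by (simp add: metric_along_def space_curve_eq)

lemma L_field_eq: "L_field S c d \<gamma> \<zeta> t = FD F (x t) (\<zeta> (x t))"
  by (simp add: L_field_def loc_diff_def field_along_def)

end

text \<open>The derivative of \<open>\<eta>\<close> enters only paired with the null vector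
  \<open>\<eta> z\<close> and drops out. Normalization of a null field is therefore a condition on
  its value at each point, cubic in that value.\<close>

lemma (in form_field) FD_square_null:
  assumes "open U" "U \<subseteq> V" "smooth_on \<eta> U" "z \<in> U" "\<And>w. B z (\<eta> z) w = 0"
  shows "FD (\<lambda>z. B z (\<eta> z) (\<eta> z)) z v = dform B z v (\<eta> z) (\<eta> z)"
proof -
  have zV: "z \<in> V" using assms by blast
  have "((\<lambda>z. B z (\<eta> z) (\<eta> z)) has_derivative
    (\<lambda>v. dform B z v (\<eta> z) (\<eta> z) + B z (FD \<eta> z v) (\<eta> z) + B z (\<eta> z) (FD \<eta> z v))) (at z)"
    by (rule has_derivative_along[OF zV has_derivative_ident
        smooth_on_has_derivative[OF assms(3,4)] smooth_on_has_derivative[OF assms(3,4)]])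
  then show ?thesis using assms(5) sym[OF zV] by (simp add: FD_eqI)
qed

context char_frame
begin

abbreviation curvature_in where
  "curvature_in h \<sigma> \<equiv> metric_along S h \<sigma> 0 (cov_deriv (amb_metric S h) (space_curve S h \<sigma>) (e_field S h \<sigma>) 0)"

lemma exists_N:
  assumes t: "z \<in> V" and l: "\<And>w. g z l w = 0" and e: "det2 e l \<noteq> 0" "g z e e = 1"
  shows "\<exists>N. amb_form S d (F z) N (FD F z e) = 0 \<and> amb_form S d (F z) N N = 0 \<and>
    amb_form S d (F z) N (FD F z l) = 1"
proof -
  have lor: "lorentz_form (amb_metric S d (F z))"
    by (rule lorentz_amb[OF d_atlas sub.maps[OF t]])
  obtain u where u: "amb_form S d (F z) u (FD F z l) \<noteq> 0"
    using lorentz_nondegenerate[OF lor first_form_positive(3)[OF c_atlas d_atlas t l e(1)]] .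
  show ?thesis
    using null_completion[OF sub.B2.bilin sub.B2.sym, OF sub.maps[OF t] sub.maps[OF t], of "FD F z l" "FD F z e" u]
      u l e(2) sub.pull[OF t] by force
qed

text \<open>Reparametrize by arc length and rescale the null field by the cube root of \<open>\<eta>\<langle>df(\<eta>), df(\<eta>)\<rangle>\<close>.\<close>

lemma curvature_frame_exists:
  assumes nd: "nondegenerate_point S q" and ind: "det2 (vel x 0) (\<eta> (x 0)) \<noteq> 0"
  shows "\<exists>\<gamma>' \<epsilon>' U' \<eta>' N. curvature_frame S q c d \<gamma>' \<epsilon>' U' \<eta>' \<and> N_field S c d \<gamma>' \<epsilon>' \<eta>' N"
proof -
  define \<mu> where "\<mu> z = FD (\<lambda>z. g z (\<eta> z) (\<eta> z)) z (\<eta> z)" for z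
  have \<mu>_eq: "\<mu> z = dform g z (\<eta> z) (\<eta> z) (\<eta> z)" if "z \<in> U" "\<And>w. g z (\<eta> z) w = 0" for z
    unfolding \<mu>_def by (rule FD_square_null[OF U that])
  have sq: "smooth_on (\<lambda>z. g z (\<eta> z) (\<eta> z)) U"
    by (intro smooth_intros U) (use U in blast)
  have s\<mu>: "smooth_on \<mu> U"
    unfolding \<mu>_def by (intro smooth_on_FD_along[OF sq] smooth_on_id U)
  obtain v where v: "FD (lam S c d) (map_of_chart c q) v \<noteq> 0"
    using nondegenerate_FD_lam[OF nd coords] .
  have x0: "x 0 = map_of_chart c q" using \<gamma>_0 by simp
  note V0 = x_V[OF zero_I]
  have E0: "g (x 0) (vel x 0) (vel x 0) > 0"
    by (rule first_form_positive(1)[OF c_atlas d_atlas V0 \<eta>_null[OF zero_I] ind])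
  \<comment> \<open>The kernel of the differential of \<open>lam\<close> is the line of the
    velocity, and \<open>\<eta>\<close> is transverse to it. \<open>dform_lam\<close> converts this
    into \<open>\<mu> \<noteq> 0\<close>, which is what division by the cube root needs.\<close>
  have "FD (lam S c d) (x 0) (\<eta> (x 0)) \<noteq> 0"
  proof
    assume 0: "FD (lam S c d) (x 0) (\<eta> (x 0)) = 0"
    obtain k where "\<eta> (x 0) = k *\<^sub>R vel x 0"
      using kernel_1dim[OF FD_linear[OF smooth_lam[OF c_atlas d_atlas] V0] v[folded x0] FD_lam_vel[OF zero_I]
        vel_x_nonzero[OF zero_I] 0] .
    then show False using ind by (simp add: det2_simps)
  qed
  then have \<mu>0: "\<mu> (x 0) \<noteq> 0"
    using dform_lam[OF c_atlas d_atlas V0 \<eta>_null[OF zero_I], of "vel x 0" "\<eta> (x 0)"] ind E0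
      \<mu>_eq[OF x_U[OF zero_I] \<eta>_null[OF zero_I]] by auto
  define U2 where "U2 = U \<inter> \<mu> -` (- {0})"
  have U2: "open U2" "U2 \<subseteq> U" "\<And>z. z \<in> U2 \<Longrightarrow> \<mu> z \<noteq> 0"
    unfolding U2_def using continuous_open_preimage[OF smooth_on_imp_continuous_on[OF s\<mu>] U(1), of "- {0}"] by auto
  define \<eta>2 where "\<eta>2 z = (1 / root 3 (\<mu> z)) *\<^sub>R \<eta> z" for z
  have s\<eta>2: "smooth_on \<eta>2 U2"
    unfolding \<eta>2_def using U2
    by (intro smooth_intros smooth_on_cbrt smooth_on_subset[OF s\<mu>] smooth_on_subset[OF U(3)]) auto
  have null2: "\<eta>2 z \<noteq> 0 \<and> (\<forall>w. g z (\<eta>2 z) w = 0)" if "z \<in> U2" "inv_chart c z \<in> LD S" for z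
  proof -
    have "\<eta> z \<noteq> 0 \<and> (\<forall>w. g z (\<eta> z) w = 0)" "z \<in> V"
      using that U2 U null_field unfolding null_field_def by blast+
    then show ?thesis using U2(3)[OF that(1)] by (simp add: \<eta>2_def B_simps)
  qed
  have nf2: "null_field S c d U2 \<eta>2"
    unfolding null_field_def using U2 U s\<eta>2 null2 by blast
  have "normalized_null_field S c d U2 \<eta>2"
    unfolding normalized_null_field_def
  proof (intro conjI ballI impI nf2)
    fix z assume z: "z \<in> U2" "inv_chart c z \<in> LD S"
    have zV: "z \<in> V" and zU: "z \<in> U" using z U2 U by blast+
    have n: "\<And>w. g z (\<eta> z) w = 0" using z zU null_field unfolding null_field_def by blast
    have "FD (\<lambda>z. g z (\<eta>2 z) (\<eta>2 z)) z (\<eta>2 z) = dform g z (\<eta>2 z) (\<eta>2 z) (\<eta>2 z)"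
      using FD_square_null[OF U2(1) _ s\<eta>2 z(1)] U2(2) U(2) null2[OF z] by blast
    also have "\<dots> = (1 / root 3 (\<mu> z)) ^ 3 * \<mu> z"
      by (simp add: \<eta>2_def dform_simps[OF zV] power3_eq_cube \<mu>_eq[OF zU n, symmetric])
    also have "\<dots> = 1"
      using U2(3)[OF z(1)] odd_real_root_pow[of 3 "\<mu> z"] by (simp add: power_divide)
    finally show "FD (\<lambda>z. g z (\<eta>2 z) (\<eta>2 z)) z (\<eta>2 z) = 1" .
  qed
  define s where "s t = sqrt (g (x t) (vel x t) (vel x t))" for t
  have sE: "smooth_on (\<lambda>t. g (x t) (vel x t) (vel x t)) I"
    by (intro smooth_intros open_I smooth_x x_V)
  obtain \<epsilon>1' where e1': "\<epsilon>1' > 0" "\<And>t. \<bar>t\<bar> < \<epsilon>1' \<Longrightarrow> g (x t) (vel x t) (vel x t) \<in> {0<..}"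
    using eventually_small_interval[OF smooth_on_imp_continuous_at[OF sE zero_I], of "{0<..}"] E0 by auto
  define \<epsilon>1 where "\<epsilon>1 = min \<epsilon>1' \<epsilon>"
  let ?I1 = "{-\<epsilon>1<..<\<epsilon>1}"
  have e1: "\<epsilon>1 > 0" "\<epsilon>1 \<le> \<epsilon>" "\<And>t. t \<in> ?I1 \<Longrightarrow> g (x t) (vel x t) (vel x t) > 0"
    using e1' \<epsilon>_pos by (auto simp: \<epsilon>1_def)
  have I1: "?I1 \<subseteq> I" using e1 by auto
  have ss: "smooth_on s ?I1"
    unfolding s_def by (rule smooth_on_sqrt[OF _ smooth_on_subset[OF sE I1] e1(3)]) auto
  obtain \<delta> \<theta> where \<delta>: "\<delta> > 0" "smooth_on \<theta> {-\<delta><..<\<delta>}" "\<theta> 0 = 0"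
    "\<And>t. t \<in> {-\<delta><..<\<delta>} \<Longrightarrow> \<theta> t \<in> ?I1"
    "\<And>t. t \<in> {-\<delta><..<\<delta>} \<Longrightarrow> (\<theta> has_real_derivative 1 / s (\<theta> t)) (at t)"
    using arc_length_parameter[OF ss e1(1)] e1(3) by (auto simp: s_def)
  let ?D = "{-\<delta><..<\<delta>}"
  have \<theta>I: "\<theta> t \<in> I" if "t \<in> ?D" for t using \<delta>(4)[OF that] I1 by blast
  define \<gamma>2 where "\<gamma>2 t = \<gamma> (\<theta> t)" for t
  have s_pos: "s (\<theta> t) > 0" if "t \<in> ?D" for t using e1(3)[OF \<delta>(4)[OF that]] by (simp add: s_def)
  have chain: "((\<lambda>t. h (\<theta> t)) has_vector_derivative (1 / s (\<theta> t)) *\<^sub>R vel h (\<theta> t)) (at t)"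
    if "t \<in> ?D" "smooth_on h J" "\<theta> t \<in> J" for t J and h :: "real \<Rightarrow> real^2"
  proof -
    have h: "(h has_derivative (\<lambda>r. r *\<^sub>R vel h (\<theta> t))) (at (\<theta> t))"
      using smooth_curve_has_vector_derivative[OF that(2,3)] by (simp add: has_vector_derivative_def)
    have "(\<theta> has_derivative (\<lambda>r. 1 / s (\<theta> t) * r)) (at t)"
      using \<delta>(5)[OF that(1)] by (simp only: has_field_derivative_def)
    from has_derivative_compose[where f = \<theta> and g = h, OF this h]
    show ?thesis by (simp add: has_vector_derivative_def mult.commute)
  qed
  have curve2: "continuous_on ?D \<gamma>2"
    unfolding \<gamma>2_def
    by (rule continuous_on_compose2[OF continuous_\<gamma> smooth_on_imp_continuous_on[OF \<delta>(2)]]) (use \<theta>I in auto)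
  have smooth2: "smooth_on (map_of_chart c' \<circ> \<gamma>2) (?D \<inter> \<gamma>2 -` dom_of c')"
    and vel2: "t \<in> ?D \<inter> \<gamma>2 -` dom_of c' \<Longrightarrow>
      vel (map_of_chart c' \<circ> \<gamma>2) t = (1 / s (\<theta> t)) *\<^sub>R vel (map_of_chart c' \<circ> \<gamma>) (\<theta> t)"
    and vel2_nz: "t \<in> ?D \<inter> \<gamma>2 -` dom_of c' \<Longrightarrow> vel (map_of_chart c' \<circ> \<gamma>2) t \<noteq> 0"
    if c': "c' \<in> surf_atlas S" for c' t
  proof -
    let ?J = "I \<inter> \<gamma> -` dom_of c'" and ?K = "?D \<inter> \<gamma>2 -` dom_of c'"
    have J: "open ?J" using continuous_open_preimage[OF continuous_\<gamma> open_I open_chart_dom[OF surf_atlas c']] .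
    have K: "open ?K" using continuous_open_preimage[OF curve2 _ open_chart_dom[OF surf_atlas c']] by auto
    have sm: "smooth_on (map_of_chart c' \<circ> \<gamma>) ?J"
      and nz: "\<And>t. t \<in> ?J \<Longrightarrow> vel (map_of_chart c' \<circ> \<gamma>) t \<noteq> 0"
      using char_curve c' unfolding char_curve_def by blast+
    have KJ: "\<theta> t \<in> ?J" if "t \<in> ?K" for t using \<theta>I that by (auto simp: \<gamma>2_def)
    have eq: "map_of_chart c' \<circ> \<gamma>2 = (\<lambda>t. (map_of_chart c' \<circ> \<gamma>) (\<theta> t))" by (auto simp: \<gamma>2_def)
    show "smooth_on (map_of_chart c' \<circ> \<gamma>2) ?K"
      unfolding eq by (rule smooth_on_compose[OF sm smooth_on_subset[OF \<delta>(2)] K J KJ]) auto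
    show vv: "vel (map_of_chart c' \<circ> \<gamma>2) t = (1 / s (\<theta> t)) *\<^sub>R vel (map_of_chart c' \<circ> \<gamma>) (\<theta> t)" if "t \<in> ?K"
      unfolding eq by (rule vector_derivative_at[OF chain[OF _ sm KJ[OF that]]]) (use that in auto)
    show "vel (map_of_chart c' \<circ> \<gamma>2) t \<noteq> 0" if "t \<in> ?K"
      unfolding vv[OF that] using nz[OF KJ[OF that]] s_pos[of t] that by auto
  qed
  define x2 where "x2 t = map_of_chart c (\<gamma>2 t)" for t
  have K: "?D \<inter> \<gamma>2 -` dom_of c = ?D" using \<theta>I \<gamma>_dom by (auto simp: \<gamma>2_def)
  have sx2: "smooth_on x2 ?D" using smooth2[OF c_atlas] unfolding K by (simp add: comp_def x2_def[abs_def])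
  have vx2: "vel x2 t = (1 / s (\<theta> t)) *\<^sub>R vel x (\<theta> t)" "vel x2 t \<noteq> 0" if "t \<in> ?D" for t
    using vel2[OF c_atlas, of t] vel2_nz[OF c_atlas, of t] that unfolding K by (simp_all add: comp_def x2_def[abs_def])
  have x2x: "x2 t = x (\<theta> t)" for t by (simp add: x2_def \<gamma>2_def)
  have x2V: "x2 t \<in> V" "lam S c d (x2 t) = 0" if "t \<in> ?D" for t
    unfolding x2x using x_V[OF \<theta>I[OF that]] lam_x[OF \<theta>I[OF that]] by auto
  have "x2 0 \<in> U2" unfolding x2x U2_def using x_U[OF zero_I] \<mu>0 \<delta>(3) by simp
  then obtain \<delta>1 where d1: "\<delta>1 > 0" "\<And>t. \<bar>t\<bar> < \<delta>1 \<Longrightarrow> x2 t \<in> U2"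
    using eventually_small_interval[OF smooth_on_imp_continuous_at[OF sx2] U2(1)] \<delta>(1) by auto
  have ne: "FD (lam S c d) (x2 0) v \<noteq> 0" using v by (simp add: x2x \<delta>(3) \<gamma>_0)
  have v0: "vel x2 0 \<noteq> 0" using vx2 \<delta>(1) by simp
  \<comment> \<open>\<open>char_curve\<close> asks that the interval sweep out exactly the lightlike
    points of some neighbourhood. A subinterval does not inherit this, since the curve might return;
    the local graph property restores it for the shrunk interval.\<close>
  obtain \<epsilon>0 where e0: "0 < \<epsilon>0" "\<epsilon>0 \<le> \<delta>"
    "\<And>\<epsilon>'. 0 < \<epsilon>' \<Longrightarrow> \<epsilon>' \<le> \<epsilon>0 \<Longrightarrow>
      \<exists>W. open W \<and> x2 0 \<in> W \<and> W \<subseteq> V \<and> {z\<in>W. lam S c d z = 0} = x2 ` {-\<epsilon>'<..<\<epsilon>'}"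
    by (rule zero_set_local_graph[OF smooth_lam[OF c_atlas d_atlas] open_V ne \<delta>(1) sx2 x2V v0]) blast+
  define \<epsilon>3 where "\<epsilon>3 = min \<epsilon>0 \<delta>1"
  let ?I3 = "{-\<epsilon>3<..<\<epsilon>3}"
  have e3: "0 < \<epsilon>3" "\<epsilon>3 \<le> \<epsilon>0" "\<And>t. t \<in> ?I3 \<Longrightarrow> x2 t \<in> U2"
    using e0 d1 by (auto simp: \<epsilon>3_def)
  have I3: "?I3 \<subseteq> ?D" using e3 e0 by auto
  obtain W where W: "open W" "x2 0 \<in> W" "W \<subseteq> V" "{z\<in>W. lam S c d z = 0} = x2 ` ?I3"
    using e0(3)[OF e3(1,2)] by blast
  have \<gamma>2_dom: "\<gamma>2 t \<in> dom_of c" if "t \<in> ?D" for t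
    unfolding \<gamma>2_def by (rule \<gamma>_dom[OF \<theta>I[OF that]])
  have inv2: "inv_chart c (x2 t) = \<gamma>2 t" if "t \<in> ?D" for t
    unfolding x2_def using inv_chart_map[OF surf_atlas c_atlas \<gamma>2_dom[OF that]] .
  have "char_curve S q \<gamma>2 \<epsilon>3"
    unfolding char_curve_def
  proof (intro conjI ballI)
    show "\<epsilon>3 > 0" by (rule e3)
    show "\<gamma>2 0 = q" by (simp add: \<gamma>2_def \<delta>(3) \<gamma>_0)
    show "continuous_on ?I3 \<gamma>2" by (rule continuous_on_subset[OF curve2 I3])
    show "smooth_on (map_of_chart c' \<circ> \<gamma>2) (?I3 \<inter> \<gamma>2 -` dom_of c')" if "c' \<in> surf_atlas S" for c'
      by (rule smooth_on_subset[OF smooth2[OF that]]) (use I3 in blast)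
    show "vel (map_of_chart c' \<circ> \<gamma>2) t \<noteq> 0" if "c' \<in> surf_atlas S" "t \<in> ?I3 \<inter> \<gamma>2 -` dom_of c'" for c' t
      using vel2_nz[OF that(1)] that(2) I3 by blast
    show "\<exists>W. open W \<and> q \<in> W \<and> LD S \<inter> W = \<gamma>2 ` ?I3"
    proof (intro exI conjI)
      let ?W = "dom_of c \<inter> map_of_chart c -` W"
      show "open ?W" by (rule open_chart_preimage[OF surf_atlas c_atlas W(1)])
      show "q \<in> ?W" using W(2) coords by (simp add: x2x \<delta>(3) \<gamma>_0 coords_at_def)
      show "LD S \<inter> ?W = \<gamma>2 ` ?I3"
      proof (intro subset_antisym subsetI)
        fix r assume r: "r \<in> LD S \<inter> ?W"
        have rr: "inv_chart c (map_of_chart c r) = r" using inv_chart_map[OF surf_atlas c_atlas] r by blast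
        have "map_of_chart c r \<in> {z\<in>W. lam S c d z = 0}"
          using r LD_iff_lam[OF c_atlas d_atlas, of "map_of_chart c r"] W(3) rr by auto
        then obtain t where t: "t \<in> ?I3" "map_of_chart c r = x2 t" using W(4) by blast
        have "r = \<gamma>2 t" using rr inv2[of t] t I3 by auto
        then show "r \<in> \<gamma>2 ` ?I3" using t by blast
      next
        fix r assume "r \<in> \<gamma>2 ` ?I3"
        then obtain t where t: "t \<in> ?I3" "r = \<gamma>2 t" by blast
        then have "t \<in> ?D" "x2 t \<in> W" using I3 W(4) by blast+
        then show "r \<in> LD S \<inter> ?W" using t \<gamma>_LD[OF \<theta>I] \<gamma>2_dom by (simp add: \<gamma>2_def x2_def)
      qed
    qed
  qed
  then have ad2: "adapted S q c d \<gamma>2 \<epsilon>3 U2 \<eta>2"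
    unfolding adapted_def using coords nf2 \<gamma>2_dom I3 e3(3) by (auto simp: x2_def)
  interpret C2: char_frame S q c d \<gamma>2 \<epsilon>3 U2 \<eta>2 by unfold_locales (rule ad2)
  have unit: "g (x2 t) (vel x2 t) (vel x2 t) = 1" if "t \<in> ?I3" for t
  proof -
    have t: "t \<in> ?D" using that I3 by blast
    have "g (x2 t) (vel x2 t) (vel x2 t) = (1 / s (\<theta> t))\<^sup>2 * g (x (\<theta> t)) (vel x (\<theta> t)) (vel x (\<theta> t))"
      unfolding vx2(1)[OF t] x2x using x2V[OF t] by (simp add: x2x B_simps power2_eq_square)
    also have "g (x (\<theta> t)) (vel x (\<theta> t)) (vel x (\<theta> t)) = (s (\<theta> t))\<^sup>2"
      using e1(3)[OF \<delta>(4)[OF t]] by (simp add: s_def)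
    finally show ?thesis using s_pos[OF t] by (simp add: power_divide)
  qed
  have "curvature_frame S q c d \<gamma>2 \<epsilon>3 U2 \<eta>2"
    unfolding curvature_frame_def
  proof (intro conjI ballI ad2 \<open>normalized_null_field S c d U2 \<eta>2\<close>)
    fix t assume t: "t \<in> ?I3"
    show "metric_along S d \<gamma>2 t (e_field S d \<gamma>2 t) (e_field S d \<gamma>2 t) = 1"
      unfolding C2.metric_along_eq[OF t] C2.e_field_eq[OF t] sub.pull[OF C2.x_V[OF t], symmetric]
      using unit[OF t] by (simp only: x2_def[abs_def])
  qed
  moreover have "\<exists>N. metric_along S d \<gamma>2 t N (e_field S d \<gamma>2 t) = 0 \<and> metric_along S d \<gamma>2 t N N = 0 \<and>
      metric_along S d \<gamma>2 t N (L_field S c d \<gamma>2 \<eta>2 t) = 1" if t: "t \<in> ?I3" for t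
  proof -
    have t': "t \<in> ?D" using t I3 by blast
    have n: "\<And>w. g (x2 t) (\<eta>2 (x2 t)) w = 0" "\<eta>2 (x2 t) \<noteq> 0"
      using C2.\<eta>_null[OF t] C2.\<eta>_nonzero[OF t] by (simp_all add: x2_def)
    have "det2 (vel x2 t) (\<eta>2 (x2 t)) \<noteq> 0"
    proof
      assume "det2 (vel x2 t) (\<eta>2 (x2 t)) = 0"
      then obtain k where "vel x2 t = k *\<^sub>R \<eta>2 (x2 t)"
        using det2_eq_0_iff[OF n(2)] det2_swap[of "\<eta>2 (x2 t)"] by auto
      then show False using unit[OF t] n(1) x2V[OF t'] by (simp add: B_simps)
    qed
    from exists_N[OF x2V(1)[OF t'] n(1) this unit[OF t]] show ?thesis
      unfolding C2.metric_along_eq[OF t] C2.e_field_eq[OF t] C2.L_field_eq by (simp add: x2_def[abs_def])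
  qed
  then have "\<forall>t\<in>?I3. \<exists>N. metric_along S d \<gamma>2 t N (e_field S d \<gamma>2 t) = 0 \<and> metric_along S d \<gamma>2 t N N = 0 \<and>
      metric_along S d \<gamma>2 t N (L_field S c d \<gamma>2 \<eta>2 t) = 1" by blast
  \<comment> \<open>\<open>N_field\<close> consists of conditions at each parameter separately, so a
    choice over \<open>t\<close> suffices.\<close>
  then obtain N where "N_field S c d \<gamma>2 \<epsilon>3 \<eta>2 N"
    unfolding N_field_def by (auto dest: bchoice)
  ultimately show ?thesis by blast
qed

end

text \<open>The existence behind the definite descriptions \<open>kappa_L\<close> and
  \<open>kappa_N\<close>; uniqueness of their values comes from comparison with one fixed
  frame.\<close>

lemma (in immersion) first_kind_curvature_frame:
  assumes "first_kind S q"
  shows "\<exists>c d \<gamma> \<epsilon> U \<eta> N. curvature_frame S q c d \<gamma> \<epsilon> U \<eta> \<and> N_field S c d \<gamma> \<epsilon> \<eta> N"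
proof -
  obtain c d \<gamma> \<epsilon> U \<eta> where a: "adapted S q c d \<gamma> \<epsilon> U \<eta>"
    "lin_indep_pair (velocity c \<gamma> 0) (field_along c \<gamma> \<eta> 0)" and nd: "nondegenerate_point S q"
    using assms unfolding first_kind_def by blast
  interpret char_frame S q c d \<gamma> \<epsilon> U \<eta> by unfold_locales (rule a)
  have "det2 (vel x 0) (\<eta> (x 0)) \<noteq> 0"
    using a(2) unfolding lin_indep_pair_iff velocity_def field_along_def comp_def .
  then show ?thesis using curvature_frame_exists[OF nd] by blast
qed

section \<open>Independence of the frame\<close>

text \<open>The unprimed frame is the fixed one. The primed data are an arbitrary frame at the point
  \<open>\<gamma> t0\<close>, with its own charts and its own curve; they are to be expressed by the
  unprimed data at the parameter \<open>t0\<close>.\<close>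

locale frame_pair = char_frame S q c d \<gamma> \<epsilon> U \<eta> + O: char_frame S "\<gamma> t0" c' d' \<gamma>' \<epsilon>' U' \<eta>'
  for S :: "('s::topological_space, 'm::topological_space) surface"
    and q c d \<gamma> \<epsilon> U \<eta> t0 c' d' \<gamma>' \<epsilon>' U' \<eta>' +
  assumes t0: "t0 \<in> {-\<epsilon><..<\<epsilon>}" and nondegenerate: "nondegenerate_point S (\<gamma> t0)"
begin

abbreviation \<phi> where "\<phi> \<equiv> surf_trans c' c"
abbreviation \<psi> where "\<psi> \<equiv> amb_trans d' d"
abbreviation z' where "z' \<equiv> map_of_chart c' (\<gamma> t0)"

definition J where "J = O.I \<inter> O.x -` overlap c' d' c d"
definition x' where "x' s = \<phi> (O.x s)"

lemmas atlases = O.c_atlas c_atlas O.d_atlas d_atlas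

lemma O_x_0: "O.x 0 = z'"
  by (simp add: O.\<gamma>_0)

lemma z'_overlap: "z' \<in> overlap c' d' c d" and \<phi>_z': "\<phi> z' = x t0"
  using coords_at_overlap[OF O.coords coords_\<gamma>[OF t0]] .

lemma open_J: "open J" and zero_J: "0 \<in> J" and J_I: "J \<subseteq> O.I"
proof -
  show "open J" unfolding J_def
    by (rule continuous_open_preimage[OF smooth_on_imp_continuous_on[OF O.smooth_x] O.open_I open_overlap[OF atlases]])
qed (use O.zero_I z'_overlap O_x_0 in \<open>auto simp: J_def\<close>)

lemma O_x_overlap: "s \<in> J \<Longrightarrow> O.x s \<in> overlap c' d' c d"
  by (simp add: J_def)

lemma smooth_O_x: "smooth_on O.x J"
  by (rule smooth_on_subset[OF O.smooth_x J_I])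

sublocale tr: pullback_form "first_form S c' d'" "overlap c' d' c d" g V \<phi>
  by (rule first_form_trans[OF atlases])

sublocale atr: pullback_form "amb_form S d'" "map_of_chart d' ` (dom_of d' \<inter> dom_of d)"
  "amb_form S d" "map_of_chart d ` dom_of d" \<psi>
  by (rule amb_trans_pullback[OF O.d_atlas d_atlas])

lemma smooth_x': "smooth_on x' J"
  unfolding x'_def[abs_def]
  by (rule smooth_on_compose[OF tr.smooth_\<phi> smooth_O_x open_J tr.B1.open_V O_x_overlap])

lemma x'_V: "s \<in> J \<Longrightarrow> x' s \<in> V"
  unfolding x'_def by (rule tr.maps[OF O_x_overlap])

lemma x'_0: "x' 0 = x t0"
  unfolding x'_def O_x_0 \<phi>_z' ..

lemma lam_x': "s \<in> J \<Longrightarrow> lam S c d (x' s) = 0"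
proof -
  assume s: "s \<in> J"
  then have sI: "s \<in> O.I" using J_I by blast
  have "\<gamma>' s \<in> dom_of c"
    using O_x_overlap[OF s] O.inv_x[OF sI] inv_chart_map[OF surf_atlas O.c_atlas] unfolding overlap_def by force
  then have "inv_chart c (x' s) = \<gamma>' s"
    unfolding x'_def O.inv_x[OF sI] by (rule inv_chart_map[OF surf_atlas c_atlas])
  then show ?thesis using LD_iff_lam[OF c_atlas d_atlas x'_V[OF s]] O.\<gamma>_LD[OF sI] by simp
qed

lemma vel_x'_0: "vel x' 0 = FD \<phi> z' (vel O.x 0)"
  using tr.curve_image(1)[OF open_J zero_J smooth_O_x O_x_overlap x'_def] unfolding O_x_0 .

lemma second_order:
  obtains k l where "vel x' 0 = k *\<^sub>R vel x t0" "vel (vel x') 0 = k\<^sup>2 *\<^sub>R vel (vel x) t0 + l *\<^sub>R vel x t0"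
proof -
  obtain v where v: "FD (lam S c d) (x t0) v \<noteq> 0"
    using nondegenerate_FD_lam[OF nondegenerate coords_\<gamma>[OF t0]] .
  show ?thesis
    by (rule zero_curves_second_order[OF smooth_lam[OF c_atlas d_atlas] open_V v open_I t0 smooth_x x_V
          lam_x vel_x_nonzero[OF t0] open_J zero_J smooth_x' x'_V lam_x' x'_0]) (assumption | rule that)+
qed

lemma \<phi>_null:
  assumes "\<And>w. first_form S c' d' z' v w = 0"
  shows "g (x t0) (FD \<phi> z' v) w = 0"
  using null_trans[OF atlases z'_overlap assms] unfolding \<phi>_z' .

text \<open>If the fixed velocity were null, the other velocity, corresponding to a multiple of it,
  would be null too. Being of the first kind, witnessed by some frame, thus shows in the fixed
  frame.\<close>

lemma independent_transfer:
  assumes "det2 (vel O.x 0) (\<eta>' (O.x 0)) \<noteq> 0"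
  shows "det2 (vel x t0) (\<eta> (x t0)) \<noteq> 0"
proof
  assume "det2 (vel x t0) (\<eta> (x t0)) = 0"
  then obtain a where a: "vel x t0 = a *\<^sub>R \<eta> (x t0)"
    using det2_eq_0_iff[OF \<eta>_nonzero[OF t0]] det2_swap[of "vel x t0"] by auto
  obtain k l where k: "vel x' 0 = k *\<^sub>R vel x t0"
    "vel (vel x') 0 = k\<^sup>2 *\<^sub>R vel (vel x) t0 + l *\<^sub>R vel x t0" by (rule second_order)
  have "first_form S c' d' z' (vel O.x 0) w = 0" for w
    unfolding tr.pull[OF z'_overlap] vel_x'_0[symmetric] k(1) a \<phi>_z'
    using \<eta>_null[OF t0] x_V[OF t0] by (simp add: B_simps)
  then have "det2 (vel O.x 0) (\<eta>' z') = 0"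
    using null_directions_dependent[OF O.c_atlas O.d_atlas O.x_V[OF O.zero_I] O.\<eta>_null[OF O.zero_I]]
    by (simp add: O_x_0)
  then show False using assms by (simp add: O_x_0)
qed

definition y' where "y' s = space_curve S d' \<gamma>' s"

lemma y'_eq: "s \<in> J \<Longrightarrow> y' s = loc_map S c' d' (O.x s)"
  unfolding y'_def using O.space_curve_eq J_I by blast

lemma smooth_y': "smooth_on y' J"
proof (rule smooth_on_cong[OF _ open_J])
  show "smooth_on (\<lambda>s. loc_map S c' d' (O.x s)) J"
    by (rule smooth_on_compose[OF smooth_loc_map[OF O.c_atlas O.d_atlas] smooth_O_x open_J O.open_V])
       (use O.x_V J_I in blast)
qed (simp add: y'_eq)

lemma y'_in: "s \<in> J \<Longrightarrow> y' s \<in> map_of_chart d' ` (dom_of d' \<inter> dom_of d)"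
  using loc_map_trans(2)[OF atlases O_x_overlap] y'_eq by simp

lemma F_x': "s \<in> J \<Longrightarrow> F (x' s) = \<psi> (y' s)"
  unfolding x'_def using loc_map_trans(1)[OF atlases O_x_overlap] y'_eq by simp

lemma FD_\<psi>: "FD \<psi> (y' 0) (FD (loc_map S c' d') z' v) = FD F (x t0) (FD \<phi> z' v)"
  using FD_loc_map_trans[OF atlases z'_overlap] unfolding \<phi>_z' y'_eq[OF zero_J] O_x_0 by simp

text \<open>By \<open>second_order\<close> the other curve has \<open>k\<^sup>2\<close> times the
  fixed acceleration plus a tangential term. The latter dies against a vector orthogonal to the
  velocity, and unit speed makes \<open>k\<^sup>2\<close> the reciprocal of the squared speed. Only
  \<open>k\<^sup>2\<close> occurs, so orientation is irrelevant.\<close>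

lemma cov_deriv_value:
  assumes unit: "metric_along S d' \<gamma>' 0 (e_field S d' \<gamma>' 0) (e_field S d' \<gamma>' 0) = 1"
    and orth: "amb_form S d (F (x t0)) (FD F (x t0) (vel x t0)) (FD \<psi> (y' 0) W) = 0"
  shows "curvature_in d' \<gamma>' W =
    acc (amb_form S d) (\<lambda>t. F (x t)) (FD \<psi> (y' 0) W) t0 / g (x t0) (vel x t0) (vel x t0)"
proof -
  let ?W = "FD \<psi> (y' 0) W"
  obtain k l where k: "vel x' 0 = k *\<^sub>R vel x t0"
    and l: "vel (vel x') 0 = k\<^sup>2 *\<^sub>R vel (vel x) t0 + l *\<^sub>R vel x t0" by (rule second_order)
  note xV = x_V[OF t0] and FV = sub.maps[OF x_V[OF t0]]
  have "1 = first_form S c' d' z' (vel O.x 0) (vel O.x 0)"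
    using unit unfolding O.metric_along_eq[OF O.zero_I] O.e_field_eq[OF O.zero_I] O_x_0
    by (simp add: first_form_def loc_diff_def)
  also have "\<dots> = k\<^sup>2 * g (x t0) (vel x t0) (vel x t0)"
    unfolding tr.pull[OF z'_overlap] vel_x'_0[symmetric] k \<phi>_z' using xV
    by (simp add: B_simps power2_eq_square)
  finally have kg: "k\<^sup>2 * g (x t0) (vel x t0) (vel x t0) = 1" by simp
  then have "g (x t0) (vel x t0) (vel x t0) \<noteq> 0" by auto
  with kg have k2: "k\<^sup>2 = 1 / g (x t0) (vel x t0) (vel x t0)" by (simp add: nonzero_eq_divide_eq)
  have e: "e_field S d' \<gamma>' = vel y'" unfolding e_field_def[abs_def] y'_def[abs_def] by simp
  have y': "space_curve S d' \<gamma>' = y'" by (simp add: y'_def[abs_def])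
  have y'0: "y' 0 \<in> map_of_chart d' ` dom_of d'" using y'_in[OF zero_J] by blast
  have "curvature_in d' \<gamma>' W =
      acc (amb_form S d') y' W 0"
    unfolding metric_along_def e y'
    by (rule form_of_cov_deriv[where \<sigma> = y' and t = 0,
        OF amb_form_field[OF O.d_atlas] y'0 lorentz_amb[OF O.d_atlas y'0]])
  also have "\<dots> = acc (amb_form S d) (\<lambda>s. F (x' s)) ?W 0"
    by (rule atr.acc_pullback[OF open_J zero_J smooth_y' y'_in F_x', symmetric])
  also have "\<dots> = k\<^sup>2 * acc (amb_form S d) (\<lambda>t. F (x t)) ?W t0"
  proof -
    note c' = sub.curve_image[OF open_J zero_J smooth_x' x'_V, where y = "\<lambda>s. F (x' s)", OF _ refl, simplified]
    note cx = sub.curve_image[OF open_I t0 smooth_x x_V, where y = "\<lambda>t. F (x t)", OF _ refl, simplified]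
    note lin = FD_linear[OF sub.smooth_\<phi> xV]
    have v: "vel (\<lambda>s. F (x' s)) 0 = k *\<^sub>R vel (\<lambda>t. F (x t)) t0"
      unfolding c'(1) cx(1) x'_0 k by (simp add: linear_scale[OF lin])
    have a: "vel (vel (\<lambda>s. F (x' s))) 0 = k\<^sup>2 *\<^sub>R vel (vel (\<lambda>t. F (x t))) t0 + l *\<^sub>R FD F (x t0) (vel x t0)"
      unfolding c'(2) cx(2) x'_0 k l FD_FD_scale[OF sub.smooth_\<phi> open_V xV]
      by (simp add: linear_scale[OF lin] linear_add[OF lin] scaleR_add_right)
    show ?thesis
      unfolding acc_def v a x'_0
      by (simp add: sub.B2.B_simps[OF FV] sub.B2.dform_simps[OF FV] orth power2_eq_square algebra_simps)
  qed
  finally show ?thesis unfolding k2 by simp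
qed

text \<open>The coordinate change adds second-derivative terms to \<open>dform\<close>
  (\<open>dform_pullback\<close>), but each of them is paired with a null vector. The cubic
  normalization is thus tensorial on null vectors.\<close>

lemma normalized_transfer:
  assumes "normalized_null_field S c' d' U' \<eta>'"
  shows "dform g (x t0) (FD \<phi> z' (\<eta>' z')) (FD \<phi> z' (\<eta>' z')) (FD \<phi> z' (\<eta>' z')) = 1"
proof -
  have z'U: "z' \<in> U'" using O.x_U[OF O.zero_I] unfolding O_x_0 .
  have n: "\<And>w. first_form S c' d' z' (\<eta>' z') w = 0" using O.\<eta>_null[OF O.zero_I] unfolding O_x_0 .
  have n1: "g (x t0) (FD \<phi> z' (\<eta>' z')) w = 0" for w by (rule \<phi>_null[OF n])
  then have n2: "g (x t0) w (FD \<phi> z' (\<eta>' z')) = 0" for w using sym[OF x_V[OF t0]] by metis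
  have "inv_chart c' z' \<in> LD S" using O.inv_x[OF O.zero_I] O.\<gamma>_LD[OF O.zero_I] unfolding O_x_0 by simp
  then have "FD (\<lambda>z. first_form S c' d' z (\<eta>' z) (\<eta>' z)) z' (\<eta>' z') = 1"
    using assms z'U unfolding normalized_null_field_def by blast
  then have "1 = dform (first_form S c' d') z' (\<eta>' z') (\<eta>' z') (\<eta>' z')"
    unfolding O.FD_square_null[OF O.U z'U n] by simp
  also have "\<dots> = dform g (x t0) (FD \<phi> z' (\<eta>' z')) (FD \<phi> z' (\<eta>' z')) (FD \<phi> z' (\<eta>' z'))"
    unfolding tr.dform_pullback[OF z'_overlap] \<phi>_z'
    using n1 n2 by simp
  finally show ?thesis by simp
qed

end

section \<open>Curvatures at first-kind points in terms of the fixed curve\<close>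

context char_frame
begin

lemma frame_pairI:
  assumes "t \<in> I" "first_kind S (\<gamma> t)" "adapted S (\<gamma> t) c' d' \<gamma>' \<epsilon>' U' \<eta>'"
  shows "frame_pair S q c d \<gamma> \<epsilon> U \<eta> t c' d' \<gamma>' \<epsilon>' U' \<eta>'"
  using assms by unfold_locales (auto simp: first_kind_def)

lemma first_kind_independent:
  assumes t: "t \<in> I" "first_kind S (\<gamma> t)"
  shows "det2 (vel x t) (\<eta> (x t)) \<noteq> 0"
proof -
  obtain c' d' \<gamma>' \<epsilon>' U' \<eta>' where a: "adapted S (\<gamma> t) c' d' \<gamma>' \<epsilon>' U' \<eta>'"
    "lin_indep_pair (velocity c' \<gamma>' 0) (field_along c' \<gamma>' \<eta>' 0)"
    using t(2) unfolding first_kind_def by blast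
  interpret frame_pair S q c d \<gamma> \<epsilon> U \<eta> t c' d' \<gamma>' \<epsilon>' U' \<eta>' by (rule frame_pairI[OF t a(1)])
  show ?thesis
    by (rule independent_transfer)
       (use a(2) in \<open>unfold lin_indep_pair_iff velocity_def field_along_def comp_def\<close>)
qed

text \<open>For an arbitrary frame at \<open>\<gamma> t\<close> the normalized null vector is
  \<open>E\<close> divided by \<open>root 3 \<mu>\<close>, its normal is given by
  \<open>null_vector_unique\<close>, and \<open>cov_deriv_value\<close> turns both pairings into
  \<open>acc\<close> of the fixed curve. Starting from an arbitrary frame also settles uniqueness
  for the definite descriptions.\<close>

lemma kappa_formula:
  fixes t b E \<xi> n
  defines "\<mu> \<equiv> dform g (x t) E E E" and "P \<equiv> acc g x E t" and "\<beta> \<equiv> g (x t) (vel x t) (vel x t)"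
    and "K \<equiv> acc (amb_form S d) (\<lambda>t. F (x t)) n t"
  assumes t: "t \<in> I" "first_kind S (\<gamma> t)"
    and E: "vel x t = E + b *\<^sub>R \<xi>" "\<And>w. g (x t) E w = 0" "det2 \<xi> E \<noteq> 0"
    and n: "amb_form S d (F (x t)) n (FD F (x t) E) = 1" "amb_form S d (F (x t)) n n = 0"
      "amb_form S d (F (x t)) n (FD F (x t) \<xi>) = 0"
  shows "b \<noteq> 0" "\<mu> \<noteq> 0" "kappa_L S (\<gamma> t) = P / (\<beta> * root 3 \<mu>)"
    "kappa_N S (\<gamma> t) = root 3 \<mu> * (P - 2 * acc g x (vel x t) t + 2 * \<beta> * K) / (2 * \<beta>\<^sup>2)"
proof -
  note xV = x_V[OF t(1)]
  note FV = sub.maps[OF xV]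
  note lin = FD_linear[OF sub.smooth_\<phi> xV]
  let ?l = "FD F (x t) E" and ?xi = "FD F (x t) \<xi>" and ?A = "amb_form S d (F (x t))"
  let ?acc = "\<lambda>W. acc (amb_form S d) (\<lambda>t. F (x t)) W t"
  define w where "w = g (x t) \<xi> \<xi>"
  have E0: "E \<noteq> 0" using E(3) by (auto simp: det2_simps)
  have fp: "w > 0" "\<And>k. ?xi \<noteq> k *\<^sub>R ?l" "?l \<noteq> 0"
    unfolding w_def using first_form_positive[OF c_atlas d_atlas xV E(2,3)] by auto
  show b: "b \<noteq> 0"
  proof
    assume "b = 0"
    then have "vel x t = E" using E(1) by simp
    then have "det2 (vel x t) (\<eta> (x t)) = 0"
      using null_directions_dependent[OF c_atlas d_atlas xV \<eta>_null[OF t(1)]] E(2) by simp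
    then show False using first_kind_independent[OF t] by simp
  qed
  have acc_l: "?acc (FD F (x t) W) = acc g x W t" for W
    by (rule sub.acc_pullback[OF open_I t(1) smooth_x x_V refl])
  have A: "?A (FD F (x t) v) (FD F (x t) u) = g (x t) v u" for v u using sub.pull[OF xV] by simp
  have gE: "g (x t) \<xi> E = 0" using E(2) sym[OF xV] by metis
  have \<beta>: "\<beta> = b\<^sup>2 * w"
    unfolding \<beta>_def E(1) w_def using E(2) gE by (simp add: B_simps[OF xV] power2_eq_square)
  have accv: "acc g x (vel x t) t = P + b * ?acc ?xi"
    unfolding E(1) acc_l P_def by (simp add: acc_simps[of x t, OF xV])
  \<comment> \<open>A normalized null vector is some \<open>h *\<^sub>R E\<close>; the cubic
    condition becomes \<open>h ^ 3 * \<mu> = 1\<close>, the origin both of the cube root and of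
    \<open>\<mu> \<noteq> 0\<close>.\<close>
  have scale: "\<exists>h. h \<noteq> 0 \<and> \<zeta> = h *\<^sub>R E \<and> \<mu> \<noteq> 0 \<and> root 3 \<mu> = 1 / h"
    if z: "\<And>w. g (x t) \<zeta> w = 0" "dform g (x t) \<zeta> \<zeta> \<zeta> = 1" for \<zeta>
  proof -
    have "det2 E \<zeta> = 0" by (rule null_directions_dependent[OF c_atlas d_atlas xV z(1) E(2)])
    then obtain h where h: "\<zeta> = h *\<^sub>R E" using det2_eq_0_iff[OF E0] by blast
    have h1: "h ^ 3 * \<mu> = 1" using z(2) unfolding h \<mu>_def by (simp add: dform_simps[OF xV] power3_eq_cube)
    then have "h \<noteq> 0" "\<mu> \<noteq> 0" by auto
    moreover have "\<mu> = (1 / h) ^ 3" using h1 \<open>h \<noteq> 0\<close> by (simp add: field_simps)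
    then have "root 3 \<mu> = 1 / h" using odd_real_root_power_cancel[of 3 "1 / h"] by simp
    ultimately show ?thesis using h by blast
  qed
  have value_L: "\<mu> \<noteq> 0 \<and> curvature_in d' \<gamma>' (L_field S c' d' \<gamma>' \<eta>' 0) = P / (\<beta> * root 3 \<mu>)"
    and value_N: "N_field S c' d' \<gamma>' \<epsilon>' \<eta>' N \<Longrightarrow> curvature_in d' \<gamma>' (N 0)
      = root 3 \<mu> * (P - 2 * acc g x (vel x t) t + 2 * \<beta> * K) / (2 * \<beta>\<^sup>2)"
    if fr: "curvature_frame S (\<gamma> t) c' d' \<gamma>' \<epsilon>' U' \<eta>'" for c' d' \<gamma>' \<epsilon>' U' \<eta>' N
  proof -
    have ad: "adapted S (\<gamma> t) c' d' \<gamma>' \<epsilon>' U' \<eta>'" and no: "normalized_null_field S c' d' U' \<eta>'"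
      using fr unfolding curvature_frame_def by blast+
    interpret frame_pair S q c d \<gamma> \<epsilon> U \<eta> t c' d' \<gamma>' \<epsilon>' U' \<eta>' by (rule frame_pairI[OF t ad])
    have unit: "metric_along S d' \<gamma>' 0 (e_field S d' \<gamma>' 0) (e_field S d' \<gamma>' 0) = 1"
      using fr O.zero_I unfolding curvature_frame_def by blast
    have n': "\<And>w. g (x t) (FD \<phi> z' (\<eta>' z')) w = 0"
      using \<phi>_null O.\<eta>_null[OF O.zero_I] unfolding O_x_0 by blast
    obtain h where h: "h \<noteq> 0" "FD \<phi> z' (\<eta>' z') = h *\<^sub>R E" "\<mu> \<noteq> 0" "root 3 \<mu> = 1 / h"
      using scale[OF n' normalized_transfer[OF no]] by blast
    have L: "FD \<psi> (y' 0) (L_field S c' d' \<gamma>' \<eta>' 0) = h *\<^sub>R ?l"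
      unfolding O.L_field_eq O_x_0 FD_\<psi> h by (rule linear_scale[OF lin])
    have "curvature_in d' \<gamma>' (L_field S c' d' \<gamma>' \<eta>' 0)
      = ?acc (h *\<^sub>R ?l) / \<beta>"
      using cov_deriv_value[OF unit, of "L_field S c' d' \<gamma>' \<eta>' 0"] E(2) sym[OF xV] A
      unfolding L \<beta>_def by (simp add: sub.B2.B_simps[OF FV])
    also have "?acc (h *\<^sub>R ?l) = h * P" unfolding P_def acc_l[symmetric]
      by (rule sub.B2.acc_simps(2)[of "\<lambda>t. F (x t)", OF FV])
    finally show "\<mu> \<noteq> 0 \<and> curvature_in d' \<gamma>' (L_field S c' d' \<gamma>' \<eta>' 0) = P / (\<beta> * root 3 \<mu>)"
      using h by simp
    assume N_field: "N_field S c' d' \<gamma>' \<epsilon>' \<eta>' N"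
    define M where "M = FD \<psi> (y' 0) (N 0)"
    have ya: "y' 0 \<in> map_of_chart d' ` (dom_of d' \<inter> dom_of d)" by (rule y'_in[OF zero_J])
    have \<psi>y: "\<psi> (y' 0) = F (x t)" using F_x'[OF zero_J] x'_0 by simp
    have ma: "metric_along S d' \<gamma>' 0 u v = ?A (FD \<psi> (y' 0) u) (FD \<psi> (y' 0) v)" for u v
      using atr.pull[OF ya, of u v] unfolding metric_along_def \<psi>y by (simp add: y'_def)
    obtain k l where k: "vel x' 0 = k *\<^sub>R vel x t"
      "vel (vel x') 0 = k\<^sup>2 *\<^sub>R vel (vel x) t + l *\<^sub>R vel x t" by (rule second_order)
    have e: "FD \<psi> (y' 0) (e_field S d' \<gamma>' 0) = k *\<^sub>R FD F (x t) (vel x t)"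
      unfolding O.e_field_eq[OF O.zero_I] O_x_0 FD_\<psi> vel_x'_0[symmetric] k by (rule linear_scale[OF lin])
    have k0: "k \<noteq> 0" using unit unfolding ma e by (auto simp: sub.B2.B_simps[OF FV])
    have N: "metric_along S d' \<gamma>' 0 (N 0) (e_field S d' \<gamma>' 0) = 0" "metric_along S d' \<gamma>' 0 (N 0) (N 0) = 0"
      "metric_along S d' \<gamma>' 0 (N 0) (L_field S c' d' \<gamma>' \<eta>' 0) = 1"
      using N_field O.zero_I unfolding N_field_def by blast+
    have FX: "FD F (x t) (vel x t) = ?l + b *\<^sub>R ?xi"
      unfolding E(1) by (simp add: linear_add[OF lin] linear_scale[OF lin])
    have M: "?A M (?l + b *\<^sub>R ?xi) = 0" "?A M M = 0" "?A M (h *\<^sub>R ?l) = 1"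
      using N k0 unfolding ma e L M_def[symmetric] FX by (simp_all add: sub.B2.B_simps[OF FV])
    have M_eq: "M = (1/h) *\<^sub>R (n - (1 / (b * w)) *\<^sub>R ?xi - (1 / (2 * b\<^sup>2 * w)) *\<^sub>R ?l)"
      by (rule null_vector_unique[OF lorentz_amb[OF d_atlas FV] fp(3) _ _ _ fp(2) n b h(1) M])
         (simp_all add: A E(2) w_def)
    have "curvature_in d' \<gamma>' (N 0) = ?acc M / \<beta>"
      using cov_deriv_value[OF unit, of "N 0"] M(1) sub.B2.sym[OF FV, of M] FX
      unfolding M_def[symmetric] \<beta>_def by simp
    also have "?acc M = (1 / h) * (K - ?acc ?xi / (b * w) - P / (2 * b\<^sup>2 * w))"
      unfolding M_eq K_def P_def acc_l[symmetric] by (simp add: sub.B2.acc_simps[of "\<lambda>t. F (x t)" t, OF FV])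
    \<comment> \<open>The pairing with \<open>\<xi>\<close> is eliminated by \<open>accv\<close> in
      favour of \<open>acc g x (vel x t) t\<close>, which is half the derivative of the squared
      speed and so can be expanded in \<open>b\<close>.\<close>
    also have "K - ?acc ?xi / (b * w) - P / (2 * b\<^sup>2 * w)
        = (P - 2 * (P + b * ?acc ?xi) + 2 * (b\<^sup>2 * w) * K) / (2 * (b\<^sup>2 * w))"
      using b fp(1) by (simp add: divide_simps) (simp add: power2_eq_square algebra_simps)
    finally show "curvature_in d' \<gamma>' (N 0)
      = root 3 \<mu> * (P - 2 * acc g x (vel x t) t + 2 * \<beta> * K) / (2 * \<beta>\<^sup>2)"
      unfolding accv \<beta> h(4) by (simp add: power2_eq_square mult.assoc)
  qed
  obtain c' d' \<gamma>' \<epsilon>' U' \<eta>' N where fr: "curvature_frame S (\<gamma> t) c' d' \<gamma>' \<epsilon>' U' \<eta>'" "N_field S c' d' \<gamma>' \<epsilon>' \<eta>' N"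
    using first_kind_curvature_frame[OF t(2)] by blast
  show "\<mu> \<noteq> 0" using value_L[OF fr(1)] by blast
  show "kappa_L S (\<gamma> t) = P / (\<beta> * root 3 \<mu>)"
    unfolding kappa_L_def
  proof (rule the_equality)
    fix k assume "\<exists>c d \<gamma>' \<epsilon> U \<eta>. curvature_frame S (\<gamma> t) c d \<gamma>' \<epsilon> U \<eta> \<and>
     k = curvature_in d \<gamma>' (L_field S c d \<gamma>' \<eta> 0)"
    then show "k = P / (\<beta> * root 3 \<mu>)" using value_L by metis
  qed (use fr value_L in metis)
  show "kappa_N S (\<gamma> t) = root 3 \<mu> * (P - 2 * acc g x (vel x t) t + 2 * \<beta> * K) / (2 * \<beta>\<^sup>2)"
    unfolding kappa_N_def
  proof (rule the_equality)
    fix k assume "\<exists>c d \<gamma>' \<epsilon> U \<eta> N. curvature_frame S (\<gamma> t) c d \<gamma>' \<epsilon> U \<eta> \<and> N_field S c d \<gamma>' \<epsilon> \<eta> N \<and>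
     k = curvature_in d \<gamma>' (N 0)"
    then show "k = root 3 \<mu> * (P - 2 * acc g x (vel x t) t + 2 * \<beta> * K) / (2 * \<beta>\<^sup>2)" using value_N by metis
  qed (use fr value_N in metis)
qed

end

section \<open>Asymptotics\<close>

lemma filterlim_cube_at_bot:
  fixes k :: "'a \<Rightarrow> real"
  assumes "filterlim (\<lambda>t. k t ^ 3) at_bot A"
  shows "filterlim k at_bot A"
  unfolding filterlim_at_bot
proof
  fix Z :: real
  have "eventually (\<lambda>t. k t ^ 3 \<le> Z ^ 3) A" using assms unfolding filterlim_at_bot by blast
  then show "eventually (\<lambda>t. k t \<le> Z) A"
    by eventually_elim (metis odd_numeral odd_real_root_power_cancel real_root_le_iff zero_less_numeral)
qed

lemma filterlim_abs_cube_at_top: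
  fixes k :: "'a \<Rightarrow> real"
  assumes "filterlim (\<lambda>t. \<bar>k t ^ 3\<bar>) at_top A"
  shows "filterlim (\<lambda>t. \<bar>k t\<bar>) at_top A"
  unfolding filterlim_at_top
proof
  fix Z :: real
  have "eventually (\<lambda>t. Z ^ 3 \<le> \<bar>k t\<bar> ^ 3) A"
    using assms unfolding filterlim_at_top power_abs by blast
  then show "eventually (\<lambda>t. Z \<le> \<bar>k t\<bar>) A"
    by eventually_elim (metis odd_numeral odd_real_root_power_cancel real_root_le_iff zero_less_numeral)
qed

lemma tendsto_cube_0:
  fixes k :: "'a \<Rightarrow> real"
  assumes "((\<lambda>t. k t ^ 3) \<longlongrightarrow> 0) A"
  shows "(k \<longlongrightarrow> 0) A"
proof -
  have "((\<lambda>t. root 3 (k t ^ 3)) \<longlongrightarrow> root 3 0) A" by (rule tendsto_real_root[OF assms])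
  then show ?thesis by (simp add: odd_real_root_power_cancel)
qed

lemma smooth_real_has_derivative:
  fixes f :: "real \<Rightarrow> real"
  shows "smooth_on f I \<Longrightarrow> t \<in> I \<Longrightarrow> (f has_real_derivative vel f t) (at t)"
  using smooth_curve_has_vector_derivative by (simp add: has_real_derivative_iff_has_vector_derivative)

text \<open>The Lagrange remainder turns the quotient into an n-th derivative at a point no farther
  from 0 than \<open>t\<close>, and continuity does the rest. The limit may be 0, which matters when
  the order of vanishing is only known to be at least 3.\<close>

lemma leading_Taylor_coefficient:
  fixes f :: "real \<Rightarrow> real"
  assumes f: "smooth_on f {-e<..<e}" and e: "e > 0" and 0: "\<And>m. m < n \<Longrightarrow> (vel ^^ m) f 0 = 0"
  shows "((\<lambda>t. f t / t ^ n) \<longlongrightarrow> (vel ^^ n) f 0 / fact n) (at 0)"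
proof -
  let ?I = "{-e<..<e}"
  have s: "smooth_on ((vel ^^ m) f) ?I" for m
    by (induction m) (auto intro!: f smooth_on_vector_derivative)
  have "isCont ((vel ^^ n) f) 0" using smooth_on_imp_continuous_at[OF s] e by simp
  then have c: "((vel ^^ n) f \<longlongrightarrow> (vel ^^ n) f 0) (at 0)" by (simp add: isCont_def)
  have ex: "\<exists>r. \<bar>r\<bar> \<le> \<bar>t\<bar> \<and> f t / t ^ n = (vel ^^ n) f r / fact n" if t: "t \<in> ?I" "t \<noteq> 0" for t :: real
  proof -
    have "\<exists>r. \<bar>r\<bar> \<le> \<bar>t\<bar> \<and> f t = (\<Sum>m<n. (vel ^^ m) f 0 / fact m * t ^ m) + (vel ^^ n) f r / fact n * t ^ n"
    proof (rule Maclaurin_bi_le, simp, intro allI impI)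
      fix m :: nat and r :: real assume "m < n \<and> \<bar>r\<bar> \<le> \<bar>t\<bar>"
      then have "r \<in> ?I" using t by (auto simp: abs_if split: if_splits)
      then show "((vel ^^ m) f has_real_derivative (vel ^^ Suc m) f r) (at r)"
        using smooth_real_has_derivative[OF s] by simp
    qed
    then show ?thesis using 0 t by auto
  qed
  show ?thesis
  proof (rule tendstoI)
    fix E :: real assume E: "E > 0"
    have "isCont (\<lambda>t. (vel ^^ n) f t / fact n) 0"
      using \<open>isCont ((vel ^^ n) f) 0\<close> by (intro continuous_intros) auto
    then obtain d where d: "d > 0"
      "\<And>r. \<bar>r\<bar> < d \<Longrightarrow> dist ((vel ^^ n) f r / fact n) ((vel ^^ n) f 0 / fact n) < E"
      unfolding continuous_at_eps_delta using E by (auto simp: dist_real_def)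
    show "eventually (\<lambda>t. dist (f t / t ^ n) ((vel ^^ n) f 0 / fact n) < E) (at 0)"
      unfolding eventually_at
    proof (intro exI[of _ "min d e"] conjI ballI impI)
      fix t :: real assume "t \<noteq> 0 \<and> dist t 0 < min d e"
      then have t: "t \<in> ?I" "t \<noteq> 0" "\<bar>t\<bar> < d" by auto
      then obtain r where "\<bar>r\<bar> \<le> \<bar>t\<bar>" "f t / t ^ n = (vel ^^ n) f r / fact n" using ex by blast
      then show "dist (f t / t ^ n) ((vel ^^ n) f 0 / fact n) < E" using d(2)[of r] t by simp
    qed (use d e in auto)
  qed
qed

text \<open>All three limits are read off the cubes of the curvatures, which are free of roots.\<close>

locale curvature_asymptotics =
  fixes b w \<nu> C K kL kN :: "real \<Rightarrow> real" and e :: real and T :: "real set"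
  assumes e: "e > 0"
    and smooth: "smooth_on b {-e<..<e}" "smooth_on w {-e<..<e}" "smooth_on \<nu> {-e<..<e}"
      "smooth_on C {-e<..<e}" "smooth_on K {-e<..<e}"
    and b0: "b 0 = 0" and \<nu>0: "\<nu> 0 \<noteq> 0" and w_pos: "\<And>t. t \<in> {-e<..<e} \<Longrightarrow> w t > 0"
    and T: "T \<subseteq> {-e<..<e}" "\<And>t. t \<in> T \<Longrightarrow> b t \<noteq> 0"
    and kL: "\<And>t. t \<in> T \<Longrightarrow> kL t = (b t * \<nu> t / 2 + (b t)\<^sup>2 * C t) / ((b t)\<^sup>2 * w t * root 3 (- (b t * \<nu> t)))"
    and kN: "\<And>t. t \<in> T \<Longrightarrow> kN t = root 3 (- (b t * \<nu> t)) *
      (b t * \<nu> t / 2 + (b t)\<^sup>2 * C t - (2 * b t * vel b t * w t + (b t)\<^sup>2 * vel w t) + 2 * ((b t)\<^sup>2 * w t) * K t)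
      / (2 * ((b t)\<^sup>2 * w t)\<^sup>2)"
begin

abbreviation A where "A \<equiv> at 0 within T"

text \<open>What remains of the bracket in the formula for \<open>kN\<close> after one factor
  \<open>b t\<close> is split off. The cube of \<open>kN\<close> is then a function smooth up to 0
  divided by \<open>b t ^ 8\<close>.\<close>

definition M where "M t = \<nu> t / 2 + b t * C t - 2 * vel b t * w t - b t * vel w t + 2 * b t * w t * K t"

lemma tendsto_smooth: "smooth_on f {-e<..<e} \<Longrightarrow> (f \<longlongrightarrow> f 0) A" for f :: "real \<Rightarrow> real"
  using smooth_on_imp_continuous_at[of f "{-e<..<e}" 0] e
  by (simp add: continuous_at_imp_continuous_at_within continuous_within[symmetric])

lemma smooth_M: "smooth_on M {-e<..<e}"
  unfolding M_def by (intro smooth_intros smooth) auto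

text \<open>\<open>b\<close> may change sign at 0, but the exponents that occur, 4 and 8, are even,
  so the pole has the same sign on both sides. Hence a limit \<open>at_bot\<close>, and not merely
  divergence of the absolute value, can result.\<close>

lemma inverse_b_power: "even n \<Longrightarrow> n > 0 \<Longrightarrow> filterlim (\<lambda>t. inverse (b t ^ n)) at_top A"
proof (rule filterlim_inverse_at_top)
  assume n: "even n" "n > 0"
  show "((\<lambda>t. b t ^ n) \<longlongrightarrow> 0) A"
    using tendsto_power[OF tendsto_smooth[OF smooth(1)], of n] b0 n by (simp add: power_0_left)
  show "eventually (\<lambda>t. 0 < b t ^ n) A"
    using T n by (auto simp: eventually_at_filter zero_less_power_eq intro!: always_eventually)
qed

lemma kL_cube: "t \<in> T \<Longrightarrow> kL t ^ 3 = - ((\<nu> t / 2 + b t * C t) ^ 3 / (w t ^ 3 * \<nu> t)) * inverse (b t ^ 4)"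
proof -
  assume t: "t \<in> T"
  have r: "root 3 (- (b t * \<nu> t)) ^ 3 = - (b t * \<nu> t)" by (rule odd_real_root_pow) simp
  have s: "b t * \<nu> t / 2 + (b t)\<^sup>2 * C t = b t * (\<nu> t / 2 + b t * C t)"
    by (simp add: power2_eq_square algebra_simps)
  have alg: "(a * u) ^ 3 / ((a\<^sup>2 * v) ^ 3 * - (a * y)) = - (u ^ 3 / (v ^ 3 * y)) * inverse (a ^ 4)"
    if "a \<noteq> 0" for a u v y :: real
  proof -
    have "(a * u) ^ 3 / ((a\<^sup>2 * v) ^ 3 * - (a * y)) = (a ^ 3 * u ^ 3) / (a ^ 3 * - (v ^ 3 * y * a ^ 4))"
      by (simp add: eval_nat_numeral mult_ac)
    also have "\<dots> = u ^ 3 / - (v ^ 3 * y * a ^ 4)"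
      using that by (intro mult_divide_mult_cancel_left) simp
    finally show ?thesis
      by (simp only: divide_inverse inverse_mult_distrib inverse_minus_eq mult.assoc minus_mult_left minus_mult_right)
  qed
  have "kL t ^ 3 = (b t * (\<nu> t / 2 + b t * C t)) ^ 3 / (((b t)\<^sup>2 * w t) ^ 3 * - (b t * \<nu> t))"
    unfolding kL[OF t] s power_divide power_mult_distrib[of _ "root 3 _"] r ..
  also have "\<dots> = - ((\<nu> t / 2 + b t * C t) ^ 3 / (w t ^ 3 * \<nu> t)) * inverse (b t ^ 4)"
    by (rule alg[OF T(2)[OF t]])
  finally show ?thesis .
qed

lemma kN_cube: "t \<in> T \<Longrightarrow> kN t ^ 3 = - (\<nu> t * M t ^ 3 / (8 * w t ^ 6)) * inverse (b t ^ 8)"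
proof -
  assume t: "t \<in> T"
  have r: "root 3 (- (b t * \<nu> t)) ^ 3 = - (b t * \<nu> t)" by (rule odd_real_root_pow) simp
  have M: "b t * \<nu> t / 2 + (b t)\<^sup>2 * C t - (2 * b t * vel b t * w t + (b t)\<^sup>2 * vel w t) + 2 * ((b t)\<^sup>2 * w t) * K t
      = b t * M t"
    by (simp add: M_def power2_eq_square algebra_simps)
  have alg: "(- (a * y)) * (a * u) ^ 3 / (2 * (a\<^sup>2 * v)\<^sup>2) ^ 3 = - (y * u ^ 3 / (8 * v ^ 6)) * inverse (a ^ 8)"
    if "a \<noteq> 0" for a u v y :: real
  proof -
    have "(2 * (a\<^sup>2 * v)\<^sup>2) ^ 3 = 8 * a ^ 12 * v ^ 6"
      by (simp add: power_mult_distrib power_mult[symmetric])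
    also have "\<dots> = a ^ 4 * (8 * v ^ 6 * a ^ 8)" by (simp flip: power_add)
    finally have den: "(2 * (a\<^sup>2 * v)\<^sup>2) ^ 3 = a ^ 4 * (8 * v ^ 6 * a ^ 8)" .
    have num: "(- (a * y)) * (a * u) ^ 3 = a ^ 4 * - (y * u ^ 3)"
      by (simp add: eval_nat_numeral mult_ac)
    have "(- (a * y)) * (a * u) ^ 3 / (2 * (a\<^sup>2 * v)\<^sup>2) ^ 3 = - (y * u ^ 3) / (8 * v ^ 6 * a ^ 8)"
      unfolding num den using that by (intro mult_divide_mult_cancel_left) simp
    then show ?thesis
      by (simp only: divide_inverse inverse_mult_distrib mult.assoc minus_mult_left)
  qed
  have "kN t ^ 3 = (- (b t * \<nu> t)) * (b t * M t) ^ 3 / (2 * ((b t)\<^sup>2 * w t)\<^sup>2) ^ 3"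
    unfolding kN[OF t] M power_divide power_mult_distrib[of "root 3 _"] r ..
  also have "\<dots> = - (\<nu> t * M t ^ 3 / (8 * w t ^ 6)) * inverse (b t ^ 8)"
    by (rule alg[OF T(2)[OF t]])
  finally show ?thesis .
qed

lemma cong_T: "(\<And>t. t \<in> T \<Longrightarrow> f t = h t) \<Longrightarrow> filterlim h G A \<Longrightarrow> filterlim f G A" for f h :: "real \<Rightarrow> real" and G
  by (subst filterlim_cong[of G G A A f h]) (auto simp: eventually_at_filter)

lemma w0: "w 0 > 0"
  using w_pos e by simp

lemma kL_at_bot: "filterlim kL at_bot A"
proof (rule filterlim_cube_at_bot, rule cong_T[OF kL_cube])
  have l: "((\<lambda>t. - ((\<nu> t / 2 + b t * C t) ^ 3 / (w t ^ 3 * \<nu> t))) \<longlongrightarrow> - ((\<nu> 0 / 2 + b 0 * C 0) ^ 3 / (w 0 ^ 3 * \<nu> 0))) A"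
    using w0 \<nu>0 by (intro tendsto_intros tendsto_smooth smooth) auto
  \<comment> \<open>At 0 this is the cube of \<open>\<nu> / 2\<close> divided by
    \<open>\<nu>\<close>, up to a positive factor; the unknown sign of \<open>\<nu>\<close>
    disappears in the square.\<close>
  have "(\<nu> 0 / 2 + b 0 * C 0) ^ 3 / (w 0 ^ 3 * \<nu> 0) = (\<nu> 0)\<^sup>2 / (8 * w 0 ^ 3)"
    using \<nu>0 by (simp add: b0 power_divide power3_eq_cube power2_eq_square)
  then have "- ((\<nu> 0 / 2 + b 0 * C 0) ^ 3 / (w 0 ^ 3 * \<nu> 0)) < 0"
    using w0 \<nu>0 by simp
  then show "filterlim (\<lambda>t. - ((\<nu> t / 2 + b t * C t) ^ 3 / (w t ^ 3 * \<nu> t)) * inverse (b t ^ 4)) at_bot A"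
    by (rule filterlim_tendsto_neg_mult_at_bot[OF l _ inverse_b_power]) auto
qed

lemma kN_at_bot:
  assumes "vel b 0 = 0"
  shows "filterlim kN at_bot A"
proof (rule filterlim_cube_at_bot, rule cong_T[OF kN_cube])
  have l: "((\<lambda>t. - (\<nu> t * M t ^ 3 / (8 * w t ^ 6))) \<longlongrightarrow> - (\<nu> 0 * M 0 ^ 3 / (8 * w 0 ^ 6))) A"
    using w0 by (intro tendsto_intros tendsto_smooth smooth smooth_M) auto
  have M0: "M 0 = \<nu> 0 / 2" using assms b0 by (simp add: M_def)
  have "\<nu> 0 * M 0 ^ 3 / (8 * w 0 ^ 6) = ((\<nu> 0)\<^sup>2)\<^sup>2 / (64 * w 0 ^ 6)"
    unfolding M0 by (simp add: power_divide power3_eq_cube power2_eq_square)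
  then have "- (\<nu> 0 * M 0 ^ 3 / (8 * w 0 ^ 6)) < 0"
    using w0 \<nu>0 by simp
  then show "filterlim (\<lambda>t. - (\<nu> t * M t ^ 3 / (8 * w t ^ 6)) * inverse (b t ^ 8)) at_bot A"
    by (rule filterlim_tendsto_neg_mult_at_bot[OF l _ inverse_b_power]) auto
qed

text \<open>When \<open>b\<close> vanishes to first order and \<open>M\<close> to order
  \<open>n\<close>, the cube of \<open>kN\<close> is comparable to \<open>t\<close> to the power
  \<open>3 n - 8\<close>. This exponent is never 0, so a finite nonzero limit cannot occur.\<close>

lemma kN_dichotomy: "(kN \<longlongrightarrow> 0) A \<or> filterlim (\<lambda>t. \<bar>kN t\<bar>) at_top A"
proof (cases "vel b 0 = 0")
  case True
  have "filterlim (\<lambda>t. \<bar>kN t\<bar>) at_top A"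
    using filterlim_compose[OF filterlim_abs_real, unfolded comp_def] kN_at_bot[OF True]
    by (metis filterlim_at_bot_imp_at_infinity filterlim_at_infinity_imp_norm_at_top real_norm_def[abs_def] filterlim_cong)
  then show ?thesis ..
next
  case False
  \<comment> \<open>The order of vanishing of \<open>M\<close>, cut off at 3: the order may be
    infinite, and from 3 on the exponent \<open>3 n - 8\<close> is positive anyway.\<close>
  define n where "n = (LEAST n. n = 3 \<or> (vel ^^ n) M 0 \<noteq> 0)"
  have n: "n = 3 \<or> (vel ^^ n) M 0 \<noteq> 0" unfolding n_def by (rule LeastI[of _ 3]) simp
  have n3: "n \<le> 3" unfolding n_def by (rule Least_le) simp
  have below: "(vel ^^ m) M 0 = 0" if "m < n" for m
    using not_less_Least[OF that[unfolded n_def]] by blast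
  define l where "l = (vel ^^ n) M 0 / fact n"
  have AA: "(f \<longlongrightarrow> r) (at 0) \<Longrightarrow> (f \<longlongrightarrow> r) A" for f and r :: real
    using tendsto_mono[OF at_le[OF subset_UNIV]] by blast
  have Ml: "((\<lambda>t. M t / t ^ n) \<longlongrightarrow> l) A"
    unfolding l_def by (rule AA[OF leading_Taylor_coefficient[OF smooth_M e below]])
  have bl: "((\<lambda>t. b t / t ^ 1) \<longlongrightarrow> (vel ^^ 1) b 0 / fact 1) A"
    by (rule AA[OF leading_Taylor_coefficient[OF smooth(1) e]]) (use b0 in auto)
  then have bl: "((\<lambda>t. b t / t) \<longlongrightarrow> vel b 0) A" by simp
  define Q where "Q t = - (\<nu> t * (M t / t ^ n) ^ 3 / (8 * w t ^ 6 * (b t / t) ^ 8))" for t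
  define q where "q = - (\<nu> 0 * l ^ 3 / (8 * w 0 ^ 6 * (vel b 0) ^ 8))"
  have Q: "(Q \<longlongrightarrow> q) A"
    unfolding Q_def q_def using w0 False by (intro tendsto_intros tendsto_smooth smooth Ml bl) auto
  have T0: "t \<noteq> 0" if "t \<in> T" for t using T(2)[OF that] b0 by auto
  have cube: "kN t ^ 3 = Q t * (t ^ (3 * n) / t ^ 8)" if t: "t \<in> T" for t
  proof -
    have "Q t * (t ^ (3 * n) / t ^ 8) = - (\<nu> t * M t ^ 3 / (8 * w t ^ 6)) * inverse (b t ^ 8)"
      unfolding Q_def using T0[OF t]
      by (simp add: power_divide power_mult[symmetric] mult.commute[of n 3] divide_simps)
    then show ?thesis using kN_cube[OF t] by simp
  qed
  show ?thesis
  proof (cases "n = 3")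
    case True
    have "((\<lambda>t. Q t * t) \<longlongrightarrow> q * 0) A" by (intro tendsto_mult Q tendsto_ident_at)
    then have "((\<lambda>t. Q t * t) \<longlongrightarrow> 0) A" by simp
    then have "((\<lambda>t. kN t ^ 3) \<longlongrightarrow> 0) A"
      by (rule cong_T[rotated]) (use cube T0 True in \<open>simp add: eval_nat_numeral\<close>)
    then show ?thesis using tendsto_cube_0 by blast
  next
    case n': False
    then have "n \<le> 2" "l \<noteq> 0" using n n3 by (auto simp: l_def)
    have q: "\<bar>q\<bar> > 0" using \<open>l \<noteq> 0\<close> \<nu>0 w0 False by (simp add: q_def)
    \<comment> \<open>The order of the pole that remains; the subtraction of naturals is exact
      because \<open>n \<le> 2\<close>.\<close>
    define k where "k = 8 - 3 * n"
    have k: "k > 0" "8 = 3 * n + k" using \<open>n \<le> 2\<close> by (auto simp: k_def)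
    have "((\<lambda>t. \<bar>t\<bar> ^ k) \<longlongrightarrow> \<bar>0\<bar> ^ k) A" by (intro tendsto_intros)
    then have "filterlim (\<lambda>t. inverse (\<bar>t\<bar> ^ k)) at_top A"
      using k T0 by (intro filterlim_inverse_at_top) (auto simp: eventually_at_filter power_0_left)
    then have "filterlim (\<lambda>t. \<bar>Q t\<bar> * inverse (\<bar>t\<bar> ^ k)) at_top A"
      by (rule filterlim_tendsto_pos_mult_at_top[OF tendsto_rabs[OF Q] q])
    then have "filterlim (\<lambda>t. \<bar>kN t ^ 3\<bar>) at_top A"
    proof (rule cong_T[rotated])
      fix t assume t: "t \<in> T"
      have "t ^ (3 * n) / t ^ 8 = inverse (t ^ k)"
        unfolding k(2) power_add using T0[OF t] by (simp add: field_simps)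
      then show "\<bar>kN t ^ 3\<bar> = \<bar>Q t\<bar> * inverse (\<bar>t\<bar> ^ k)"
        unfolding cube[OF t] by (simp add: abs_mult power_abs)
    qed
    then show ?thesis using filterlim_abs_cube_at_top by blast
  qed
qed

end

text \<open>Metric compatibility, valid for degenerate forms too: with \<open>W\<close> the velocity
  itself, the two \<open>dform\<close> terms in \<open>acc\<close> add up to half of one of
  them.\<close>

lemma (in form_field) has_derivative_energy:
  assumes I: "open I" "t \<in> I" and x: "smooth_on x I" "\<And>s. s \<in> I \<Longrightarrow> x s \<in> V"
  shows "((\<lambda>s. B (x s) (vel x s) (vel x s)) has_real_derivative 2 * acc B x (vel x t) t) (at t)"
proof -
  have xV: "x t \<in> V" using I x by blast
  have v: "(vel x has_derivative (\<lambda>r. r *\<^sub>R vel (vel x) t)) (at t)" "(x has_derivative (\<lambda>r. r *\<^sub>R vel x t)) (at t)"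
    using smooth_curve_has_vector_derivative[OF smooth_on_vector_derivative[OF I(1) x(1)] I(2)]
      smooth_curve_has_vector_derivative[OF x(1) I(2)] by (simp_all add: has_vector_derivative_def)
  have "(\<lambda>r. dform B (x t) (r *\<^sub>R vel x t) (vel x t) (vel x t) + B (x t) (r *\<^sub>R vel (vel x) t) (vel x t)
      + B (x t) (vel x t) (r *\<^sub>R vel (vel x) t)) = (*) (2 * acc B x (vel x t) t)"
    by (auto simp: acc_def B_simps[OF xV] dform_simps[OF xV] sym[OF xV, of "vel x t"] algebra_simps)
  then show ?thesis
    using has_derivative_along[OF xV v(2,1,1)] by (simp add: has_field_derivative_def)
qed

lemma (in form_field) dform_null_along:
  assumes I: "open I" "t \<in> I" and x: "smooth_on x I" "\<And>s. s \<in> I \<Longrightarrow> x s \<in> V"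
    and E: "smooth_on E I" "\<And>s w. s \<in> I \<Longrightarrow> B (x s) (E s) w = 0"
  shows "dform B (x t) (vel x t) (E t) (E t) = 0"
proof -
  have xV: "x t \<in> V" using I x by blast
  have "((\<lambda>s. B (x s) (E s) (E s)) has_derivative
      (\<lambda>r. dform B (x t) (FD x t r) (E t) (E t) + B (x t) (FD E t r) (E t) + B (x t) (E t) (FD E t r))) (at t)"
    by (rule has_derivative_along[OF xV smooth_on_has_derivative[OF x(1) I(2)]
        smooth_on_has_derivative[OF E(1) I(2)] smooth_on_has_derivative[OF E(1) I(2)]])
  moreover have "((\<lambda>s. B (x s) (E s) (E s)) has_derivative (\<lambda>r. 0)) (at t)"
    by (rule has_derivative_transform_within_open[OF has_derivative_const[of 0] I]) (simp add: E(2))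
  ultimately have "(\<lambda>r. dform B (x t) (FD x t r) (E t) (E t) + B (x t) (FD E t r) (E t) + B (x t) (E t) (FD E t r)) = (\<lambda>r. 0)"
    by (rule has_derivative_unique)
  from fun_cong[OF this, of 1] show ?thesis
    using E(2)[OF I(2)] sym[OF xV, of _ "E t"] FD_curve[OF x(1) I(2)] by simp
qed

section \<open>Asymptotics along the curve through a second-kind point\<close>

context char_frame
begin

text \<open>Although the curvatures are meaningful only at parameters of first-kind points, every
  coefficient in their formulas is smooth on a full interval around 0. The velocity at 0 being null
  gives \<open>b 0 = 0\<close>, and non-degeneracy gives \<open>\<nu> 0 \<noteq> 0\<close>.\<close>

lemma curvature_asymptotics_second_kind:
  assumes nd: "nondegenerate_point S q" and dep: "det2 (vel x 0) (\<eta> (x 0)) = 0"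
  obtains e b w \<nu> C K where "e \<le> \<epsilon>"
    "curvature_asymptotics b w \<nu> C K (\<lambda>t. kappa_L S (\<gamma> t)) (\<lambda>t. kappa_N S (\<gamma> t)) e
      {t \<in> {-e<..<e}. first_kind S (\<gamma> t)}"
    "vel (\<lambda>t. det2 (vel x t) (\<eta> (x t))) 0 = 0 \<Longrightarrow> vel b 0 = 0"
proof -
  obtain \<xi> where \<xi>: "det2 \<xi> (\<eta> (x 0)) \<noteq> 0" using exists_det2_nonzero[OF \<eta>_nonzero[OF zero_I]] .
  define D where "D t = det2 \<xi> (\<eta> (x t))" for t
  define \<delta> where "\<delta> t = det2 (vel x t) (\<eta> (x t))" for t
  define H where "H t = det2 \<xi> (vel x t)" for t
  have s\<eta>: "smooth_on (\<lambda>t. \<eta> (x t)) I"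
    by (rule smooth_on_compose[OF U(3) smooth_x open_I U(1) x_U])
  have sv: "smooth_on (vel x) I" by (intro smooth_intros open_I smooth_x)
  have sD: "smooth_on D I" "smooth_on \<delta> I" "smooth_on H I"
    unfolding D_def \<delta>_def H_def det2_def by (intro smooth_intros open_I s\<eta> sv)+
  have split: "vel x t = (\<delta> t / D t) *\<^sub>R \<xi> + (H t / D t) *\<^sub>R \<eta> (x t)" if "D t \<noteq> 0" for t
    using vec2_cramer[of \<xi> "\<eta> (x t)" "vel x t"] that unfolding D_def \<delta>_def H_def by simp
  have D0: "D 0 \<noteq> 0" using \<xi> by (simp add: D_def)
  have \<delta>0: "\<delta> 0 = 0" using dep by (simp add: \<delta>_def)
  have "H 0 \<noteq> 0" using split[OF D0] \<delta>0 vel_x_nonzero[OF zero_I] by auto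
  \<comment> \<open>\<open>D\<close> must stay nonzero to be divided by, and \<open>H\<close> to
    keep \<open>E\<close> nonzero. At 0 the velocity is a nonzero multiple of \<open>\<eta>\<close>,
    whence \<open>H 0 \<noteq> 0\<close>.\<close>
  then have "D 0 * H 0 \<in> - {0}" using D0 by simp
  moreover have "isCont (\<lambda>t. D t * H t) 0"
    by (rule smooth_on_imp_continuous_at[OF smooth_on_mult[OF open_I sD(1,3)] zero_I])
  ultimately obtain e1' where e1': "e1' > 0" "\<And>t. \<bar>t\<bar> < e1' \<Longrightarrow> D t * H t \<in> - {0}"
    using eventually_small_interval[of "\<lambda>t. D t * H t" "- {0}"] by blast
  define e1 where "e1 = min e1' \<epsilon>"
  let ?J1 = "{-e1<..<e1}"
  have e1: "e1 > 0" "e1 \<le> \<epsilon>" "\<And>t. t \<in> ?J1 \<Longrightarrow> D t \<noteq> 0 \<and> H t \<noteq> 0"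
    using e1' \<epsilon>_pos by (force simp: e1_def)+
  have I1: "?J1 \<subseteq> I" using e1 by auto
  define b where "b t = \<delta> t / D t" for t
  define E where "E t = vel x t - b t *\<^sub>R \<xi>" for t
  have sb1: "smooth_on b ?J1"
    unfolding b_def using e1(3) by (intro smooth_intros smooth_on_subset[OF sD(2) I1] smooth_on_subset[OF sD(1) I1]) auto
  have sE1: "smooth_on E ?J1"
    unfolding E_def by (intro smooth_intros sb1 smooth_on_subset[OF sv I1]) auto
  have vE: "vel x t = E t + b t *\<^sub>R \<xi>" for t by (simp add: E_def)
  have E\<eta>: "E t = (H t / D t) *\<^sub>R \<eta> (x t)" if "t \<in> ?J1" for t
    using split[of t] e1(3)[OF that] unfolding E_def b_def by (metis add_diff_cancel_left')
  have Enull: "g (x t) (E t) w = 0" if "t \<in> ?J1" for t w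
  proof -
    have "t \<in> I" using that I1 by blast
    then show ?thesis unfolding E\<eta>[OF that] using \<eta>_null x_V by (simp add: B_simps)
  qed
  have dE: "det2 \<xi> (E t) \<noteq> 0" if "t \<in> ?J1" for t
    using e1(3)[OF that] unfolding E\<eta>[OF that] by (simp add: det2_simps D_def)
  have b0: "b 0 = 0" by (simp add: b_def \<delta>0)
  let ?A = "\<lambda>t. amb_form S d (F (x t))"
  have z1: "0 \<in> ?J1" using e1 by simp
  \<comment> \<open>A constant seed for \<open>null_completion\<close>, chosen at 0 and usable
    nearby by continuity; this is what makes \<open>n\<close> smooth in the parameter.\<close>
  obtain z1 where z1: "?A 0 z1 (FD F (x 0) (E 0)) \<noteq> 0"
    using lorentz_nondegenerate[OF lorentz_amb[OF d_atlas sub.maps[OF x_V[OF zero_I]]]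
      first_form_positive(3)[OF c_atlas d_atlas x_V[OF zero_I] Enull[OF z1] dE[OF z1]]] .
  have sF: "smooth_on (\<lambda>t. F (x t)) I"
    by (rule smooth_on_compose[OF sub.smooth_\<phi> smooth_x open_I open_V x_V])
  have sA: "smooth_on (\<lambda>t. ?A t z1 (FD F (x t) (E t))) ?J1"
    using I1 x_V sub.maps
    by (intro sub.B2.smooth_along smooth_on_const smooth_on_subset[OF sF I1]
        smooth_on_FD_along[OF sub.smooth_\<phi> open_V] smooth_on_subset[OF smooth_x I1] sE1) auto
  have "isCont (\<lambda>t. ?A t z1 (FD F (x t) (E t))) 0"
    by (rule smooth_on_imp_continuous_at[OF sA]) (use e1 in simp)
  then obtain e2 where e2: "e2 > 0" "\<And>t. \<bar>t\<bar> < e2 \<Longrightarrow> ?A t z1 (FD F (x t) (E t)) \<in> - {0}"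
    using eventually_small_interval[of "\<lambda>t. ?A t z1 (FD F (x t) (E t))" "- {0}"] z1 by blast
  define e where "e = min e1 e2"
  have e: "e > 0" "e \<le> e1" "\<And>t. t \<in> {-e<..<e} \<Longrightarrow> ?A t z1 (FD F (x t) (E t)) \<noteq> 0"
    using e1 e2 by (auto simp: e_def)
  let ?J = "{-e<..<e}"
  have JI1: "?J \<subseteq> ?J1" and JI: "?J \<subseteq> I" using e e1 by auto
  have J1: "t \<in> ?J1" if "t \<in> ?J" for t using that JI1 by blast
  have J2: "t \<in> I" if "t \<in> ?J" for t using that JI by blast
  have oJ: "open ?J" by simp
  have xV: "x t \<in> V" and FV: "F (x t) \<in> map_of_chart d ` dom_of d" if "t \<in> ?J" for t
    using x_V[OF J2[OF that]] sub.maps by blast+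
  note sx = smooth_on_subset[OF smooth_x JI] and sE = smooth_on_subset[OF sE1 JI1]
    and sb = smooth_on_subset[OF sb1 JI1] and sFJ = smooth_on_subset[OF sF JI]
  define w where "w t = g (x t) \<xi> \<xi>" for t
  define \<nu> where "\<nu> t = dform g (x t) \<xi> (E t) (E t)" for t
  define C where "C t = dform g (x t) \<xi> \<xi> (E t) - dform g (x t) (E t) \<xi> \<xi> / 2" for t
  define n where "n t = null_completion (?A t) (FD F (x t) (E t)) (FD F (x t) \<xi>) z1" for t
  define K where "K t = acc (amb_form S d) (\<lambda>t. F (x t)) (n t) t" for t
  have w_pos: "w t > 0" if "t \<in> ?J" for t
    unfolding w_def
    by (rule first_form_positive(1)[OF c_atlas d_atlas xV[OF that] Enull[OF J1[OF that]] dE[OF J1[OF that]]])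
  have pullA: "?A t (FD F (x t) u) (FD F (x t) v) = g (x t) u v" if "t \<in> ?J" for t u v
    using sub.pull[OF xV[OF that]] by simp
  have n: "?A t (n t) (FD F (x t) (E t)) = 1" "?A t (n t) (FD F (x t) \<xi>) = 0" "?A t (n t) (n t) = 0" if t: "t \<in> ?J" for t
    unfolding n_def
    using null_completion[OF sub.B2.bilin[OF FV[OF t]] sub.B2.sym[OF FV[OF t]], of "FD F (x t) (E t)" "FD F (x t) \<xi>" z1]
      pullA[OF t] Enull[OF J1[OF t]] w_pos[OF t] e(3)[OF t] by (auto simp: w_def)
  have sl: "smooth_on (\<lambda>t. FD F (x t) (E t)) ?J" "smooth_on (\<lambda>t. FD F (x t) \<xi>) ?J"
    by (intro smooth_on_FD_along[OF sub.smooth_\<phi> open_V oJ sx] sE smooth_on_const oJ xV; assumption)+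
  \<comment> \<open>The intermediate vector of \<open>null_completion\<close>, before the correction
    along the null vector; smoothness is proved in these two stages.\<close>
  define u where "u t = (1 / ?A t z1 (FD F (x t) (E t))) *\<^sub>R
    (z1 - (?A t z1 (FD F (x t) \<xi>) / ?A t (FD F (x t) \<xi>) (FD F (x t) \<xi>)) *\<^sub>R FD F (x t) \<xi>)" for t
  have su: "smooth_on u ?J"
    unfolding u_def
    by (intro smooth_on_scaleR smooth_on_diff smooth_on_divide smooth_on_const sub.B2.smooth_along sFJ sl oJ FV; assumption?)
       (use e(3) pullA w_pos in \<open>force simp: w_def\<close>)+
  have "n t = u t - (?A t (u t) (u t) / 2) *\<^sub>R FD F (x t) (E t)" for t
    unfolding n_def null_completion_def u_def Let_def ..
  moreover have "smooth_on (\<lambda>t. u t - (?A t (u t) (u t) / 2) *\<^sub>R FD F (x t) (E t)) ?J"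
    by (intro smooth_on_scaleR smooth_on_diff smooth_on_divide smooth_on_const sub.B2.smooth_along sFJ sl su oJ FV; simp)
  ultimately have sn: "smooth_on n ?J" by presburger
  have \<nu>0: "\<nu> 0 \<noteq> 0"
  proof -
    have J0: "0 \<in> ?J" using e by simp
    obtain v where v: "FD (lam S c d) (x 0) v \<noteq> 0" using nondegenerate_FD_lam[OF nd coords] \<gamma>_0 by metis
    \<comment> \<open>\<open>\<xi>\<close> is transverse to the characteristic curve because
      \<open>H 0 \<noteq> 0\<close>, so by non-degeneracy \<open>lam\<close> changes to first order
      along it; \<open>dform_lam\<close> transfers this to \<open>\<nu>\<close>.\<close>
    have "FD (lam S c d) (x 0) \<xi> \<noteq> 0"
    proof
      assume 0: "FD (lam S c d) (x 0) \<xi> = 0"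
      obtain k where "\<xi> = k *\<^sub>R vel x 0"
        using kernel_1dim[OF FD_linear[OF smooth_lam[OF c_atlas d_atlas] xV[OF J0]] v FD_lam_vel[OF zero_I]
          vel_x_nonzero[OF zero_I] 0] .
      then show False using \<open>H 0 \<noteq> 0\<close> by (simp add: H_def det2_simps)
    qed
    then show ?thesis
      using dform_lam[OF c_atlas d_atlas xV[OF J0] Enull[OF J1[OF J0]], of \<xi> \<xi>] dE[OF J1[OF J0]]
      unfolding \<nu>_def by auto
  qed
  have core: "dform g (x t) (E t) (E t) (E t) = - (b t * \<nu> t)"
      "acc g x (E t) t = b t * \<nu> t / 2 + (b t)\<^sup>2 * C t"
      "g (x t) (vel x t) (vel x t) = (b t)\<^sup>2 * w t"
      "2 * acc g x (vel x t) t = 2 * b t * vel b t * w t + (b t)\<^sup>2 * vel w t"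
    if t: "t \<in> ?J" for t
  proof -
    note xt = xV[OF t] and En = Enull[OF J1[OF t]]
    have gE: "g (x t) v (E t) = 0" for v using En sym[OF xt] by metis
    have z: "dform g (x t) (vel x t) (E t) (E t) = 0"
      by (rule dform_null_along[OF oJ t sx xV sE Enull[OF J1]])
    then show \<mu>: "dform g (x t) (E t) (E t) (E t) = - (b t * \<nu> t)"
      unfolding vE[of t] \<nu>_def by (simp add: dform_simps[OF xt])
    have zz: "dform g (x t) (E t + b t *\<^sub>R \<xi>) (E t) (E t) = 0" using z unfolding vE[of t] .
    have dsym: "dform g (x t) v \<xi> (E t) = dform g (x t) v (E t) \<xi>" for v by (rule dform_sym[OF xt])
    have d1: "dform g (x t) (vel x t) (vel x t) (E t)
        = b t * dform g (x t) (E t) (E t) \<xi> + (b t)\<^sup>2 * dform g (x t) \<xi> \<xi> (E t)"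
    proof -
      have "dform g (x t) (vel x t) (vel x t) (E t)
        = dform g (x t) (vel x t) (E t) (E t) + b t * dform g (x t) (vel x t) \<xi> (E t)"
        by (subst (2) vE[of t]) (simp add: dform_simps[OF xt])
      also have "\<dots> = b t * (dform g (x t) (E t) \<xi> (E t) + b t * dform g (x t) \<xi> \<xi> (E t))"
        unfolding z by (subst vE[of t]) (simp add: dform_simps[OF xt])
      finally show ?thesis unfolding dsym[of "E t"] by (simp add: power2_eq_square algebra_simps)
    qed
    have d2: "dform g (x t) (E t) (vel x t) (vel x t) = - (b t * \<nu> t) + 2 * b t * dform g (x t) (E t) (E t) \<xi>
        + (b t)\<^sup>2 * dform g (x t) (E t) \<xi> \<xi>"
      unfolding vE[of t] \<mu>[symmetric] by (simp add: dform_simps[OF xt] dsym power2_eq_square algebra_simps)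
    \<comment> \<open>The acceleration is paired with the null vector and vanishes. The mixed terms
      linear in \<open>b\<close> in \<open>d1\<close> and half of \<open>d2\<close> cancel, which
      leaves \<open>b \<nu> / 2\<close>; the quadratic terms are collected in
      \<open>C\<close>.\<close>
    show "acc g x (E t) t = b t * \<nu> t / 2 + (b t)\<^sup>2 * C t"
      unfolding acc_def d1 d2 gE C_def by (simp add: field_simps)
    have \<beta>: "g (x s) (vel x s) (vel x s) = (b s)\<^sup>2 * w s" if s: "s \<in> ?J" for s
    proof -
      have "g (x s) v (E s) = 0" for v using Enull[OF J1[OF s]] sym[OF xV[OF s]] by metis
      then show ?thesis
        unfolding vE[of s] w_def using Enull[OF J1[OF s]] by (simp add: B_simps[OF xV[OF s]] power2_eq_square)
    qed
    then show "g (x t) (vel x t) (vel x t) = (b t)\<^sup>2 * w t" using t by blast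
    have sw: "smooth_on w ?J" unfolding w_def by (intro smooth_along smooth_on_const oJ sx xV; assumption)
    \<comment> \<open>The acceleration is not expanded; instead the squared speed is differentiated
      and compared with \<open>has_derivative_energy\<close>. The summand with \<open>vel b\<close>
      is of first order in \<open>b\<close>, like \<open>b \<nu> / 2\<close>, and it is what sets
      the \<open>L_3\<close> case apart.\<close>
    have "((\<lambda>s. (b s)\<^sup>2 * w s) has_real_derivative 2 * b t * vel b t * w t + (b t)\<^sup>2 * vel w t) (at t)"
      using smooth_real_has_derivative[OF sb t] smooth_real_has_derivative[OF sw t]
      by (auto intro!: derivative_eq_intros)
    moreover have "((\<lambda>s. (b s)\<^sup>2 * w s) has_real_derivative 2 * acc g x (vel x t) t) (at t)"
      by (rule has_field_derivative_transform_within_open[OF has_derivative_energy[OF oJ t sx xV] oJ t]) (use \<beta> in auto)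
    ultimately show "2 * acc g x (vel x t) t = 2 * b t * vel b t * w t + (b t)\<^sup>2 * vel w t"
      using DERIV_unique by blast
  qed
  show ?thesis
  proof (rule that)
    show "e \<le> \<epsilon>" using e e1 by simp
    show "vel b 0 = 0" if "vel (\<lambda>t. det2 (vel x t) (\<eta> (x t))) 0 = 0"
    proof -
      have "vel \<delta> 0 = 0" using that unfolding \<delta>_def[abs_def] .
      then have "(\<delta> has_real_derivative 0) (at 0)"
        using smooth_real_has_derivative[OF sD(2) zero_I] by simp
      from DERIV_divide[OF this smooth_real_has_derivative[OF sD(1) zero_I] D0]
      have "(b has_real_derivative 0) (at 0)" by (simp add: b_def[abs_def] \<delta>0)
      then show ?thesis by (simp add: has_real_derivative_iff_has_vector_derivative vector_derivative_at)
    qed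
    show "curvature_asymptotics b w \<nu> C K (\<lambda>t. kappa_L S (\<gamma> t)) (\<lambda>t. kappa_N S (\<gamma> t)) e
      {t \<in> ?J. first_kind S (\<gamma> t)}"
    proof
      show "smooth_on w ?J" unfolding w_def by (intro smooth_along smooth_on_const oJ sx xV; assumption)
      show "smooth_on \<nu> ?J" unfolding \<nu>_def by (intro smooth_dform_along smooth_on_const oJ sx sE xV; assumption)
      show "smooth_on C ?J" unfolding C_def
        by (intro smooth_on_diff smooth_on_divide smooth_dform_along smooth_on_const oJ sx sE xV; simp)
      show "smooth_on K ?J" unfolding K_def by (intro sub.B2.smooth_acc oJ sFJ sn FV; assumption)
    next
      fix t assume "t \<in> {t \<in> ?J. first_kind S (\<gamma> t)}"
      then have t: "t \<in> ?J" "first_kind S (\<gamma> t)" by auto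
      note kf = kappa_formula[OF J2[OF t(1)] t(2) vE Enull[OF J1[OF t(1)]] dE[OF J1[OF t(1)]] n(1,3,2)[OF t(1)]]
      show "b t \<noteq> 0" by (rule kf(1))
      show "kappa_L S (\<gamma> t) = (b t * \<nu> t / 2 + (b t)\<^sup>2 * C t) / ((b t)\<^sup>2 * w t * root 3 (- (b t * \<nu> t)))"
        unfolding kf(3) core[OF t(1)] ..
      show "kappa_N S (\<gamma> t) = root 3 (- (b t * \<nu> t)) *
        (b t * \<nu> t / 2 + (b t)\<^sup>2 * C t - (2 * b t * vel b t * w t + (b t)\<^sup>2 * vel w t) + 2 * ((b t)\<^sup>2 * w t) * K t)
        / (2 * ((b t)\<^sup>2 * w t)\<^sup>2)"
        unfolding kf(4) core[OF t(1)] K_def ..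
    qed (use e sb b0 \<nu>0 w_pos in auto)
  qed
qed

text \<open>Limits at \<open>q\<close> run over points, the asymptotics over parameters. By
  \<open>zero_set_local_graph\<close> every lightlike point close to \<open>q\<close> is
  \<open>\<gamma> t\<close> with \<open>t\<close> small, so the filter at \<open>q\<close> is finer
  than the image of the parameter filter.\<close>

lemma filterlim_first_kind_near:
  assumes nd: "nondegenerate_point S q" and e: "e \<le> \<epsilon>"
    and lim: "filterlim (\<lambda>t. f (\<gamma> t)) G (at 0 within {t \<in> {-e<..<e}. first_kind S (\<gamma> t)})" and e0: "e > 0"
  shows "filterlim f G (first_kind_near S q)"
proof -
  let ?T = "{t \<in> {-e<..<e}. first_kind S (\<gamma> t)}"
  obtain v where v: "FD (lam S c d) (x 0) v \<noteq> 0" using nondegenerate_FD_lam[OF nd coords] \<gamma>_0 by metis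
  obtain \<epsilon>0 where \<epsilon>0: "0 < \<epsilon>0" "\<epsilon>0 \<le> \<epsilon>" "\<And>\<epsilon>'. 0 < \<epsilon>' \<Longrightarrow> \<epsilon>' \<le> \<epsilon>0 \<Longrightarrow>
      \<exists>W. open W \<and> x 0 \<in> W \<and> W \<subseteq> V \<and> {z\<in>W. lam S c d z = 0} = x ` {-\<epsilon>'<..<\<epsilon>'}"
    by (rule zero_set_local_graph[OF smooth_lam[OF c_atlas d_atlas] open_V v \<epsilon>_pos smooth_x x_V lam_x
        vel_x_nonzero[OF zero_I]]) blast+
  have "first_kind_near S q \<le> filtermap \<gamma> (at 0 within ?T)"
  proof (rule filter_leI)
    fix Q assume "eventually Q (filtermap \<gamma> (at 0 within ?T))"
    then obtain r where r: "r > 0" "\<And>t. t \<in> ?T \<Longrightarrow> t \<noteq> 0 \<Longrightarrow> \<bar>t\<bar> < r \<Longrightarrow> Q (\<gamma> t)"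
      unfolding eventually_filtermap eventually_at by (auto simp: dist_real_def)
    define r' where "r' = min (min r \<epsilon>0) e"
    have r': "r' > 0" "r' \<le> \<epsilon>0" "r' \<le> e" "r' \<le> r" using r \<epsilon>0 e0 by (auto simp: r'_def)
    obtain W where W: "open W" "x 0 \<in> W" "W \<subseteq> V" "{z\<in>W. lam S c d z = 0} = x ` {-r'<..<r'}"
      using \<epsilon>0(3)[OF r'(1,2)] by blast
    let ?W = "dom_of c \<inter> map_of_chart c -` W"
    have "Q p" if p: "p \<in> ?W" "p \<noteq> q" "first_kind S p" for p
    proof -
      have pp: "inv_chart c (map_of_chart c p) = p" using inv_chart_map[OF surf_atlas c_atlas] p by blast
      have "p \<in> LD S" using p(3) unfolding first_kind_def nondegenerate_point_def LD_def by blast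
      then have "map_of_chart c p \<in> {z\<in>W. lam S c d z = 0}"
        using LD_iff_lam[OF c_atlas d_atlas, of "map_of_chart c p"] p W(3) pp by auto
      then obtain t where t: "t \<in> {-r'<..<r'}" "map_of_chart c p = x t" using W(4) by blast
      have tI: "t \<in> I" "t \<in> {-e<..<e}" "\<bar>t\<bar> < r" using t(1) r' e by (auto simp: abs_if)
      have "p = \<gamma> t" using inv_x[OF tI(1)] unfolding t(2)[symmetric] pp .
      moreover have "t \<noteq> 0" using calculation p(2) \<gamma>_0 by auto
      ultimately show ?thesis using r(2)[of t] tI p(3) by simp
    qed
    moreover have "open ?W" by (rule open_chart_preimage[OF surf_atlas c_atlas W(1)])
    moreover have "q \<in> ?W" using W(2) coords \<gamma>_0 by (simp add: coords_at_def)
    ultimately show "eventually Q (first_kind_near S q)"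
      unfolding first_kind_near_def eventually_at_topological by blast
  qed
  moreover have "filterlim f G (filtermap \<gamma> (at 0 within ?T))"
    using lim by (simp add: filterlim_filtermap)
  ultimately show ?thesis using filterlim_mono[OF _ order_refl] by blast
qed

end

theorem theorem1:
  fixes S :: "('s::{t2_space, second_countable_topology}, 'm::{t2_space, second_countable_topology}) surface"
    and p :: 's
  assumes "mixed_type_surface S"
    and "admissible_second_kind S p"
  shows "filterlim (kappa_L S) at_bot (first_kind_near S p) \<and>
    ((kappa_N S \<longlongrightarrow> 0) (first_kind_near S p) \<or>
     filterlim (\<lambda>q. \<bar>kappa_N S q\<bar>) at_top (first_kind_near S p)) \<and>
    (\<not> L_point S 3 p \<longrightarrow> filterlim (kappa_N S) at_bot (first_kind_near S p))"
proof -
  have sk: "second_kind S p" using assms(2) unfolding admissible_second_kind_def by blast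
  obtain c d \<gamma> \<epsilon> U \<eta> where ad: "adapted S p c d \<gamma> \<epsilon> U \<eta>"
    and dep: "\<not> lin_indep_pair (velocity c \<gamma> 0) (field_along c \<gamma> \<eta> 0)" and nd: "nondegenerate_point S p"
    using sk unfolding second_kind_def by blast
  interpret char_frame S p c d \<gamma> \<epsilon> U \<eta>
    using assms(1) ad unfolding mixed_type_surface_def by unfold_locales blast+
  have vel: "velocity c \<gamma> t = vel x t" "field_along c \<gamma> \<eta> t = \<eta> (x t)" for t
    by (simp_all add: velocity_def field_along_def comp_def)
  have d0: "det2 (vel x 0) (\<eta> (x 0)) = 0" using dep unfolding lin_indep_pair_iff vel by blast
  obtain e b w \<nu> C K where e: "e \<le> \<epsilon>"
    and ca: "curvature_asymptotics b w \<nu> C K (\<lambda>t. kappa_L S (\<gamma> t)) (\<lambda>t. kappa_N S (\<gamma> t)) e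
      {t \<in> {-e<..<e}. first_kind S (\<gamma> t)}"
    and b': "vel (\<lambda>t. det2 (vel x t) (\<eta> (x t))) 0 = 0 \<Longrightarrow> vel b 0 = 0"
    by (rule curvature_asymptotics_second_kind[OF nd d0]) blast
  interpret ca: curvature_asymptotics b w \<nu> C K "\<lambda>t. kappa_L S (\<gamma> t)" "\<lambda>t. kappa_N S (\<gamma> t)" e
    "{t \<in> {-e<..<e}. first_kind S (\<gamma> t)}" by (rule ca)
  note lim = filterlim_first_kind_near[OF nd e _ ca.e]
  have "vel b 0 = 0" if "\<not> L_point S 3 p"
  proof (rule b')
    have \<delta>: "delta c \<gamma> \<eta> = (\<lambda>t. det2 (vel x t) (\<eta> (x t)))"
      by (simp add: delta_def det2_def vel fun_eq_iff)
    have "smooth_on (\<lambda>t. \<eta> (x t)) I"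
      by (rule smooth_on_compose[OF U(3) smooth_x open_I U(1) x_U])
    then have "smooth_on (\<lambda>t. det2 (vel x t) (\<eta> (x t))) I"
      unfolding det2_def by (intro smooth_intros open_I smooth_x)
    then have "deriv (\<lambda>t. det2 (vel x t) (\<eta> (x t))) 0 = vel (\<lambda>t. det2 (vel x t) (\<eta> (x t))) 0"
      using smooth_real_has_derivative[OF _ zero_I] DERIV_imp_deriv by blast
    moreover have "deriv (delta c \<gamma> \<eta>) 0 = 0"
    proof (rule ccontr)
      assume "deriv (delta c \<gamma> \<eta>) 0 \<noteq> 0"
      \<comment> \<open>For order 3 the vanishing conditions reduce to \<open>j = 0\<close>, which
        is \<open>d0\<close>. \<open>L_point\<close> is existential in the frame, so its negation
        can be applied to the frame at hand.\<close>
      then have "(\<forall>j \<le> 3 - 3. (deriv ^^ j) (delta c \<gamma> \<eta>) 0 = 0) \<and> (deriv ^^ (3 - 2)) (delta c \<gamma> \<eta>) 0 \<noteq> 0"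
        using d0 by (simp add: \<delta>)
      then have "L_point S 3 p"
        unfolding L_point_def using sk ad by blast
      then show False using that by blast
    qed
    ultimately show "vel (\<lambda>t. det2 (vel x t) (\<eta> (x t))) 0 = 0" unfolding \<delta> by simp
  qed
  then have "\<not> L_point S 3 p \<longrightarrow> filterlim (kappa_N S) at_bot (first_kind_near S p)"
    using lim[OF ca.kN_at_bot] by simp
  moreover have "(kappa_N S \<longlongrightarrow> 0) (first_kind_near S p) \<or>
      filterlim (\<lambda>q. \<bar>kappa_N S q\<bar>) at_top (first_kind_near S p)"
    using ca.kN_dichotomy
  proof
    assume "((\<lambda>t. kappa_N S (\<gamma> t)) \<longlongrightarrow> 0) ca.A"
    from lim[OF this] show ?thesis by simp
  next
    assume "filterlim (\<lambda>t. \<bar>kappa_N S (\<gamma> t)\<bar>) at_top ca.A"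
    from lim[where f = "\<lambda>q. \<bar>kappa_N S q\<bar>", OF this] show ?thesis by simp
  qed
  ultimately show ?thesis using lim[OF ca.kL_at_bot] by simp
qed

end
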